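(* Let $q(n)$ denote the number of partitions of $n$ into distinct parts. Then $q(n)$ is log-concave for $n\geq 33$, that is, $$q(n)^2\geq q(n-1)\,q(n+1)\qquad\text{for all integers } n\geq 33,$$ and $q(n)$ satisfies the higher order Tur\'an inequalities for $n\geq 121$, that is, $$4\left(q(n)^2-q(n-1)q(n+1)\right)\left(q(n+1)^2-q(n)q(n+2)\right)\geq \left(q(n)q(n+1)-q(n-1)q(n+2)\right)^2\qquad\text{for all integers } n\geq 121.$$
   Context: For an integer $n\ge 0$, $q(n)$ is the number of partitions of $n$ into distinct parts, with generating function $\sum_{n\ge 0}q(n)x^n=\prod_{j=1}^{\infty}(1+x^j)$. *)

theory Defs
  imports Main
begin

(* A partition of n into distinct parts is determined by its set of parts. *)

definition distinct_partitions :: "nat \<Rightarrow> nat set set" where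
  "distinct_partitions n = {S. finite S \<and> 0 \<notin> S \<and> \<Sum>S = n}"

definition q :: "nat \<Rightarrow> nat" where
  "q n = card (distinct_partitions n)"

(* Since card is 0 on infinite sets, q counts what it should only because of this fact. *)

lemma finite_distinct_partitions: "finite (distinct_partitions n)"
proof (rule finite_subset)
  show "distinct_partitions n \<subseteq> Pow {..n}"
  proof
    fix S assume "S \<in> distinct_partitions n"
    then have S: "finite S" "\<Sum>S = n" by (simp_all add: distinct_partitions_def)
    have "x \<le> n" if "x \<in> S" for x
      using member_le_sum[OF that, of "\<lambda>x. x"] S by simp
    then show "S \<in> Pow {..n}" by auto
  qed
qed simp

end

(* Euler's identity between partitions into distinct and into odd parts gives
   sum q(n) exp(-n s) = exp (G s) with G s = sum_{k>=1} 1 / (2 k sinh (k s)), and the partial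
   fractions of 1 / sinh turn into G s + G (2 pi^2 / s) = pi^2 / (12 s) + s / 24 - ln 2 / 2.
   In Cauchy's integral for q(n) on Re s = t of order n^(-1/2), the arc |Im s| <= 5 t may be
   treated with G (2 pi^2 / s) neglected and completed to a closed contour, which yields a series
   of Bessel type; on the rest, the terms k = 1, 2 of G already lose a constant multiple of 1 / t
   in the exponent. So sqrt 2 q(n) is M (n + 1/24) up to an exponentially small relative error,
   where x M'' + 2 M' = a M with a = pi^2 / 12, and barriers for the Riccati equation of M' / M
   control the ratios of M.
   With r(n) = q(n+1) / q(n) and e(n) = r(n-1) - r(n), the third order inequality reads
   4 e(n)^2 e(n+1) >= r(n) (e(n) - e(n+1))^2. Here e(n) is of order n^(-3/2) and e(n) - e(n+1) of
   order n^(-5/2), so that it holds with room to spare once n >= 2001, and the smaller n are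
   checked by computation. *)

theory Submission
  imports Defs "HOL-Complex_Analysis.Complex_Analysis" "HOL-Computational_Algebra.Formal_Power_Series"
begin

section \<open>A functional equation for the generating function\<close>

text \<open>The scale is \<open>W = x^(-1/4)\<close> with x near n. Since e is of order
  \<open>W^6\<close>, the inequality tolerates a difference e(n) - e(n+1) up to a small multiple of
  \<open>W^9\<close>, while its true order is \<open>W^10\<close>. The gap between these two orders
  is what the relative error of M may consume, so an error below \<open>0.035 * W^9\<close> is
  required. The contour estimate yields a relative error \<open>exp (-0.7 * y)\<close> up to powers
  of x, where \<open>y = pi * sqrt (x / 12)\<close>, and the required bound then holds from about x
  = 2000 on with little to spare. This explains the use of two terms of G off the central arc, the
  explicit constants everywhere, and the size of the table. The obstacle on the analytic side is
  that an asymptotic expansion of M may not be differenced twice. The Riccati equation removes it: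
  bounds for \<open>M' / M\<close> alone give bounds for its first two derivatives by algebra. On
  the computational side the evaluation is symbolic, so the values of q are built by additions only
  and the inequality is tested on ratios with 28 binary digits.\<close>

lemma cot_partial_fractions:
  fixes z :: complex
  assumes "z \<notin> \<int>"
  shows "(\<lambda>n. 2 * z / (z\<^sup>2 - (of_nat (Suc n))\<^sup>2)) sums (pi * cos (pi * z) / sin (pi * z) - 1 / z)"
proof -
  have ni: "z + of_nat n \<noteq> 0" "1 - z + of_nat n \<noteq> 0" "z - of_nat n \<noteq> 0" for n
  proof -
    have "z \<noteq> - of_nat n" "z \<noteq> 1 + of_nat n" "z \<noteq> of_nat n"
      using assms by (metis Ints_minus Ints_of_nat, metis Ints_1 Ints_add Ints_of_nat, metis Ints_of_nat)
    then show "z + of_nat n \<noteq> 0" "1 - z + of_nat n \<noteq> 0" "z - of_nat n \<noteq> 0"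
      by (auto simp: algebra_simps eq_neg_iff_add_eq_0)
  qed
  have z0: "z \<noteq> 0" "1 - z \<noteq> 0" using ni(1)[of 0] ni(2)[of 0] by auto
  have sin: "sin (pi * z) \<noteq> 0"
    using assms by (auto simp: sin_eq_0)
  \<comment> \<open>Differentiating the reflection formula
    \<open>rGamma z * rGamma (1 - z) = sin (pi * z) / pi\<close> expresses the cotangent by
    \<open>Digamma (1 - z) - Digamma z\<close>; the logarithms in the two limit formulas for
    \<open>Digamma\<close> then cancel.\<close>
  have "((\<lambda>z. rGamma z * rGamma (1 - z :: complex)) has_field_derivative
      rGamma z * rGamma (1 - z) * (Digamma (1 - z) - Digamma z)) (at z)"
  proof -
    have "z \<notin> \<int>\<^sub>\<le>\<^sub>0" "1 - z \<notin> \<int>\<^sub>\<le>\<^sub>0"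
      using assms by (auto dest: nonpos_Ints_Int)
    then show ?thesis by (auto intro!: derivative_eq_intros simp: algebra_simps)
  qed
  moreover have "((\<lambda>z. sin (pi * z) / pi) has_field_derivative cos (pi * z)) (at z)"
    by (auto intro!: derivative_eq_intros)
  ultimately have "rGamma z * rGamma (1 - z) * (Digamma (1 - z) - Digamma z) = cos (pi * z)"
    unfolding rGamma_reflection_complex by (rule DERIV_unique)
  then have D: "Digamma (1 - z) - Digamma z = pi * cos (pi * z) / sin (pi * z)"
    using sin by (simp add: rGamma_reflection_complex field_simps)
  let ?f = "\<lambda>m. (\<Sum>n<m. inverse (z + of_nat n)) - (\<Sum>n<m. inverse (1 - z + of_nat n))"
  have "?f \<longlonglongrightarrow> pi * cos (pi * z) / sin (pi * z)"
    using tendsto_diff[OF Digamma_LIMSEQ[OF z0(2)] Digamma_LIMSEQ[OF z0(1)]] unfolding D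
    by (simp add: algebra_simps)
  then have 1: "(\<lambda>m. ?f (Suc m)) \<longlonglongrightarrow> pi * cos (pi * z) / sin (pi * z)"
    by (rule LIMSEQ_Suc)
  have 2: "(\<lambda>m. inverse (1 - z + of_nat m)) \<longlonglongrightarrow> 0"
    by (intro filterlim_compose[OF tendsto_inverse_0] tendsto_add_filterlim_at_infinity[OF tendsto_const]
      tendsto_of_nat)
  \<comment> \<open>Splitting \<open>1 / z\<close> off the first sum leaves it one term short.
    Adding back the last reciprocal of the second sum, which tends to 0, lets
    \<open>z + (n + 1)\<close> be paired with \<open>z - (n + 1)\<close>.\<close>
  have "?f (Suc m) + inverse (1 - z + of_nat m) - 1 / z = (\<Sum>n<m. 2 * z / (z\<^sup>2 - (of_nat (Suc n))\<^sup>2))" for m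
  proof -
    have s: "2 * z / (z\<^sup>2 - (of_nat (Suc n))\<^sup>2) = inverse (z + of_nat (Suc n)) - inverse (1 - z + of_nat n)" for n
    proof -
      have nz: "z + of_nat (Suc n) \<noteq> 0" "1 - z + of_nat n \<noteq> 0" by (rule ni)+
      have e: "z\<^sup>2 - (of_nat (Suc n))\<^sup>2 = - ((z + of_nat (Suc n)) * (1 - z + of_nat n))"
        by (simp add: power2_eq_square algebra_simps)
      have "inverse a - inverse b = (b - a) / (a * b)" if "a \<noteq> 0" "b \<noteq> 0" for a b :: complex
        using that by (simp add: field_simps)
      from this[OF nz] show ?thesis unfolding e by (simp add: diff_diff_eq)
    qed
    have "?f (Suc m) + inverse (1 - z + of_nat m) - 1 / z =
      (\<Sum>n<m. inverse (z + of_nat (Suc n)) - inverse (1 - z + of_nat n))"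
      by (subst sum.lessThan_Suc_shift) (simp add: sum_subtractf inverse_eq_divide)
    then show ?thesis by (simp only: s)
  qed
  moreover have "(\<lambda>m. ?f (Suc m) + inverse (1 - z + of_nat m) - 1 / z) \<longlonglongrightarrow>
      pi * cos (pi * z) / sin (pi * z) + 0 - 1 / z"
    by (intro tendsto_intros 1 2)
  ultimately show ?thesis by (simp add: sums_def)
qed

text \<open>The substitution \<open>z = i x / (2 pi)\<close> turns the cotangent into
  \<open>1 / (exp x - 1)\<close>. The hypothesis places \<open>z\<close> in the upper half plane,
  away from the integers.\<close>

lemma inverse_exp_minus_one_sums:
  fixes x :: complex
  assumes "Re x > 0"
  shows "(\<lambda>n. 2 * x / (x\<^sup>2 + 4 * (of_real pi)\<^sup>2 * (of_nat (Suc n))\<^sup>2)) sums (1 / (exp x - 1) - 1 / x + 1 / 2)"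
proof -
  define z where "z = \<i> * x / (2 * pi)"
  have x0: "x \<noteq> 0" using assms by auto
  have "Im z > 0" using assms by (simp add: z_def)
  then have "z \<notin> \<int>" by (auto elim!: Ints_cases)
  note S = sums_mult[OF cot_partial_fractions[OF this], of "\<i> / (2 * pi)"]
  have e: "exp x \<noteq> 1"
  proof
    assume "exp x = 1"
    then have "exp (Re x) = 1" by (metis norm_exp_eq_Re norm_one)
    then show False using assms by simp
  qed
  have pz: "pi * z = \<i> * x / 2" by (simp add: z_def)
  have h: "exp x = exp (x / 2) * exp (x / 2)" by (simp flip: exp_add)
  have "\<i> / (2 * pi) * (pi * cos (pi * z) / sin (pi * z) - 1 / z) = 1 / (exp x - 1) - 1 / x + 1 / 2"
  proof -
    have "cos (pi * z) / sin (pi * z) = - \<i> * (exp x + 1) / (exp x - 1)"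
      unfolding pz using e unfolding h
      by (simp add: cos_exp_eq sin_exp_eq exp_minus field_simps)
    then have "\<i> / (2 * pi) * (pi * cos (pi * z) / sin (pi * z) - 1 / z)
      = \<i> / 2 * (- \<i> * (exp x + 1) / (exp x - 1)) - \<i> / (2 * pi) / z"
      by (simp only: times_divide_eq_right[symmetric] right_diff_distrib) simp
    also have "\<dots> = 1 / (exp x - 1) - 1 / x + 1 / 2"
      using x0 e by (simp add: z_def field_simps)
    finally show ?thesis .
  qed
  moreover have "\<i> / (2 * pi) * (2 * z / (z\<^sup>2 - (of_nat (Suc n))\<^sup>2)) =
      2 * x / (x\<^sup>2 + 4 * (of_real pi)\<^sup>2 * (of_nat (Suc n))\<^sup>2)" for n
  proof -
    define D where "D = x\<^sup>2 + 4 * (of_real pi)\<^sup>2 * (of_nat (Suc n))\<^sup>2"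
    have "z\<^sup>2 - (of_nat (Suc n))\<^sup>2 = - D / (4 * (of_real pi)\<^sup>2)"
      by (simp add: z_def D_def power_divide power_mult_distrib field_simps)
    moreover have "\<i> / (2 * pi) * (2 * z / (- D / (4 * (of_real pi)\<^sup>2))) = 2 * x / D"
      by (cases "D = 0") (simp_all add: z_def field_simps power2_eq_square)
    ultimately have "\<i> / (2 * pi) * (2 * z / (z\<^sup>2 - (of_nat (Suc n))\<^sup>2)) = 2 * x / D"
      by simp
    then show ?thesis by (simp only: D_def)
  qed
  ultimately show ?thesis using S by simp
qed

text \<open>The product majorant makes the family absolutely summable over all pairs, so both orders
  of summation give the same value. This serves the reflection formula as well as the logarithm of
  the infinite product.\<close>

lemma double_sums_swap:
  fixes b :: "nat \<Rightarrow> nat \<Rightarrow> complex"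
  assumes b: "\<And>j m. norm (b j m) \<le> f j * g m"
    and f: "summable f" and g: "summable g"
    and nonneg: "\<And>j. f j \<ge> 0" "\<And>m. g m \<ge> 0"
    and X: "\<And>j. b j sums X j" and Y: "\<And>m. (\<lambda>j. b j m) sums Y m"
  obtains S where "X sums S" "Y sums S"
proof -
  have bX: "(b j has_sum X j) UNIV" for j
    by (rule norm_summable_imp_has_sum[OF _ X])
      (rule summable_comparison_test_ev[OF _ summable_mult[OF g, of "f j"]], use b in auto)
  have bY: "((\<lambda>j. b j m) has_sum Y m) UNIV" for m
    by (rule norm_summable_imp_has_sum[OF _ Y])
      (rule summable_comparison_test_ev[OF _ summable_mult2[OF f, of "g m"]], use b in auto)
  have fs: "f summable_on UNIV" and gs: "g summable_on UNIV"
    using f g nonneg by (auto simp: summable_on_UNIV_nonneg_real_iff)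
  have "(\<lambda>(j, m). f j * g m) summable_on UNIV \<times> UNIV"
  proof (rule summable_on_SigmaI)
    show "((\<lambda>y. case (x, y) of (j, m) \<Rightarrow> f j * g m) has_sum f x * infsum g UNIV) UNIV" for x
      using has_sum_cmult_right[OF has_sum_infsum[OF gs], of "f x"] by simp
    show "(\<lambda>x. f x * infsum g UNIV) summable_on UNIV"
      by (intro summable_on_cmult_left fs)
  qed (use nonneg in auto)
  then have "(\<lambda>p. norm (case p of (j, m) \<Rightarrow> b j m)) summable_on UNIV \<times> UNIV"
    by (rule summable_on_comparison_test) (use b in auto)
  then have s: "(\<lambda>(j, m). b j m) summable_on UNIV \<times> UNIV"
    by (rule abs_summable_summable)
  define S where "S = infsum (\<lambda>(j, m). b j m) (UNIV \<times> UNIV)"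
  have S: "((\<lambda>(j, m). b j m) has_sum S) (UNIV \<times> UNIV)"
    unfolding S_def by (rule has_sum_infsum[OF s])
  then have S': "((\<lambda>(m, j). b j m) has_sum S) (UNIV \<times> UNIV)"
    by (subst has_sum_swap) (simp add: case_prod_unfold)
  have "(X has_sum S) UNIV" by (rule has_sum_SigmaD[OF S]) (use bX in auto)
  moreover have "(Y has_sum S) UNIV" by (rule has_sum_SigmaD[OF S']) (use bY in auto)
  ultimately show ?thesis using that has_sum_imp_sums by blast
qed

text \<open>After division by \<open>x + y\<close> the combination is a point of the segment from
  \<open>s\<close> to \<open>w\<close>, so the distance of 0 from this compact set can be taken for
  \<open>d\<close>.\<close>

lemma norm_quadratic_form_ge:
  fixes s w :: complex
  assumes "0 \<notin> closed_segment s w"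
  shows "\<exists>d>0. \<forall>x\<ge>0. \<forall>y\<ge>0. d * (x + y) \<le> norm (of_real x * s + of_real y * w)"
proof -
  obtain p where p: "p \<in> closed_segment s w" "\<And>x. x \<in> closed_segment s w \<Longrightarrow> dist 0 p \<le> dist 0 x"
    using distance_attains_inf[of "closed_segment s w" 0] ends_in_segment closed_segment by blast
  show ?thesis
  proof (intro exI[of _ "norm p"] conjI allI impI)
    show "norm p > 0" using p(1) assms by auto
    fix x y :: real assume xy: "x \<ge> 0" "y \<ge> 0"
    show "norm p * (x + y) \<le> norm (of_real x * s + of_real y * w)"
    proof (cases "x + y = 0")
      case False
      then have pos: "x + y > 0" using xy by simp
      have "(x / (x + y)) *\<^sub>R s + (y / (x + y)) *\<^sub>R w \<in> closed_segment s w"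
      proof -
        have "1 - y / (x + y) = x / (x + y)" using pos by (simp add: field_simps)
        then show ?thesis using xy pos unfolding in_segment
          by (intro exI[of _ "y / (x + y)"]) simp
      qed
      from p(2)[OF this] have "norm p \<le> norm ((x / (x + y)) *\<^sub>R s + (y / (x + y)) *\<^sub>R w)" by simp
      also have "(x / (x + y)) *\<^sub>R s + (y / (x + y)) *\<^sub>R w = (of_real x * s + of_real y * w) / of_real (x + y)"
        by (simp add: scaleR_conv_of_real add_divide_distrib)
      also have "norm \<dots> = norm (of_real x * s + of_real y * w) / (x + y)" using pos by (simp add: norm_divide del: of_real_add)
      finally show ?thesis using pos by (simp add: field_simps)
    qed (use xy in auto)
  qed
qed

section \<open>Partial fractions and bounds for the hyperbolic cosecant series\<close>

lemma inverse_sinh_eq: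
  fixes x :: complex
  assumes "Re x > 0"
  shows "sinh x \<noteq> 0" "1 / sinh x = 2 * (1 / (exp x - 1) - 1 / (exp (2 * x) - 1))"
proof -
  have e: "exp y \<noteq> 1" if "Re y > 0" for y :: complex
  proof
    assume "exp y = 1"
    then have "norm (exp y) = 1" by simp
    then show False using that by (simp add: norm_exp_eq_Re)
  qed
  define E where "E = exp x"
  have h: "exp (2 * x) = E * E" unfolding E_def mult_2 exp_add ..
  have "E \<noteq> 1" unfolding E_def by (rule e) fact
  moreover have "E * E \<noteq> 1" unfolding h[symmetric] by (rule e) (use assms in simp)
  moreover have "E \<noteq> 0" by (simp add: E_def)
  ultimately have E: "E \<noteq> 0" "E - 1 \<noteq> 0" "E * E - 1 \<noteq> 0" by simp_all
  have EE: "E * E - 1 = (E - 1) * (E + 1)" by (simp add: algebra_simps)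
  have s: "sinh x = (E * E - 1) / (2 * E)"
    unfolding sinh_field_def exp_minus E_def[symmetric] using E(1) by (simp add: field_simps)
  show "sinh x \<noteq> 0" using E by (simp add: s)
  have "1 / (E - 1) = (E + 1) / (E * E - 1)" using E unfolding EE by simp
  then have "1 / (E - 1) - 1 / (E * E - 1) = E / (E * E - 1)"
    by (simp only: diff_divide_distrib[symmetric] add_diff_cancel_right')
  moreover have "1 / ((E * E - 1) / (2 * E)) = 2 * (E / (E * E - 1))" by simp
  ultimately show "1 / sinh x = 2 * (1 / (exp x - 1) - 1 / (exp (2 * x) - 1))"
    by (simp only: s h E_def[symmetric])
qed

text \<open>\<open>1 / sinh v\<close> is a difference of \<open>1 / (exp - 1)\<close> at
  \<open>v\<close> and at \<open>2 v\<close>. The expansion at \<open>2 v\<close> runs over all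
  integers, the one at \<open>v\<close> over the even ones with double weight, so even terms come
  with sign plus and odd ones with sign minus.\<close>

lemma inverse_sinh_sums:
  fixes v :: complex
  assumes "Re v > 0"
  shows "(\<lambda>j. 1 / (v\<^sup>2 + (of_real pi)\<^sup>2 * (of_nat (2 * j + 2))\<^sup>2) - 1 / (v\<^sup>2 + (of_real pi)\<^sup>2 * (of_nat (2 * j + 1))\<^sup>2))
    sums ((1 / sinh v - 1 / v) / (2 * v))"
proof -
  have v: "v \<noteq> 0" using assms by auto
  let ?c = "\<lambda>k. 1 / (v\<^sup>2 + (of_real pi)\<^sup>2 * (of_nat (Suc k))\<^sup>2)"
  have "(\<lambda>n. v * ?c n) sums (1 / (exp (2 * v) - 1) - 1 / (2 * v) + 1 / 2)"
  proof -
    have "2 * (2 * v) / ((2 * v)\<^sup>2 + 4 * (of_real pi)\<^sup>2 * (of_nat (Suc n))\<^sup>2) = v * ?c n" for n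
    proof -
      define D where "D = v\<^sup>2 + (of_real pi)\<^sup>2 * (of_nat (Suc n))\<^sup>2"
      have "(2 * v)\<^sup>2 + 4 * (of_real pi)\<^sup>2 * (of_nat (Suc n))\<^sup>2 = 4 * D"
        by (simp add: D_def power_mult_distrib algebra_simps)
      then have "2 * (2 * v) / ((2 * v)\<^sup>2 + 4 * (of_real pi)\<^sup>2 * (of_nat (Suc n))\<^sup>2) = v * (1 / D)"
        by (simp only:) simp
      then show ?thesis by (simp only: D_def)
    qed
    then show ?thesis using inverse_exp_minus_one_sums[of "2 * v"] assms by simp
  qed
  note all = this
  have 1: "(\<lambda>j. v * ?c (2 * j) + v * ?c (2 * j + 1)) sums (1 / (exp (2 * v) - 1) - 1 / (2 * v) + 1 / 2)"
  proof -
    have "{j * 2..<j * 2 + 2} = {2 * j, 2 * j + 1}" for j :: nat by auto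
    then show ?thesis using sums_group[OF all, of 2] by simp
  qed
  have 2: "(\<lambda>j. 2 * v * ?c (2 * j + 1)) sums (1 / (exp v - 1) - 1 / v + 1 / 2)"
  proof -
    have "2 * v / (v\<^sup>2 + 4 * (of_real pi)\<^sup>2 * (of_nat (Suc j))\<^sup>2) = 2 * v * ?c (2 * j + 1)" for j
    proof -
      have "(of_nat (Suc (2 * j + 1)) :: complex)\<^sup>2 = 4 * (of_nat (Suc j))\<^sup>2"
        by (simp add: power2_eq_square algebra_simps)
      then have e: "(of_real pi)\<^sup>2 * (of_nat (Suc (2 * j + 1)))\<^sup>2 = 4 * (of_real pi)\<^sup>2 * (of_nat (Suc j) :: complex)\<^sup>2"
        by (simp only: ac_simps)
      show ?thesis unfolding e by simp
    qed
    then show ?thesis using inverse_exp_minus_one_sums[OF assms] by (simp only:)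
  qed
  have "(\<lambda>j. (1 / v) * (2 * v * ?c (2 * j + 1) - (v * ?c (2 * j) + v * ?c (2 * j + 1))))
      sums ((1 / v) * ((1 / (exp v - 1) - 1 / v + 1 / 2) - (1 / (exp (2 * v) - 1) - 1 / (2 * v) + 1 / 2)))"
    by (intro sums_mult sums_diff 1 2)
  also have "(1 / v) * ((1 / (exp v - 1) - 1 / v + 1 / 2) - (1 / (exp (2 * v) - 1) - 1 / (2 * v) + 1 / 2))
      = (1 / sinh v - 1 / v) / (2 * v)"
  proof -
    have "(1 / v) * ((a - 1 / v + 1 / 2) - (b - 1 / (2 * v) + 1 / 2)) = (2 * (a - b) - 1 / v) / (2 * v)"
      for a b :: complex using v by (simp add: field_simps)
    then show ?thesis unfolding inverse_sinh_eq(2)[OF assms] .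
  qed
  also have "(\<lambda>j. (1 / v) * (2 * v * ?c (2 * j + 1) - (v * ?c (2 * j) + v * ?c (2 * j + 1)))) =
      (\<lambda>j. ?c (2 * j + 1) - ?c (2 * j))"
    using v by (simp add: fun_eq_iff right_diff_distrib)
  finally show ?thesis by simp
qed

text \<open>This is \<open>G\<close> of the overview, a logarithm of the generating function at
  \<open>exp (- s)\<close>.\<close>

definition csch_sum :: "complex \<Rightarrow> complex" where
  "csch_sum s = (\<Sum>k. 1 / (2 * of_nat (Suc k) * sinh (of_nat (Suc k) * s)))"

lemma norm_sinh_ge: "sinh (Re z) \<le> norm (sinh z)"
proof -
  have "2 * sinh (Re z) = norm (exp z) - norm (exp (- z))" by (simp add: sinh_field_def norm_exp_eq_Re)
  also have "\<dots> \<le> norm (exp z - exp (- z))" by (rule norm_triangle_ineq2)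
  also have "\<dots> = 2 * norm (sinh z)" by (simp add: sinh_field_def norm_divide)
  finally show ?thesis by simp
qed

lemma sinh_real_ge:
  fixes x :: real
  assumes "x \<ge> 0"
  shows "x \<le> sinh x"
proof -
  have "(\<lambda>x. sinh x - x) 0 \<le> (\<lambda>x. sinh x - x) x"
  proof (rule DERIV_nonneg_imp_nondecreasing[OF assms])
    fix y :: real
    have "((\<lambda>x. sinh x - x) has_real_derivative cosh y - 1) (at y)"
      by (auto intro!: derivative_eq_intros)
    moreover have "cosh y - 1 \<ge> 0" using cosh_real_ge_1[of y] by simp
    ultimately show "\<exists>z. ((\<lambda>x. sinh x - x) has_real_derivative z) (at y) \<and> 0 \<le> z" by blast
  qed
  then show ?thesis by simp
qed

text \<open>Induction by the addition formula and \<open>cosh \<ge> 1\<close>. The factor gained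
  joins the one in the denominator of the series and yields a majorant \<open>1 / k^2\<close> that
  is independent of \<open>Im s\<close>.\<close>

lemma sinh_of_nat_mult_ge:
  assumes "x > 0"
  shows "of_nat (Suc k) * sinh x \<le> sinh (of_nat (Suc k) * (x :: real))"
proof (induction k)
  case (Suc k)
  let ?y = "of_nat (Suc k) * x"
  have "?y > 0" using assms by simp
  then have "sinh ?y * 1 \<le> sinh ?y * cosh x" "1 * sinh x \<le> cosh ?y * sinh x"
    using assms cosh_real_ge_1 by (intro mult_left_mono mult_right_mono; simp)+
  then have "sinh ?y + sinh x \<le> sinh (?y + x)" by (simp add: sinh_add)
  moreover have "of_nat (Suc (Suc k)) * x = ?y + x" by (simp add: algebra_simps)
  ultimately show ?case using Suc by (simp add: algebra_simps)
qed simp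

lemma norm_csch_term:
  assumes "Re s > 0"
  shows "norm (1 / (2 * of_nat (Suc k) * sinh (of_nat (Suc k) * s))) \<le>
    1 / (2 * sinh (Re s)) * (1 / (of_nat (Suc k))\<^sup>2)"
proof -
  have p: "sinh (Re s) > 0" using assms by simp
  have "of_nat (Suc k) * sinh (Re s) \<le> norm (sinh (of_nat (Suc k) * s))"
    using sinh_of_nat_mult_ge[OF assms, of k] norm_sinh_ge[of "of_nat (Suc k) * s"] by simp
  then have "2 * of_nat (Suc k) * (of_nat (Suc k) * sinh (Re s)) \<le>
      norm (2 * of_nat (Suc k) * sinh (of_nat (Suc k) * s))"
    by (simp only: norm_mult norm_of_nat norm_numeral) (intro mult_left_mono; simp)
  then have "norm (1 / (2 * of_nat (Suc k) * sinh (of_nat (Suc k) * s))) \<le>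
      1 / (2 * of_nat (Suc k) * (of_nat (Suc k) * sinh (Re s)))"
    unfolding norm_divide norm_one using p by (intro frac_le mult_pos_pos) auto
  also have "\<dots> = 1 / (2 * sinh (Re s)) * (1 / (of_nat (Suc k))\<^sup>2)"
    by (simp add: power2_eq_square)
  finally show ?thesis .
qed

lemma csch_sum:
  assumes "Re s > 0"
  shows "summable (\<lambda>k. norm (1 / (2 * of_nat (Suc k) * sinh (of_nat (Suc k) * s))))"
    "(\<lambda>k. 1 / (2 * of_nat (Suc k) * sinh (of_nat (Suc k) * s))) sums csch_sum s"
    "norm (csch_sum s) \<le> pi\<^sup>2 / 12 / sinh (Re s)"
proof -
  define a where "a k = 1 / (2 * of_nat (Suc k) * sinh (of_nat (Suc k) * s))" for k
  define g where "g k = 1 / (2 * sinh (Re s)) * (1 / (real (Suc k))\<^sup>2)" for k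
  have ag: "norm (a k) \<le> g k" for k
    unfolding a_def g_def by (rule norm_csch_term[OF assms])
  have S: "g sums (1 / (2 * sinh (Re s)) * (pi\<^sup>2 / 6))"
    unfolding g_def using inverse_squares_sums
    by (intro sums_mult) (simp only: Suc_eq_plus1 of_nat_power)
  have s: "summable (\<lambda>k. norm (a k))"
    by (rule summable_comparison_test_ev[OF _ sums_summable[OF S]]) (simp add: ag)
  have a_eq: "(\<lambda>k. 1 / (2 * of_nat (Suc k) * sinh (of_nat (Suc k) * s))) = a"
    by (rule ext) (simp only: a_def)
  have G: "csch_sum s = suminf a" unfolding csch_sum_def a_eq ..
  show "summable (\<lambda>k. norm (1 / (2 * of_nat (Suc k) * sinh (of_nat (Suc k) * s))))"
    using s unfolding a_def .
  show "(\<lambda>k. 1 / (2 * of_nat (Suc k) * sinh (of_nat (Suc k) * s))) sums csch_sum s"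
    unfolding a_eq G by (rule summable_sums[OF summable_norm_cancel[OF s]])
  have "norm (suminf a) \<le> (\<Sum>k. norm (a k))" by (rule summable_norm[OF s])
  also have "\<dots> \<le> suminf g" by (rule suminf_le[OF ag s sums_summable[OF S]])
  also have "\<dots> = 1 / (2 * sinh (Re s)) * (pi\<^sup>2 / 6)" by (rule sums_unique[OF S, symmetric])
  also have "\<dots> = pi\<^sup>2 / 12 / sinh (Re s)" by simp
  finally show "norm (csch_sum s) \<le> pi\<^sup>2 / 12 / sinh (Re s)"
    unfolding G .
qed

lemma sums_pairs:
  fixes f :: "nat \<Rightarrow> 'a :: real_normed_vector"
  assumes "f sums S"
  shows "(\<lambda>j. f (2 * j) + f (2 * j + 1)) sums S"
proof -
  have "{j * 2..<j * 2 + 2} = {2 * j, 2 * j + 1}" for j :: nat by auto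
  then show ?thesis using sums_group[OF assms, of 2] by simp
qed

lemma alternating_inverse_squares_sums:
  "(\<lambda>j. 1 / (real (2 * j + 1))\<^sup>2 - 1 / (real (2 * j + 2))\<^sup>2) sums (pi\<^sup>2 / 12)"
proof -
  define h where "h n = 1 / (real (Suc n))\<^sup>2" for n
  have Q: "h sums (pi\<^sup>2 / 6)"
    unfolding h_def using inverse_squares_sums by (simp only: Suc_eq_plus1 of_nat_power)
  have "1 / 2 * h j = 2 * h (2 * j + 1)" for j
  proof -
    have "real (Suc (2 * j + 1)) = 2 * real (Suc j)" by simp
    then show ?thesis by (simp only: h_def power_mult_distrib) simp
  qed
  then have "(\<lambda>j. 2 * h (2 * j + 1)) sums (1 / 2 * (pi\<^sup>2 / 6))"
    using sums_mult[OF Q, of "1 / 2"] by (simp only:)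
  from sums_diff[OF sums_pairs[OF Q] this]
  have "(\<lambda>j. h (2 * j) - h (2 * j + 1)) sums (pi\<^sup>2 / 12)" by (simp add: algebra_simps)
  then show ?thesis by (simp add: h_def)
qed

text \<open>A single term is only of size \<open>1 / (k^2 + m^2)\<close>, whose double series
  diverges. The difference of neighbours in \<open>k\<close> gains a factor and is of size
  \<open>J / R^2\<close> with \<open>R = J^2 + M^2\<close>. From \<open>J \<le> R^(1/2)\<close> and
  \<open>J * M \<le> R\<close> follows the bound \<open>(J * M)^(-3/2)\<close>, a product of two
  summable sequences.\<close>

lemma inverse_quadratic_diff_bound:
  fixes s :: complex
  assumes "Re s > 0"
  obtains K where "K > 0" "\<And>j m. norm (1 / ((of_nat (2 * j + 1))\<^sup>2 * s\<^sup>2 + 4 * (of_real pi)\<^sup>2 * (of_nat (Suc m))\<^sup>2)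
      - 1 / ((of_nat (2 * j + 2))\<^sup>2 * s\<^sup>2 + 4 * (of_real pi)\<^sup>2 * (of_nat (Suc m))\<^sup>2))
    \<le> K * real (Suc j) powr (- (3 / 2)) * real (Suc m) powr (- (3 / 2))"
proof -
  \<comment> \<open>The segment could meet 0 only if the square of \<open>s\<close> were real and
    not positive, which \<open>Re s > 0\<close> excludes.\<close>
  have "0 \<notin> closed_segment (s\<^sup>2) (4 * (of_real pi)\<^sup>2)"
  proof
    assume "0 \<in> closed_segment (s\<^sup>2) (4 * (of_real pi)\<^sup>2)"
    then obtain u where u: "0 \<le> u" "u \<le> 1" "0 = (1 - u) *\<^sub>R s\<^sup>2 + u *\<^sub>R (4 * (of_real pi)\<^sup>2)"
      unfolding in_segment by blast
    have "Im ((1 - u) *\<^sub>R s\<^sup>2 + u *\<^sub>R (4 * (of_real pi)\<^sup>2)) = 0"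
      "Re ((1 - u) *\<^sub>R s\<^sup>2 + u *\<^sub>R (4 * (of_real pi)\<^sup>2)) = 0"
      by (simp_all flip: u(3))
    then have im: "(1 - u) * (Re s * Im s) = 0"
      and re: "(1 - u) * ((Re s)\<^sup>2 - (Im s)\<^sup>2) + u * (4 * pi\<^sup>2) = 0"
      by (auto simp: power2_eq_square)
    show False
    proof (cases "u = 1")
      case True
      then show False using re by simp
    next
      case False
      then have "Im s = 0" using im assms by simp
      then have "(1 - u) * (Re s)\<^sup>2 + u * (4 * pi\<^sup>2) = 0" using re by simp
      moreover have "(1 - u) * (Re s)\<^sup>2 > 0" using False u assms by simp
      moreover have "u * (4 * pi\<^sup>2) \<ge> 0" using u by simp
      ultimately show False by linarith
    qed
  qed
  from norm_quadratic_form_ge[OF this] obtain d where d: "d > 0"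
    "\<And>x y. x \<ge> 0 \<Longrightarrow> y \<ge> 0 \<Longrightarrow> d * (x + y) \<le> norm (of_real x * s\<^sup>2 + of_real y * (4 * (of_real pi)\<^sup>2))"
    by blast
  define D where "D k m = (of_nat k)\<^sup>2 * s\<^sup>2 + 4 * (of_real pi)\<^sup>2 * (of_nat (Suc m) :: complex)\<^sup>2" for k m :: nat
  have D: "d * ((real k)\<^sup>2 + (real (Suc m))\<^sup>2) \<le> norm (D k m)" for k m
    using d(2)[of "(real k)\<^sup>2" "(real (Suc m))\<^sup>2"] by (simp add: D_def mult_ac)
  define K where "K = 4 * (norm s)\<^sup>2 / d\<^sup>2"
  show ?thesis
  proof (rule that[of K])
    have "s \<noteq> 0" using assms by auto
    then show "K > 0" using d(1) by (simp add: K_def)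
    fix j m :: nat
    define J where "J = real (Suc j)"
    define M where "M = real (Suc m)"
    have JM: "J \<ge> 1" "M \<ge> 1" by (simp_all add: J_def M_def)
    define R where "R = J\<^sup>2 + M\<^sup>2"
    have R: "R > 0" using JM by (simp add: R_def add_pos_pos)
    have DR: "d * R \<le> norm (D k m)" if "Suc j \<le> k" for k
    proof -
      have "J \<le> real k" using that by (simp only: J_def of_nat_le_iff)
      then have "J\<^sup>2 \<le> (real k)\<^sup>2" using JM by (intro power_mono) auto
      then have "d * R \<le> d * ((real k)\<^sup>2 + (real (Suc m))\<^sup>2)"
        using d(1) by (intro mult_left_mono) (auto simp: R_def M_def)
      then show ?thesis using D[of k m] by linarith
    qed
    have dR: "d * R > 0" using d(1) R by simp
    have D0: "D k m \<noteq> 0" if "Suc j \<le> k" for k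
      using DR[OF that] dR by auto
    have "1 / D (2 * j + 1) m - 1 / D (2 * j + 2) m = (D (2 * j + 2) m - D (2 * j + 1) m) / (D (2 * j + 1) m * D (2 * j + 2) m)"
      using D0[of "2 * j + 1"] D0[of "2 * j + 2"] by (simp add: field_simps)
    also have "D (2 * j + 2) m - D (2 * j + 1) m = of_nat (4 * j + 3) * s\<^sup>2"
      by (simp add: D_def power2_eq_square algebra_simps)
    finally have "norm (1 / D (2 * j + 1) m - 1 / D (2 * j + 2) m) =
      real (4 * j + 3) * (norm s)\<^sup>2 / (norm (D (2 * j + 1) m) * norm (D (2 * j + 2) m))"
      by (simp only: norm_divide norm_mult norm_power norm_of_nat)
    also have "\<dots> \<le> 4 * J * (norm s)\<^sup>2 / ((d * R) * (d * R))"
      using DR[of "2 * j + 1"] DR[of "2 * j + 2"] dR d(1) R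
      by (intro frac_le mult_mono mult_pos_pos) (auto simp: J_def)
    also have "\<dots> = K * (J / R\<^sup>2)" 
      unfolding K_def power2_eq_square times_divide_times_eq by (simp only: mult_ac)
    also have "J / R\<^sup>2 \<le> J powr (- (3 / 2)) * M powr (- (3 / 2))"
    proof -
      have "J = (J\<^sup>2) powr (1 / 2)" using JM by (simp add: powr_half_sqrt)
      also have "\<dots> \<le> R powr (1 / 2)" using JM by (intro powr_mono2) (auto simp: R_def)
      finally have 1: "J \<le> R powr (1 / 2)" .
      have "2 * (J * M) \<le> R" using sum_squares_bound[of J M] by (simp add: R_def mult_ac)
      then have "J * M \<le> R" using JM by (smt (verit) mult_pos_pos)
      then have 2: "(J * M) powr (3 / 2) \<le> R powr (3 / 2)" using JM by (intro powr_mono2) auto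
      have "J * (J * M) powr (3 / 2) \<le> R powr (1 / 2) * R powr (3 / 2)"
        using 1 2 JM by (intro mult_mono) auto
      also have "\<dots> = R\<^sup>2" using R by (simp flip: powr_add add: powr_numeral)
      finally have *: "J * (J * M) powr (3 / 2) \<le> R\<^sup>2" .
      have "J / y \<le> 1 / z" if "J * z \<le> y" "y > 0" "z > 0" for y z
        using that by (simp add: field_simps)
      from this[OF *] have "J / R\<^sup>2 \<le> 1 / (J * M) powr (3 / 2)" using R JM by simp
      moreover have "(J * M) powr (3 / 2) = J powr (3 / 2) * M powr (3 / 2)"
        by (rule powr_mult)
      ultimately show ?thesis unfolding powr_minus_divide by simp
    qed
    finally show "norm (1 / ((of_nat (2 * j + 1))\<^sup>2 * s\<^sup>2 + 4 * (of_real pi)\<^sup>2 * (of_nat (Suc m))\<^sup>2)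
      - 1 / ((of_nat (2 * j + 2))\<^sup>2 * s\<^sup>2 + 4 * (of_real pi)\<^sup>2 * (of_nat (Suc m))\<^sup>2))
      \<le> K * real (Suc j) powr (- (3 / 2)) * real (Suc m) powr (- (3 / 2))"
      using \<open>K > 0\<close> by (simp only: D_def J_def M_def mult.assoc) (simp only: mult_left_mono)
  qed
qed

text \<open>The duplication identity for \<open>1 / sinh\<close> makes the k-th term of
  \<open>csch_sum\<close> equal to \<open>A k - 2 * A (2 * k)\<close>; taking the even terms away
  twice leaves an alternating series. In this form \<open>csch_sum\<close> arises both from partial
  fractions and from the logarithm of the product.\<close>

lemma csch_sum_alternating:
  assumes "Re s > 0"
  defines "A \<equiv> \<lambda>k. 1 / (exp (of_nat k * s) - 1) / of_nat k"
  shows "summable (\<lambda>n. norm (A (Suc n)))" "(\<lambda>j. A (2 * j + 1) - A (2 * j + 2)) sums csch_sum s"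
proof -
  show s: "summable (\<lambda>n. norm (A (Suc n)))"
  proof (rule summable_comparison_test')
    show "summable (\<lambda>n. 1 / Re s * (1 / (real (Suc n))\<^sup>2))"
      using inverse_squares_sums by (intro summable_mult) (simp only: Suc_eq_plus1 of_nat_power sums_iff)
    fix n :: nat
    let ?k = "real (Suc n)"
    have "?k * Re s \<le> exp (?k * Re s) - 1" using exp_ge_add_one_self[of "?k * Re s"] by linarith
    also have "\<dots> = norm (exp (of_nat (Suc n) * s)) - norm (1 :: complex)"
      by (simp add: norm_exp_eq_Re)
    also have "\<dots> \<le> norm (exp (of_nat (Suc n) * s) - 1)" by (rule norm_triangle_ineq2)
    finally have le: "?k * Re s \<le> norm (exp (of_nat (Suc n) * s) - 1)" .
    have "norm (A (Suc n)) = 1 / norm (exp (of_nat (Suc n) * s) - 1) / ?k"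
      by (simp only: A_def norm_divide norm_one norm_of_nat)
    also have "\<dots> \<le> 1 / (?k * Re s) / ?k"
      using le assms by (intro divide_right_mono frac_le) auto
    finally show "norm (norm (A (Suc n))) \<le> 1 / Re s * (1 / ?k\<^sup>2)" by (simp add: power2_eq_square mult_ac)
  qed
  from summable_norm_cancel[OF s] obtain U where U: "(\<lambda>n. A (Suc n)) sums U" by (auto simp: summable_def)
  have Re: "Re (of_nat (Suc n) * s) > 0" for n using assms by simp
  have "1 / (2 * of_nat (Suc n) * sinh (of_nat (Suc n) * s)) = A (Suc n) - 2 * A (2 * n + 2)" for n
  proof -
    define M where "M = (of_nat (Suc n) :: complex)"
    have n2: "(of_nat (2 * n + 2) :: complex) = 2 * M" by (simp add: M_def)
    have "1 / (2 * M * sinh (M * s)) = (1 / sinh (M * s)) / (2 * M)" by simp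
    also have "\<dots> = 1 / (exp (M * s) - 1) / M - 2 * (1 / (exp (2 * M * s) - 1) / (2 * M))"
      unfolding inverse_sinh_eq(2)[OF Re[of n], folded M_def] by (simp add: diff_divide_distrib mult.assoc)
    also have "\<dots> = A (Suc n) - 2 * A (2 * n + 2)"
      unfolding A_def n2 M_def[symmetric] ..
    finally show ?thesis unfolding M_def .
  qed
  then have "(\<lambda>n. A (Suc n) - 2 * A (2 * n + 2)) sums csch_sum s"
    using csch_sum(2)[OF assms(1)] by (simp only:)
  from sums_diff[OF U this] have "(\<lambda>n. 2 * A (2 * n + 2)) sums (U - csch_sum s)" by simp
  from sums_diff[OF sums_pairs[OF U] this]
  show "(\<lambda>j. A (2 * j + 1) - A (2 * j + 2)) sums csch_sum s" by (simp add: algebra_simps)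
qed

text \<open>Both sides are double series of terms \<open>1 / (k\<^sup>2 s\<^sup>2 + 4 pi\<^sup>2 m\<^sup>2)\<close> with alternating signs in \<open>k\<close>.
  Pairing the terms \<open>k = 2 j + 1\<close> and \<open>k = 2 j + 2\<close> makes them absolutely summable.\<close>

theorem csch_sum_reflect:
  assumes "Re s > 0"
  shows "csch_sum s + csch_sum (2 * (of_real pi)\<^sup>2 / s) = (of_real pi)\<^sup>2 / (12 * s) + s / 24 - of_real (ln 2) / 2"
proof -
  have s0: "s \<noteq> 0" using assms by auto
  define P where "P = (of_real pi :: complex)"
  have P0: "P \<noteq> 0" by (simp add: P_def)
  define c where "c k m = 1 / ((of_nat k)\<^sup>2 * s\<^sup>2 + 4 * P\<^sup>2 * (of_nat (Suc m))\<^sup>2)" for k m :: nat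
  define b where "b j m = c (2 * j + 1) m - c (2 * j + 2) m" for j m
  define C where "C k = 1 / (exp (of_nat k * s) - 1)" for k :: nat
  \<comment> \<open>\<open>Z k\<close> is the sum of \<open>c k m\<close> over \<open>m\<close>, and
    \<open>Y m\<close> below is the sum of \<open>b j m\<close> over \<open>j\<close>. The
    elementary summands of \<open>Z\<close>, alternating in \<open>k\<close>, produce
    \<open>pi^2 / (12 s)\<close> and \<open>ln 2 / 2\<close>; the summand \<open>1 / v\<close> in
    \<open>Y\<close> produces \<open>s / 24\<close>.\<close>
  define Z where "Z k = (C k - 1 / (of_nat k * s) + 1 / 2) / (2 * of_nat k * s)" for k :: nat
  define X where "X j = Z (2 * j + 1) - Z (2 * j + 2)" for j
  define v where "v m = of_nat (Suc m) * (2 * P\<^sup>2 / s)" for m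
  define Y where "Y m = - (P\<^sup>2 / s\<^sup>2) * ((1 / sinh (v m) - 1 / v m) / (2 * v m))" for m
  have cZ: "c k sums Z k" if "k > 0" for k
  proof -
    have k: "(of_nat k :: complex) \<noteq> 0" using that by simp
    have "Re (of_nat k * s) > 0" using that assms by simp
    from sums_divide[OF inverse_exp_minus_one_sums[OF this], of "2 * of_nat k * s"]
    have "(\<lambda>n. 2 * (of_nat k * s) / ((of_nat k * s)\<^sup>2 + 4 * P\<^sup>2 * (of_nat (Suc n))\<^sup>2) / (2 * of_nat k * s))
      sums Z k" unfolding Z_def C_def P_def .
    moreover have "2 * (of_nat k * s) / D / (2 * of_nat k * s) = 1 / D" for D
      using k s0 by simp
    ultimately show ?thesis unfolding c_def by (simp only: power_mult_distrib)
  qed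
  have bX: "b j sums X j" for j
    unfolding b_def X_def by (intro sums_diff cZ) auto
  have Rev: "Re (v m) > 0" for m
  proof -
    have "Re (1 / s) > 0" using assms by (simp add: Re_divide power2_eq_square add_pos_nonneg)
    moreover have "v m = of_real (real (Suc m) * (2 * pi\<^sup>2)) * (1 / s)"
      by (simp add: v_def P_def)
    moreover have "real (Suc m) * (2 * pi\<^sup>2) > 0" by simp
    moreover have "Re (of_real x * z) = x * Re z" for x z by simp
    ultimately show ?thesis by (simp only: mult_pos_pos)
  qed
  have bY: "(\<lambda>j. b j m) sums Y m" for m
  proof -
    have e: "1 / ((v m)\<^sup>2 + P\<^sup>2 * (of_nat k)\<^sup>2) = s\<^sup>2 / P\<^sup>2 * c k m" for k
    proof -
      have "(v m)\<^sup>2 + P\<^sup>2 * (of_nat k)\<^sup>2 = P\<^sup>2 / s\<^sup>2 * ((of_nat k)\<^sup>2 * s\<^sup>2 + 4 * P\<^sup>2 * (of_nat (Suc m))\<^sup>2)"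
        using s0 by (simp only: v_def) (simp add: field_simps power2_eq_square)
      then show ?thesis by (simp add: c_def)
    qed
    have "(\<lambda>j. - (P\<^sup>2 / s\<^sup>2) * (s\<^sup>2 / P\<^sup>2 * c (2 * j + 2) m - s\<^sup>2 / P\<^sup>2 * c (2 * j + 1) m)) sums Y m"
      using sums_mult[OF inverse_sinh_sums[OF Rev[of m], folded P_def, unfolded e], of "- (P\<^sup>2 / s\<^sup>2)"]
      unfolding Y_def .
    moreover have "- (P\<^sup>2 / s\<^sup>2) * (s\<^sup>2 / P\<^sup>2 * x - s\<^sup>2 / P\<^sup>2 * y) = y - x" for x y
      using s0 P0 by (simp add: field_simps)
    ultimately show ?thesis unfolding b_def by (simp only:)
  qed
  obtain K where K: "K > 0" "\<And>j m. norm (b j m) \<le> K * real (Suc j) powr (- (3 / 2)) * real (Suc m) powr (- (3 / 2))"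
    using inverse_quadratic_diff_bound[OF assms, folded P_def, folded c_def, folded b_def] by metis
  have sp: "summable (\<lambda>n. real (Suc n) powr (- (3 / 2)))"
    by (subst summable_Suc_iff) (simp add: summable_real_powr_iff)
  obtain S where XS: "X sums S" and YS: "Y sums S"
    by (rule double_sums_swap[OF K(2) summable_mult[OF sp] sp _ _ bX bY]) (use K(1) in auto)
  have "(\<lambda>m. 2 * s * Y m) sums (s / (4 * P\<^sup>2) * (P\<^sup>2 / 6) - csch_sum (2 * P\<^sup>2 / s))"
  proof -
    have "(\<lambda>n. complex_of_real (1 / (real (Suc n))\<^sup>2)) sums complex_of_real (pi\<^sup>2 / 6)"
      using inverse_squares_sums by (intro sums_of_real) (simp only: Suc_eq_plus1 of_nat_power)
    then have "(\<lambda>n. 1 / (of_nat (Suc n))\<^sup>2) sums (P\<^sup>2 / 6)" by (simp add: P_def)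
    from sums_mult[OF this, of "s / (4 * P\<^sup>2)"]
    have A: "(\<lambda>n. s / (4 * P\<^sup>2) * (1 / (of_nat (Suc n))\<^sup>2)) sums (s / (4 * P\<^sup>2) * (P\<^sup>2 / 6))" .
    have "Re (2 * P\<^sup>2 / s) > 0" using Rev[of 0] by (simp add: v_def)
    from sums_diff[OF A csch_sum(2)[OF this]]
    have "(\<lambda>n. s / (4 * P\<^sup>2) * (1 / (of_nat (Suc n))\<^sup>2) - 1 / (2 * of_nat (Suc n) * sinh (v n)))
      sums (s / (4 * P\<^sup>2) * (P\<^sup>2 / 6) - csch_sum (2 * P\<^sup>2 / s))" unfolding v_def .
    moreover have "s / (4 * P\<^sup>2) * (1 / (of_nat (Suc n))\<^sup>2) - 1 / (2 * of_nat (Suc n) * sinh (v n)) = 2 * s * Y n" for n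
    proof -
      define M where "M = (of_nat (Suc n) :: complex)"
      have M: "M \<noteq> 0" unfolding M_def by (rule of_nat_neq_0)
      define h where "h = 1 / sinh (v n)"
      have vn: "v n = M * (2 * P\<^sup>2 / s)" by (simp add: v_def M_def)
      have "2 * s * Y n = s / (4 * P\<^sup>2) * (1 / M\<^sup>2) - h / (2 * M)"
        unfolding Y_def h_def[symmetric] unfolding vn
        using M s0 P0 by (simp add: field_simps power2_eq_square)
      then show ?thesis unfolding h_def M_def[symmetric] by simp
    qed
    ultimately show ?thesis by (simp only:)
  qed
  from sums_unique2[OF this sums_mult[OF YS]]
  have S1: "2 * s * S = s / (4 * P\<^sup>2) * (P\<^sup>2 / 6) - csch_sum (2 * P\<^sup>2 / s)" by simp
  define A where "A k = C k / of_nat k" for k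
  have T: "(\<lambda>j. A (2 * j + 1) - A (2 * j + 2)) sums (2 * s * S + P\<^sup>2 / 12 / s - of_real (ln 2) / 2)"
  proof -
    have "(\<lambda>j. complex_of_real (1 / (real (2 * j + 1))\<^sup>2 - 1 / (real (2 * j + 2))\<^sup>2)) sums complex_of_real (pi\<^sup>2 / 12)"
      by (intro sums_of_real alternating_inverse_squares_sums)
    then have 1: "(\<lambda>j. 1 / (of_nat (2 * j + 1))\<^sup>2 - 1 / (of_nat (2 * j + 2))\<^sup>2) sums (P\<^sup>2 / 12)"
      by (simp add: P_def)
    have "(\<lambda>j. complex_of_real (inverse (real_of_nat (2*j+1)) - inverse (real_of_nat (2*j+2)))) sums of_real (ln 2)"
      by (intro sums_of_real alternating_harmonic_series_sums')
    then have 2: "(\<lambda>j. 1 / of_nat (2 * j + 1) - 1 / of_nat (2 * j + 2)) sums (of_real (ln 2) :: complex)"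
      by (simp add: inverse_eq_divide)
    have "(\<lambda>j. 2 * s * X j + (1 / (of_nat (2 * j + 1))\<^sup>2 - 1 / (of_nat (2 * j + 2))\<^sup>2) / s
        - (1 / of_nat (2 * j + 1) - 1 / of_nat (2 * j + 2)) / 2)
      sums (2 * s * S + P\<^sup>2 / 12 / s - of_real (ln 2) / 2)"
      by (intro sums_diff sums_add sums_mult sums_divide XS 1 2)
    moreover have "2 * s * X j + (1 / (of_nat (2 * j + 1))\<^sup>2 - 1 / (of_nat (2 * j + 2))\<^sup>2) / s
        - (1 / of_nat (2 * j + 1) - 1 / of_nat (2 * j + 2)) / 2 = A (2 * j + 1) - A (2 * j + 2)" for j
    proof -
      have e: "2 * s * Z k = A k - 1 / (of_nat k)\<^sup>2 / s + 1 / of_nat k / 2" if "k > 0" for k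
      proof -
        have "(of_nat k :: complex) \<noteq> 0" using that by simp
        then show ?thesis unfolding Z_def A_def using s0
          by (simp add: field_simps power2_eq_square)
      qed
      have "2 * s * X j = 2 * s * Z (2 * j + 1) - 2 * s * Z (2 * j + 2)"
        by (simp add: X_def algebra_simps)
      also have "\<dots> = (A (2 * j + 1) - 1 / (of_nat (2 * j + 1))\<^sup>2 / s + 1 / of_nat (2 * j + 1) / 2) -
         (A (2 * j + 2) - 1 / (of_nat (2 * j + 2))\<^sup>2 / s + 1 / of_nat (2 * j + 2) / 2)"
        by (subst (1 2) e) auto
      finally show ?thesis by (simp only: diff_divide_distrib) simp
    qed
    ultimately show ?thesis by (simp only:)
  qed
  have "(\<lambda>j. A (2 * j + 1) - A (2 * j + 2)) sums csch_sum s"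
    unfolding A_def C_def by (rule csch_sum_alternating(2)[OF assms])
  from sums_unique2[OF this T] S1
  have "csch_sum s = s / (4 * P\<^sup>2) * (P\<^sup>2 / 6) - csch_sum (2 * P\<^sup>2 / s) + P\<^sup>2 / 12 / s - of_real (ln 2) / 2"
    by simp
  then show ?thesis unfolding P_def[symmetric] using P0 by (simp add: field_simps)
qed

section \<open>A Bessel-type series\<close>

text \<open>The resulting \<open>bes a x\<close> is
  \<open>sqrt (a / x) * I_1 (2 * sqrt (a * x))\<close> with the modified Bessel function
  \<open>I_1\<close>. At \<open>a = pi^2 / 12\<close> it is the function M of the overview.\<close>

definition bes_coeff :: "real \<Rightarrow> nat \<Rightarrow> real" where
  "bes_coeff a k = a ^ Suc k / (fact k * fact (Suc k))"

definition bes :: "real \<Rightarrow> real \<Rightarrow> real" where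
  "bes a x = (\<Sum>k. bes_coeff a k * x ^ k)"

definition bes' :: "real \<Rightarrow> real \<Rightarrow> real" where
  "bes' a x = (\<Sum>k. diffs (bes_coeff a) k * x ^ k)"

definition bes'' :: "real \<Rightarrow> real \<Rightarrow> real" where
  "bes'' a x = (\<Sum>k. diffs (diffs (bes_coeff a)) k * x ^ k)"

lemma bes_coeff_pos: "a > 0 \<Longrightarrow> bes_coeff a k > 0"
  by (simp add: bes_coeff_def)

lemma bes_coeff_Suc: "of_nat (Suc k) * of_nat (k + 2) * bes_coeff a (Suc k) = a * bes_coeff a k"
proof -
  have "fact (Suc (Suc k)) = (of_nat (k + 2) * fact (Suc k) :: real)"
    "fact (Suc k) = (of_nat (Suc k) * fact k :: real)"
    by (simp_all del: of_nat_Suc)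
  then have "bes_coeff a (Suc k) = a ^ Suc (Suc k) / ((of_nat (Suc k) * fact k) * (of_nat (k + 2) * fact (Suc k)))"
    by (simp only: bes_coeff_def)
  moreover have "s * t * (a * c / ((s * f) * (t * g))) = a * (c / (f * g))" if "s \<noteq> 0" "t \<noteq> 0"
    for s t c f g :: real
    using that by simp
  ultimately show ?thesis unfolding bes_coeff_def power_Suc[of a "Suc k"] by simp
qed

lemma summable_bes: "summable (\<lambda>k. bes_coeff a k * x ^ k)"
proof (rule summable_comparison_test')
  show "summable (\<lambda>k. \<bar>a\<bar> * ((\<bar>a * x\<bar>) ^ k /\<^sub>R fact k))"
    by (intro summable_mult summable_exp_generic)
  fix k :: nat
  have "norm (bes_coeff a k * x ^ k) = \<bar>a\<bar> * \<bar>a * x\<bar> ^ k / (fact k * fact (Suc k))"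
    by (simp add: bes_coeff_def abs_mult power_abs power_mult_distrib del: fact_Suc)
  also have "\<dots> \<le> \<bar>a\<bar> * \<bar>a * x\<bar> ^ k / (fact k * 1)"
    by (intro divide_left_mono mult_left_mono fact_ge_1) auto
  finally show "norm (bes_coeff a k * x ^ k) \<le> \<bar>a\<bar> * ((\<bar>a * x\<bar>) ^ k /\<^sub>R fact k)"
    by (simp add: divide_inverse mult_ac)
qed

lemma summable_bes': "summable (\<lambda>k. diffs (bes_coeff a) k * x ^ k)"
  by (rule termdiff_converges_all[OF summable_bes])

lemma summable_bes'': "summable (\<lambda>k. diffs (diffs (bes_coeff a)) k * x ^ k)"
  by (rule termdiff_converges_all[OF summable_bes'])

lemma has_real_derivative_bes: "(bes a has_real_derivative bes' a x) (at x)"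
  unfolding bes_def[abs_def] bes'_def
  by (rule termdiffs_strong_converges_everywhere[OF summable_bes])

lemma has_real_derivative_bes': "(bes' a has_real_derivative bes'' a x) (at x)"
  unfolding bes'_def[abs_def] bes''_def
  by (rule termdiffs_strong_converges_everywhere[OF summable_bes'])

lemma bes_ode: "x * bes'' a x + 2 * bes' a x = a * bes a x"
proof -
  have "(\<lambda>k. diffs (bes_coeff a) k * x ^ k * of_nat k) sums (x * bes'' a x)"
  proof -
    have "(\<lambda>k. x * (diffs (diffs (bes_coeff a)) k * x ^ k)) sums (x * bes'' a x)"
      unfolding bes''_def by (intro sums_mult summable_sums summable_bes'')
    moreover have "x * (diffs (diffs (bes_coeff a)) k * x ^ k) =
        diffs (bes_coeff a) (Suc k) * x ^ Suc k * of_nat (Suc k)" for k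
      by (simp add: diffs_def)
    ultimately have "(\<lambda>k. diffs (bes_coeff a) (Suc k) * x ^ Suc k * of_nat (Suc k)) sums (x * bes'' a x)"
      by (simp only:)
    from sums_Suc[OF this] show ?thesis by simp
  qed
  moreover have "(\<lambda>k. 2 * (diffs (bes_coeff a) k * x ^ k)) sums (2 * bes' a x)"
    unfolding bes'_def by (intro sums_mult summable_sums summable_bes')
  ultimately have "(\<lambda>k. diffs (bes_coeff a) k * x ^ k * of_nat k + 2 * (diffs (bes_coeff a) k * x ^ k))
      sums (x * bes'' a x + 2 * bes' a x)" by (rule sums_add)
  moreover have "diffs (bes_coeff a) k * x ^ k * of_nat k + 2 * (diffs (bes_coeff a) k * x ^ k)
      = a * (bes_coeff a k * x ^ k)" for k
  proof -
    have "diffs (bes_coeff a) k * x ^ k * of_nat k + 2 * (diffs (bes_coeff a) k * x ^ k) =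
      (of_nat (Suc k) * of_nat (k + 2) * bes_coeff a (Suc k)) * x ^ k"
      by (simp add: diffs_def algebra_simps)
    then show ?thesis by (simp only: bes_coeff_Suc mult.assoc[of a])
  qed
  moreover have "(\<lambda>k. a * (bes_coeff a k * x ^ k)) sums (a * bes a x)"
    unfolding bes_def by (intro sums_mult summable_sums summable_bes)
  ultimately show ?thesis by (simp add: sums_iff)
qed

text \<open>The coefficients of the derivative are \<open>a / (k + 2)\<close> times those of the
  series, hence at most \<open>a / 2\<close> times them. The third bound is the initial condition
  for the upper barrier below.\<close>

lemma bes_pos:
  assumes "a > 0" "x \<ge> 0"
  shows "bes a x > 0" "bes' a x > 0" "bes' a x \<le> a / 2 * bes a x"
proof -
  have d: "diffs (bes_coeff a) k = a * bes_coeff a k / (k + 2)" for k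
    using bes_coeff_Suc[of k a] by (simp add: diffs_def field_simps)
  have "0 < (\<Sum>k. bes_coeff a k * x ^ k)"
    by (rule suminf_pos2[OF summable_bes, of _ _ 0])
      (use assms in \<open>auto intro!: mult_nonneg_nonneg less_imp_le[OF bes_coeff_pos] simp: bes_coeff_pos\<close>)
  then show "bes a x > 0" by (simp add: bes_def)
  have dn: "diffs (bes_coeff a) k > 0" for k
    unfolding diffs_def by (intro mult_pos_pos bes_coeff_pos assms) simp
  have "0 < (\<Sum>k. diffs (bes_coeff a) k * x ^ k)"
    by (rule suminf_pos2[OF summable_bes', of _ _ 0])
      (use assms in \<open>auto intro!: mult_nonneg_nonneg less_imp_le[OF dn] simp: dn\<close>)
  then show "bes' a x > 0" by (simp add: bes'_def)
  have "(\<Sum>k. diffs (bes_coeff a) k * x ^ k) \<le> (\<Sum>k. a / 2 * (bes_coeff a k * x ^ k))"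
  proof (intro suminf_le summable_bes' summable_mult summable_bes)
    fix k
    have "a * bes_coeff a k / (k + 2) \<le> a * bes_coeff a k / 2"
      using assms by (intro divide_left_mono) (auto intro!: mult_nonneg_nonneg less_imp_le[OF bes_coeff_pos])
    then have "a * bes_coeff a k / (k + 2) * x ^ k \<le> a * bes_coeff a k / 2 * x ^ k"
      using assms by (intro mult_right_mono) auto
    also have "\<dots> = a / 2 * (bes_coeff a k * x ^ k)" by simp
    finally show "diffs (bes_coeff a) k * x ^ k \<le> a / 2 * (bes_coeff a k * x ^ k)"
      unfolding d .
  qed
  also have "\<dots> = a / 2 * (\<Sum>k. bes_coeff a k * x ^ k)" by (rule suminf_mult[OF summable_bes])
  finally show "bes' a x \<le> a / 2 * bes a x" by (simp add: bes'_def bes_def)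
qed

lemma bes_ge: 
  assumes "a > 0"
  shows "a + a\<^sup>2 / 2 + a ^ 3 / 12 \<le> bes a 1"
proof -
  have "(\<Sum>k\<in>{..<3}. bes_coeff a k * 1 ^ k) \<le> bes a 1"
    unfolding bes_def using assms
    by (intro sum_le_suminf summable_bes) (auto intro: less_imp_le[OF bes_coeff_pos])
  moreover have "(\<Sum>k\<in>{..<3}. bes_coeff a k * 1 ^ k) = a + a\<^sup>2 / 2 + a ^ 3 / 12"
    by (simp add: numeral_3_eq_3 bes_coeff_def fact_numeral power_numeral_reduce)
  ultimately show ?thesis by linarith
qed

text \<open>By the differential equation, the derivative of \<open>(M' - p M) x\<^sup>2 exp P\<close>, where \<open>P' = p\<close>, has the sign of
  the defect of \<open>p\<close> in the Riccati equation for \<open>M' / M\<close>; no convergence at infinity is needed.\<close>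

lemma bes_riccati_derivative:
  assumes x: "x > 0"
    and P: "(P has_real_derivative p x) (at x)" and p: "(p has_real_derivative p') (at x)"
  shows "((\<lambda>x. (bes' a x - p x * bes a x) * x\<^sup>2 * exp (P x)) has_real_derivative
    (a / x - p' - (p x)\<^sup>2 - 2 * p x / x) * (x\<^sup>2 * exp (P x) * bes a x)) (at x)"
proof -
  have b2: "bes'' a x = (a * bes a x - 2 * bes' a x) / x"
    using bes_ode[of x a] x by (simp add: field_simps)
  have alg: "((c2 - (p' * m + m1 * px)) * x\<^sup>2 + 2 * x * (m1 - px * m)) * e + e * px * ((m1 - px * m) * x\<^sup>2)
    = (a / x - p' - px\<^sup>2 - 2 * px / x) * (x\<^sup>2 * e * m)"
    if "c2 = (a * m - 2 * m1) / x" for c2 m m1 px e :: real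
    unfolding that using x by (simp add: field_simps power2_eq_square)
  have "((\<lambda>x. (bes' a x - p x * bes a x) * x\<^sup>2 * exp (P x)) has_real_derivative
     ((bes'' a x - (p' * bes a x + bes' a x * p x)) * x\<^sup>2 + 2 * x * (bes' a x - p x * bes a x)) * exp (P x)
      + exp (P x) * p x * ((bes' a x - p x * bes a x) * x\<^sup>2)) (at x)"
    by (rule derivative_eq_intros has_real_derivative_bes has_real_derivative_bes' P p refl)+
      (simp add: power2_eq_square algebra_simps)
  then show ?thesis unfolding alg[OF b2] .
qed

text \<open>With \<open>u = 1 / sqrt x\<close>, the Riccati equation fixes the first terms of the
  expansion of \<open>M' / M\<close> as \<open>b * u - 3 / 4 * u^2\<close>. Stopping there gives the
  defect \<open>3 / 16 * u^4\<close> of one sign. The next coefficient would be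
  \<open>3 / (32 * b)\<close>, and replacing it by the larger \<open>1 / 4\<close> reverses the
  sign, which yields the upper barrier.\<close>

lemma bes_log_derivative_bounds:
  assumes b: "0.9 \<le> b" "b \<le> 1" and x: "x \<ge> 1 / 4"
  defines "u \<equiv> 1 / sqrt x" and "h \<equiv> bes' (b\<^sup>2) x / bes (b\<^sup>2) x"
  shows "b * u - 3 / 4 * u\<^sup>2 \<le> h" "h \<le> b * u - 3 / 4 * u\<^sup>2 + u ^ 3 / 4"
proof -
  define a where "a = b\<^sup>2"
  have a: "a > 0" using b by (simp add: a_def)
  have pos: "bes a y > 0" if "y \<ge> 1 / 4" for y using bes_pos(1)[OF a] that by simp
  define p where "p y = b / sqrt y - 3 / 4 / y" for y :: real
  define P where "P y = 2 * b * sqrt y - 3 / 4 * ln y" for y :: real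
  define r where "r y = p y + 1 / (4 * (y * sqrt y))" for y :: real
  define R where "R y = P y - 1 / (2 * sqrt y)" for y :: real
  have P: "(P has_real_derivative p y) (at y)" if "y > 0" for y
    unfolding P_def p_def using that by (auto intro!: derivative_eq_intros simp: field_simps)
  have p: "(p has_real_derivative - b / (2 * (y * sqrt y)) + 3 / 4 / y\<^sup>2) (at y)" if "y > 0" for y
    unfolding p_def using that
    by (auto intro!: derivative_eq_intros simp: field_simps power2_eq_square)
  have R: "(R has_real_derivative r y) (at y)" if "y > 0" for y
    unfolding R_def r_def using that
    by (auto intro!: derivative_eq_intros P simp: field_simps power2_eq_square)
  have r: "(r has_real_derivative - b / (2 * (y * sqrt y)) + 3 / 4 / y\<^sup>2 - 3 / (8 * (y\<^sup>2 * sqrt y))) (at y)"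
    if "y > 0" for y
    unfolding r_def using that
    by (auto intro!: derivative_eq_intros p simp: field_simps power2_eq_square)
  have sq: "1 / y = s\<^sup>2" "1 / sqrt y = s" "1 / (y * sqrt y) = s ^ 3" "1 / y\<^sup>2 = s ^ 4" "1 / (y\<^sup>2 * sqrt y) = s ^ 5"
    if "y > 0" "s = 1 / sqrt y" for y s :: real
  proof -
    have "1 / y = (1 / sqrt y)\<^sup>2" using that(1) by (simp add: power_divide)
    then show *: "1 / y = s\<^sup>2" "1 / sqrt y = s" by (simp_all add: that(2))
    have "1 / (y * sqrt y) = (1 / y) * (1 / sqrt y)" by simp
    then show "1 / (y * sqrt y) = s ^ 3" unfolding * by (simp add: power2_eq_square power3_eq_cube)
    have "1 / y\<^sup>2 = (1 / y)\<^sup>2" by (simp add: power_divide)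
    then show **: "1 / y\<^sup>2 = s ^ 4" unfolding * by simp
    have "1 / (y\<^sup>2 * sqrt y) = (1 / y\<^sup>2) * (1 / sqrt y)" by simp
    then show "1 / (y\<^sup>2 * sqrt y) = s ^ 5" unfolding * ** by (simp add: eval_nat_numeral)
  qed
  have ps: "p y = b * s - 3 / 4 * s\<^sup>2" "r y = b * s - 3 / 4 * s\<^sup>2 + s ^ 3 / 4"
    if "y > 0" "s = 1 / sqrt y" for y s
  proof -
    have "p y = b * (1 / sqrt y) - 3 / 4 * (1 / y)" by (simp add: p_def)
    then show "p y = b * s - 3 / 4 * s\<^sup>2" unfolding sq[OF that] .
    moreover have "r y = p y + 1 / (y * sqrt y) / 4" by (simp add: r_def)
    ultimately show "r y = b * s - 3 / 4 * s\<^sup>2 + s ^ 3 / 4" unfolding sq[OF that] by simp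
  qed
  have low: "a / y - (- b / (2 * (y * sqrt y)) + 3 / 4 / y\<^sup>2) - (p y)\<^sup>2 - 2 * p y / y \<ge> 0"
    if "y > 0" for y
  proof -
    define s where "s = 1 / sqrt y"
    note sq = sq[OF that s_def] and ps = ps[OF that s_def]
    have "a / y - (- b / (2 * (y * sqrt y)) + 3 / 4 / y\<^sup>2) - (p y)\<^sup>2 - 2 * p y / y =
      a * (1 / y) - (- b / 2 * (1 / (y * sqrt y)) + 3 / 4 * (1 / y\<^sup>2)) - (p y)\<^sup>2 - 2 * p y * (1 / y)"
      by simp
    also have "\<dots> = 3 / 16 * s ^ 4" unfolding sq ps a_def by algebra
    finally have e: "a / y - (- b / (2 * (y * sqrt y)) + 3 / 4 / y\<^sup>2) - (p y)\<^sup>2 - 2 * p y / y = 3 / 16 * s ^ 4" .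
    show ?thesis unfolding e by simp
  qed
  have up: "a / y - (- b / (2 * (y * sqrt y)) + 3 / 4 / y\<^sup>2 - 3 / (8 * (y\<^sup>2 * sqrt y))) - (r y)\<^sup>2 - 2 * r y / y \<le> 0"
    if "y > 0" for y
  proof -
    define s where "s = 1 / sqrt y"
    note sq = sq[OF that s_def] and ps = ps[OF that s_def]
    have "a / y - (- b / (2 * (y * sqrt y)) + 3 / 4 / y\<^sup>2 - 3 / (8 * (y\<^sup>2 * sqrt y))) - (r y)\<^sup>2 - 2 * r y / y
      = a * (1 / y) - (- b / 2 * (1 / (y * sqrt y)) + 3 / 4 * (1 / y\<^sup>2) - 3 / 8 * (1 / (y\<^sup>2 * sqrt y))) - (r y)\<^sup>2 - 2 * r y * (1 / y)"
      by simp
    also have "\<dots> = - (s ^ 4 * (b / 2 - 3 / 16 - s / 4 + s\<^sup>2 / 16))"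
      unfolding sq ps a_def by (simp add: field_simps power2_eq_square eval_nat_numeral)
    also have "\<dots> \<le> 0"
    proof -
      \<comment> \<open>Completing the square leaves the constant \<open>b / 2 - 7 / 16\<close>,
        nonnegative as \<open>b\<close> is at least 0.9.\<close>
      have "0 \<le> (s - 2)\<^sup>2 / 16" by simp
      also have "\<dots> = s\<^sup>2 / 16 - s / 4 + 1 / 4" by (simp add: power2_eq_square field_simps)
      finally have "0 \<le> b / 2 - 3 / 16 - s / 4 + s\<^sup>2 / 16" using b(1) by simp
      then show ?thesis by simp
    qed
    finally show ?thesis .
  qed
  \<comment> \<open>The starting point is \<open>1 / 4\<close>, where \<open>u = 2\<close>: the
    lower barrier equals \<open>2 * b - 3\<close> there and is negative, the upper one equals
    \<open>2 * b - 1\<close> and exceeds the trivial bound \<open>a / 2\<close>.\<close>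
  have s4: "sqrt (1 / 4) = 1 / 2" by (simp add: real_sqrt_divide)
  let ?W = "\<lambda>p P y. (bes' a y - p y * bes a y) * y\<^sup>2 * exp (P y)"
  have "?W p P (1 / 4) \<le> ?W p P x"
  proof (rule DERIV_nonneg_imp_nondecreasing[OF x])
    fix y :: real assume y: "1 / 4 \<le> y"
    then have "y > 0" by simp
    from bes_riccati_derivative[OF this P p, OF this this, of a] low[OF this] pos[OF y]
    show "\<exists>d. (?W p P has_real_derivative d) (at y) \<and> 0 \<le> d" by fastforce
  qed
  moreover have "0 \<le> ?W p P (1 / 4)"
  proof -
    have "p (1 / 4) \<le> 0" using b by (simp add: p_def s4)
    then have "p (1 / 4) * bes a (1 / 4) \<le> 0" using pos[of "1 / 4"] by (simp add: mult_nonpos_nonneg)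
    then show ?thesis using bes_pos(2)[OF a, of "1 / 4"] by simp
  qed
  ultimately have "0 \<le> ?W p P x" by linarith
  then have "0 \<le> bes' a x - p x * bes a x" using x by (simp add: zero_le_mult_iff)
  then have "p x \<le> h" unfolding h_def a_def[symmetric] using pos[OF x] by (simp add: field_simps)
  moreover have "p x = b * u - 3 / 4 * u\<^sup>2" using x by (intro ps(1)) (auto simp: u_def)
  ultimately show "b * u - 3 / 4 * u\<^sup>2 \<le> h" by simp
  have "?W r R x \<le> ?W r R (1 / 4)"
  proof (rule DERIV_nonpos_imp_nonincreasing[OF x])
    fix y :: real assume y: "1 / 4 \<le> y"
    then have "y > 0" by simp
    from bes_riccati_derivative[OF this R r, OF this this, of a] up[OF this] pos[OF y]
    show "\<exists>d. (?W r R has_real_derivative d) (at y) \<and> d \<le> 0"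
      by (fastforce intro: mult_nonpos_nonneg)
  qed
  moreover have "?W r R (1 / 4) \<le> 0"
  proof -
    have "a \<le> 1" using b mult_mono[of b 1 b 1] by (simp add: a_def power2_eq_square)
    then have "a / 2 \<le> r (1 / 4)" using b by (simp add: r_def p_def s4)
    then have "a / 2 * bes a (1 / 4) \<le> r (1 / 4) * bes a (1 / 4)"
      using pos[of "1 / 4"] by (intro mult_right_mono) auto
    then have "bes' a (1 / 4) - r (1 / 4) * bes a (1 / 4) \<le> 0" using bes_pos(3)[OF a, of "1 / 4"] by linarith
    then show ?thesis by (simp add: mult_nonpos_nonneg)
  qed
  ultimately have "?W r R x \<le> 0" by linarith
  then have "bes' a x - r x * bes a x \<le> 0" using x by (simp add: mult_le_0_iff)
  then have "h \<le> r x" unfolding h_def a_def[symmetric] using pos[OF x] by (simp add: field_simps)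
  moreover have "r x = b * u - 3 / 4 * u\<^sup>2 + u ^ 3 / 4" using x by (intro ps(2)) (auto simp: u_def)
  ultimately show "h \<le> b * u - 3 / 4 * u\<^sup>2 + u ^ 3 / 4" by simp
qed

text \<open>The exponent is an antiderivative of the lower barrier, so the quotient of the two sides
  increases and only its value at 1 matters. The sharp asymptotic constant would be
  \<open>sqrt b / (2 * sqrt pi)\<close>, about 0.27. The interval for \<open>b\<close> encloses
  \<open>pi / sqrt 12\<close>.\<close>

lemma bes_lower_bound:
  assumes b: "0.9068 \<le> b" "b \<le> 0.907" and x: "x \<ge> 1"
  shows "0.19 * exp (2 * b * sqrt x - 3 / 4 * ln x) \<le> bes (b\<^sup>2) x"
proof -
  define a where "a = b\<^sup>2"
  have a: "a > 0" using b by (simp add: a_def)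
  let ?L = "\<lambda>y. bes a y * exp (- (2 * b * sqrt y - 3 / 4 * ln y))"
  have "?L 1 \<le> ?L x"
  proof (rule DERIV_nonneg_imp_nondecreasing[OF x])
    fix y :: real assume y: "1 \<le> y"
    let ?p = "b / sqrt y - 3 / 4 / y"
    have "(?L has_real_derivative (bes' a y - ?p * bes a y) * exp (- (2 * b * sqrt y - 3 / 4 * ln y))) (at y)"
      using y by (auto intro!: derivative_eq_intros has_real_derivative_bes simp: field_simps)
    moreover have "?p \<le> bes' a y / bes a y"
      using bes_log_derivative_bounds(1)[of b y] b y by (simp add: a_def power_divide)
    then have "0 \<le> bes' a y - ?p * bes a y"
      using bes_pos(1)[OF a, of y] y by (simp add: pos_le_divide_eq)
    ultimately show "\<exists>d. (?L has_real_derivative d) (at y) \<and> 0 \<le> d" by fastforce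
  qed
  moreover have "0.19 \<le> ?L 1"
  proof -
    have a8: "0.822 \<le> a" using power_mono[OF b(1), of 2] by (simp add: a_def power2_eq_square)
    have "1.2 \<le> 0.822 + 0.822\<^sup>2 / 2 + 0.822 ^ 3 / (12 :: real)" by (simp add: power2_eq_square power3_eq_cube)
    also have "\<dots> \<le> a + a\<^sup>2 / 2 + a ^ 3 / 12"
      using a8 by (intro add_mono divide_right_mono power_mono) auto
    also have "\<dots> \<le> bes a 1" by (rule bes_ge[OF a])
    finally have m: "1.2 \<le> bes a 1" .
    \<comment> \<open>The number \<open>2 * b + 0.18\<close> is just below 2, which reduces the
      estimate to \<open>exp 1 < 2.72\<close>.\<close>
    have "exp (2 * b) * 1.18 \<le> exp (2 * b) * exp (0.18 :: real)"
      using exp_ge_add_one_self[of "0.18 :: real"] by (intro mult_left_mono) auto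
    also have "\<dots> = exp (2 * b + 0.18)" by (rule exp_add[symmetric])
    also have "\<dots> \<le> exp (1 + 1)" unfolding exp_le_cancel_iff using b by simp
    also have "\<dots> = exp 1 * exp (1 :: real)" by (rule exp_add)
    also have "\<dots> \<le> 2.72 * 2.72" using e_less_272 by (intro mult_mono) auto
    finally have "0.19 * exp (2 * b) \<le> 1.2" by simp
    then have "0.19 * exp (2 * b) \<le> bes a 1" using m by linarith
    then show ?thesis by (simp add: exp_minus field_simps)
  qed
  ultimately have "0.19 \<le> ?L x" by linarith
  then show ?thesis unfolding a_def[symmetric] exp_minus by (simp add: field_simps)
qed

text \<open>The Riccati equation and its derivative express \<open>h'\<close> and \<open>h''\<close>
  as polynomials in \<open>h\<close> and \<open>u\<close>, into which the barriers for
  \<open>h\<close> are inserted. In \<open>h'\<close> the terms of order \<open>u^2\<close> cancel,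
  in \<open>h''\<close> those of order \<open>u^4\<close>; the width \<open>u^3 / 4\<close> between
  the barriers is small enough to survive both cancellations.\<close>

lemma bes_h_derivative_bounds:
  assumes b: "0.9068 \<le> b" "b \<le> 0.907" and x: "x \<ge> 1600"
  defines "u \<equiv> 1 / sqrt x" and "a \<equiv> b\<^sup>2"
  defines "h \<equiv> (\<lambda>x. bes' a x / bes a x)"
  defines "h' \<equiv> (\<lambda>x. a / x - (h x)\<^sup>2 - 2 * h x / x)"
  defines "h'' \<equiv> (\<lambda>x. - a / x\<^sup>2 - 2 * h x * h' x - 2 * h' x / x + 2 * h x / x\<^sup>2)"
  shows "(h has_real_derivative h' x) (at x)" "(h' has_real_derivative h'' x) (at x)"
    "0 \<le> h x" "h x \<le> b * u"
    "u ^ 3 * (b / 2 - 0.94 * u) \<le> - h' x" "- h' x \<le> b / 2 * u ^ 3"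
    "0 \<le> h'' x" "h'' x \<le> 1.3 * b * u ^ 5"
proof -
  have a: "a > 0" using b by (simp add: a_def)
  have pos: "bes a x > 0" using bes_pos(1)[OF a, of x] x by simp
  have b2: "bes'' a x = (a * bes a x - 2 * bes' a x) / x"
    using bes_ode[of x a] x by (simp add: field_simps)
  show h': "(h has_real_derivative h' x) (at x)"
    unfolding h_def
    by (rule derivative_eq_intros has_real_derivative_bes has_real_derivative_bes' refl)+
      (use pos x in \<open>simp_all add: h'_def h_def b2 field_simps power2_eq_square\<close>)
  show "(h' has_real_derivative h'' x) (at x)"
  proof -
    have "((\<lambda>x. a / x - (h x)\<^sup>2 - 2 * h x / x) has_real_derivative
        (- a / x\<^sup>2 - 2 * h x * h' x - (2 * h' x * x - 2 * h x) / x\<^sup>2)) (at x)"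
      using x by (auto intro!: derivative_eq_intros h' simp: power2_eq_square)
    moreover have "- a / x\<^sup>2 - 2 * h x * h' x - (2 * h' x * x - 2 * h x) / x\<^sup>2 = h'' x"
      unfolding h''_def using x by (simp add: diff_divide_distrib power2_eq_square)
    ultimately show ?thesis by (simp only: h'_def)
  qed
  have "sqrt 1600 \<le> sqrt x" using x by (simp only: real_sqrt_le_iff)
  moreover have "sqrt 1600 = 40" by (rule real_sqrt_unique) auto
  ultimately have "40 \<le> sqrt x" by simp
  then have u: "0 < u" "u \<le> 1 / 40" using x by (simp_all add: u_def divide_simps)
  have xu: "1 / x = u\<^sup>2" using x by (simp add: u_def power_divide)
  have lo: "b * u - 3 / 4 * u\<^sup>2 \<le> h x" and hi: "h x \<le> b * u - 3 / 4 * u\<^sup>2 + u ^ 3 / 4"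
    using bes_log_derivative_bounds[of b x] b x unfolding h_def a_def u_def by simp_all
  have lo0: "0 \<le> b * u - 3 / 4 * u\<^sup>2"
  proof -
    have "0 \<le> u * (b - 3 / 4 * u)" using u b by (intro mult_nonneg_nonneg) auto
    then show ?thesis by (simp add: algebra_simps power2_eq_square)
  qed
  then show h0: "0 \<le> h x" using lo by linarith
  have "b * u - 3 / 4 * u\<^sup>2 + u ^ 3 / 4 = b * u - u\<^sup>2 * (3 / 4 - u / 4)"
    by (simp add: power2_eq_square power3_eq_cube algebra_simps)
  also have "\<dots> \<le> b * u" using u by simp
  finally show "h x \<le> b * u" using hi by linarith
  have h'u: "- h' x = (h x)\<^sup>2 + 2 * h x * u\<^sup>2 - b\<^sup>2 * u\<^sup>2"
  proof -
    have "- h' x = (h x)\<^sup>2 + 2 * h x * (1 / x) - b\<^sup>2 * (1 / x)" by (simp add: h'_def a_def)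
    then show ?thesis unfolding xu .
  qed
  have "u ^ 3 * (b / 2 - 15 / 16 * u) = (b * u - 3 / 4 * u\<^sup>2)\<^sup>2 + 2 * (b * u - 3 / 4 * u\<^sup>2) * u\<^sup>2 - b\<^sup>2 * u\<^sup>2"
    by (simp add: field_simps power2_eq_square eval_nat_numeral)
  also have "\<dots> \<le> - h' x"
    unfolding h'u using lo lo0 by (intro diff_right_mono add_mono power_mono mult_right_mono) auto
  finally have A1: "u ^ 3 * (b / 2 - 15 / 16 * u) \<le> - h' x" .
  have "u ^ 3 * (b / 2 - 0.94 * u) \<le> u ^ 3 * (b / 2 - 15 / 16 * u)"
    using u by (intro mult_left_mono) auto
  with A1 show A1': "u ^ 3 * (b / 2 - 0.94 * u) \<le> - h' x" by linarith
  have "- h' x \<le> (b * u - 3 / 4 * u\<^sup>2 + u ^ 3 / 4)\<^sup>2 + 2 * (b * u - 3 / 4 * u\<^sup>2 + u ^ 3 / 4) * u\<^sup>2 - b\<^sup>2 * u\<^sup>2"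
    unfolding h'u using hi h0 by (intro diff_right_mono add_mono power_mono mult_right_mono) auto
  also have "\<dots> = u ^ 3 * (b / 2 + (9 / 16 + b / 2 - 3 / 2 + u / 8 + u\<^sup>2 / 16) * u)"
    by (simp add: field_simps power2_eq_square eval_nat_numeral)
  also have "\<dots> \<le> u ^ 3 * (b / 2 + (- 0.48) * u)"
  proof -
    have "u\<^sup>2 \<le> 1 / 40 * (1 / 40)" using u unfolding power2_eq_square by (intro mult_mono) auto
    then show ?thesis using u b by (intro mult_left_mono add_left_mono mult_right_mono) auto
  qed
  finally have A2: "- h' x \<le> u ^ 3 * (b / 2 - 0.48 * u)" by simp
  also have "\<dots> \<le> u ^ 3 * (b / 2)" using u by (intro mult_left_mono) auto
  finally show "- h' x \<le> b / 2 * u ^ 3" by (simp add: mult.commute)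
  have h''u: "h'' x = 2 * (- h' x) * (h x + u\<^sup>2) + 2 * h x * u ^ 4 - b\<^sup>2 * u ^ 4"
  proof -
    have "1 / x\<^sup>2 = u ^ 4" using xu by (metis power_mult power_one_over mult_2 numeral_Bit0 numeral_code(2) power_mult_distrib power_even_eq power2_eq_square)
    moreover have "h'' x = 2 * (- h' x) * (h x + 1 / x) + 2 * h x * (1 / x\<^sup>2) - a * (1 / x\<^sup>2)"
      unfolding h''_def by (simp add: algebra_simps)
    ultimately show ?thesis unfolding xu a_def by simp
  qed
  have B1: "u * (b + u / 4) \<le> h x + u\<^sup>2"
    using lo by (simp add: field_simps power2_eq_square)
  have B2: "h x + u\<^sup>2 \<le> u * (b + 0.26 * u)"
  proof -
    have "h x + u\<^sup>2 \<le> u * (b + (1 / 4 + u / 4) * u)"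
      using hi by (simp add: field_simps power2_eq_square power3_eq_cube)
    also have "\<dots> \<le> u * (b + 0.26 * u)"
      using u by (intro mult_left_mono add_left_mono mult_right_mono) auto
    finally show ?thesis .
  qed
  have "u ^ 5 * (0.37 * b - 1.97 * u) =
      2 * (u ^ 3 * (b / 2 - 0.94 * u)) * (u * (b + u / 4)) + 2 * (b * u - 3 / 4 * u\<^sup>2) * u ^ 4 - b\<^sup>2 * u ^ 4"
    by (simp add: field_simps power2_eq_square eval_nat_numeral)
  also have "\<dots> \<le> h'' x"
  proof -
    have "0 \<le> b / 2 - 0.94 * u" using u b by simp
    then have "0 \<le> u ^ 3 * (b / 2 - 0.94 * u)" using u by (intro mult_nonneg_nonneg) auto
    then have "0 \<le> - h' x" using A1' by linarith
    then show ?thesis unfolding h''u using A1' B1 lo lo0 h0 u b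
      by (intro diff_right_mono add_mono mult_mono mult_right_mono) auto
  qed
  finally have "u ^ 5 * (0.37 * b - 1.97 * u) \<le> h'' x" .
  moreover have "0 \<le> u ^ 5 * (0.37 * b - 1.97 * u)" using u b by (intro mult_nonneg_nonneg) auto
  ultimately show "0 \<le> h'' x" by linarith
  have "0 \<le> - h' x"
  proof -
    have "0 \<le> u ^ 3 * (b / 2 - 0.94 * u)" using u b by (intro mult_nonneg_nonneg) auto
    then show ?thesis using A1' by linarith
  qed
  then have "h'' x \<le> 2 * (u ^ 3 * (b / 2 - 0.48 * u)) * (u * (b + 0.26 * u)) + 2 * (b * u) * u ^ 4 - b\<^sup>2 * u ^ 4"
    unfolding h''u using A2 B2 \<open>h x \<le> b * u\<close> u b h0
    by (intro diff_right_mono add_mono mult_mono mult_right_mono) auto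
  also have "\<dots> = 1.3 * b * u ^ 5 - 0.2496 * u ^ 6"
    by (simp add: field_simps power2_eq_square eval_nat_numeral)
  also have "\<dots> \<le> 1.3 * b * u ^ 5" by simp
  finally show "h'' x \<le> 1.3 * b * u ^ 5" .
qed

text \<open>Since \<open>R' / R\<close> is the increment of \<open>h\<close> over a unit step, mean
  values give first differences of \<open>R\<close> close to \<open>h'\<close>, of order
  \<open>U^3\<close>, and second differences close to \<open>h''\<close>, of order
  \<open>U^5\<close>. All bounds are expressed by the one number \<open>U\<close>, taken at the left
  end.\<close>

lemma bes_ratio_bounds:
  assumes b: "0.9068 \<le> b" "b \<le> 0.907" and X: "X \<ge> 1999"
  defines "U \<equiv> 1 / sqrt X" and "R \<equiv> (\<lambda>x. bes (b\<^sup>2) (x + 1) / bes (b\<^sup>2) x)"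
  shows "0.43 * U ^ 3 \<le> R X - R (X + 1)" "0.43 * U ^ 3 \<le> R (X + 1) - R (X + 2)"
    "\<bar>R X - 2 * R (X + 1) + R (X + 2)\<bar> \<le> 1.4 * U ^ 5"
    "\<And>x. X \<le> x \<Longrightarrow> R x \<le> 1.03" "\<And>x. X \<le> x \<Longrightarrow> 1 \<le> R x"
proof -
  define a where "a = b\<^sup>2"
  have a: "a > 0" using b by (simp add: a_def)
  define h where "h x = bes' a x / bes a x" for x
  define h' where "h' x = a / x - (h x)\<^sup>2 - 2 * h x / x" for x
  define h'' where "h'' x = - a / x\<^sup>2 - 2 * h x * h' x - 2 * h' x / x + 2 * h x / x\<^sup>2" for x
  note H = bes_h_derivative_bounds[OF b, folded a_def, folded h_def, folded h'_def, folded h''_def]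
  have pos: "bes a x > 0" if "X \<le> x" for x using bes_pos(1)[OF a, of x] X that by simp
  have "44 \<le> sqrt X"
  proof -
    have "sqrt (44\<^sup>2) \<le> sqrt X" using X by (simp only: real_sqrt_le_iff) simp
    then show ?thesis by simp
  qed
  then have U: "0 < U" "U \<le> 1 / 44" using X by (simp_all add: U_def divide_simps)
  have uU: "0 < 1 / sqrt x" "1 / sqrt x \<le> U" if "X \<le> x" for x
    using that X unfolding U_def by (auto intro!: frac_le)
  \<comment> \<open>The points at which lower bounds are used lie within distance 3 of
    \<open>X\<close>; for \<open>X \<ge> 1999\<close> this changes the square root by less than one
    part in a thousand.\<close>
  have uU3: "0.999 * U \<le> 1 / sqrt x" if "X \<le> x" "x \<le> X + 3" for x
  proof -
    have "0.998001 * x \<le> X" using that X by simp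
    then have "sqrt (0.998001 * x) \<le> sqrt X" by simp
    moreover have "sqrt (0.998001 * x) = 0.999 * sqrt x"
      using that X by (intro real_sqrt_unique) (simp_all add: power_mult_distrib power2_eq_square)
    ultimately have "0.999 * sqrt x \<le> sqrt X" by (simp only:)
    moreover have "0 < sqrt x" "0 < sqrt X" using that X by simp_all
    ultimately show ?thesis unfolding U_def by (simp add: field_simps)
  qed
  have h'lo: "0.4305 * U ^ 3 \<le> - h' x" if "X \<le> x" "x \<le> X + 3" for x
  proof -
    define u where "u = 1 / sqrt x"
    have u: "0 < u" "u \<le> U" "0.999 * U \<le> u" using uU uU3 that by (auto simp: u_def)
    have "0.4305 * U ^ 3 \<le> (0.999 * U) ^ 3 * 0.432" using U by (simp add: power_mult_distrib power3_eq_cube)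
    also have "\<dots> \<le> u ^ 3 * (b / 2 - 0.94 * u)"
      using u U b by (intro mult_mono power_mono) auto
    also have "\<dots> \<le> - h' x" using H(5)[of x] that X unfolding u_def by simp
    finally show ?thesis .
  qed
  have h'hi: "- h' x \<le> 0.4535 * U ^ 3" if "X \<le> x" for x
  proof -
    have "- h' x \<le> b / 2 * (1 / sqrt x) ^ 3" using H(6)[of x] that X by simp
    also have "\<dots> \<le> 0.4535 * U ^ 3" using b uU[OF that] by (intro mult_mono power_mono) auto
    finally show ?thesis .
  qed
  have h''hi: "\<bar>h'' x\<bar> \<le> 1.18 * U ^ 5" if "X \<le> x" for x
  proof -
    have "h'' x \<le> 1.3 * b * (1 / sqrt x) ^ 5" "0 \<le> h'' x" using H(7,8)[of x] that X by simp_all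
    moreover have "1.3 * b * (1 / sqrt x) ^ 5 \<le> 1.18 * U ^ 5"
      using b uU[OF that] by (intro mult_mono power_mono) auto
    ultimately show ?thesis by linarith
  qed
  have R_eq: "R x = bes a (x + 1) / bes a x" for x by (simp add: R_def a_def)
  show R1: "1 \<le> R x" if "X \<le> x" for x
  proof -
    have "bes a x \<le> bes a (x + 1)"
    proof (rule DERIV_nonneg_imp_nondecreasing[of x "x + 1" "bes a"])
      fix y assume "x \<le> y"
      then show "\<exists>d. (bes a has_real_derivative d) (at y) \<and> 0 \<le> d"
        using has_real_derivative_bes[of a y] bes_pos(2)[OF a, of y] X that
        by (intro exI[of _ "bes' a y"]) auto
    qed simp
    then show ?thesis unfolding R_eq using pos[OF that] by simp
  qed
  show R2: "R x \<le> 1.03" if "X \<le> x" for x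
  proof -
    \<comment> \<open>Here \<open>h\<close> is at most \<open>0.907 / 44 < 1 / 40\<close>, so
      \<open>M\<close> grows by at most the factor \<open>exp (1 / 40)\<close> over a unit
      step.\<close>
    let ?g = "\<lambda>y. bes a y * exp (- (y / 40))"
    have "?g (x + 1) \<le> ?g x"
    proof (rule DERIV_nonpos_imp_nonincreasing[of x "x + 1" ?g])
      fix y assume y: "x \<le> y"
      have "(?g has_real_derivative (bes' a y - bes a y / 40) * exp (- (y / 40))) (at y)"
        by (auto intro!: derivative_eq_intros has_real_derivative_bes simp: algebra_simps)
      moreover have "h y \<le> 1 / 40"
      proof -
        have "h y \<le> b * (1 / sqrt y)" using H(4)[of y] y that X by simp
        also have "\<dots> \<le> 0.907 * (1 / 44)"
        proof (intro mult_mono)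
          show "1 / sqrt y \<le> 1 / 44" using U uU[of y] y that by linarith
        qed (use b uU[of y] y that in auto)
        finally show ?thesis by simp
      qed
      then have "bes' a y - bes a y / 40 \<le> 0"
        using pos[of y] y that unfolding h_def by (simp add: pos_divide_le_eq)
      ultimately show "\<exists>d. (?g has_real_derivative d) (at y) \<and> d \<le> 0"
        by (fastforce intro: mult_nonpos_nonneg)
    qed simp
    moreover have "exp (- ((x + 1) / 40)) = exp (- (x / 40)) * exp (- (1 / 40))"
      unfolding exp_add[symmetric] by (simp add: add_divide_distrib)
    ultimately have "(bes a (x + 1) * exp (- (1 / 40))) * exp (- (x / 40)) \<le> bes a x * exp (- (x / 40))"
      by (simp only: mult_ac)
    then have "bes a (x + 1) * exp (- (1 / 40)) \<le> bes a x"
      by (rule mult_right_le_imp_le) simp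
    then have "bes a (x + 1) / exp (1 / 40) \<le> bes a x" by (simp only: exp_minus divide_inverse)
    then have "R x \<le> exp (1 / 40)" unfolding R_eq using pos[OF that]
      by (simp only: pos_divide_le_eq exp_gt_zero mult.commute)
    also have "exp (1 / 40 :: real) \<le> 1.03"
      using exp_bound[of "1 / 40 :: real"] by (simp add: power2_eq_square)
    finally show ?thesis .
  qed
  define R' where "R' x = R x * (h (x + 1) - h x)" for x
  define R'' where "R'' x = R x * ((h (x + 1) - h x)\<^sup>2 + (h' (x + 1) - h' x))" for x
  have dR: "(R has_real_derivative R' x) (at x)" if "X \<le> x" for x
  proof -
    have "((\<lambda>x. bes a (x + 1)) has_real_derivative bes' a (x + 1)) (at x)"
      using DERIV_shift[of "bes a" "bes' a (x + 1)" x 1] has_real_derivative_bes by simp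
    from DERIV_divide[OF this has_real_derivative_bes[of a x]]
    have "(R has_real_derivative (bes' a (x + 1) * bes a x - bes a (x + 1) * bes' a x) / (bes a x * bes a x)) (at x)"
      using pos[OF that] by (simp add: R_eq[abs_def])
    also have "(bes' a (x + 1) * bes a x - bes a (x + 1) * bes' a x) / (bes a x * bes a x) = R' x"
      using pos[OF that] pos[of "x + 1"] that by (simp add: R'_def R_eq h_def field_simps)
    finally show ?thesis .
  qed
  have dh: "(h has_real_derivative h' x) (at x)" "(h' has_real_derivative h'' x) (at x)" if "X \<le> x" for x
    using H(1,2)[of x] that X by simp_all
  have dR': "(R' has_real_derivative R'' x) (at x)" if "X \<le> x" for x
  proof -
    have "((\<lambda>x. h (x + 1)) has_real_derivative h' (x + 1)) (at x)"
      using DERIV_shift[of h "h' (x + 1)" x 1] dh(1)[of "x + 1"] that by simp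
    from DERIV_mult[OF dR[OF that] DERIV_diff[OF this dh(1)[OF that]]]
    show ?thesis unfolding R'_def[abs_def]
      by (rule DERIV_cong) (simp add: R''_def R'_def algebra_simps power2_eq_square)
  qed
  have h_diff: "\<exists>z. x < z \<and> z < x + 1 \<and> h (x + 1) - h x = h' z" if "X \<le> x" for x
    using MVT2[of x "x + 1" h h'] dh(1) that by auto
  have h'_diff: "\<exists>z. x < z \<and> z < x + 1 \<and> h' (x + 1) - h' x = h'' z" if "X \<le> x" for x
    using MVT2[of x "x + 1" h' h''] dh(2) that by auto
  have e: "0.43 * U ^ 3 \<le> R x - R (x + 1)" if x: "X \<le> x" "x \<le> X + 1" for x
  proof -
    obtain z where z: "x < z" "z < x + 1" "R (x + 1) - R x = R' z"
      using MVT2[of x "x + 1" R R'] dR x by auto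
    obtain w where w: "z < w" "w < z + 1" "h (z + 1) - h z = h' w"
      using h_diff[of z] z x by auto
    have "1 * (0.43 * U ^ 3) \<le> R z * - h' w"
    proof (intro mult_mono)
      have "0.43 * U ^ 3 \<le> 0.4305 * U ^ 3" using U by simp
      also have "\<dots> \<le> - h' w" using h'lo[of w] w z x by simp
      finally show "0.43 * U ^ 3 \<le> - h' w" .
    qed (use R1[of z] z x U in auto)
    then show ?thesis using z(3) w(3) by (simp add: R'_def)
  qed
  show "0.43 * U ^ 3 \<le> R X - R (X + 1)" "0.43 * U ^ 3 \<le> R (X + 1) - R (X + 2)"
    using e[of X] e[of "X + 1"] by (simp_all add: add.assoc)
  \<comment> \<open>The second difference of \<open>R\<close> is a first difference of the unit
    increment of \<open>R\<close>; two mean values reduce it to a single value of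
    \<open>R''\<close>.\<close>
  have "((\<lambda>x. R (x + 1) - R x) has_real_derivative R' (x + 1) - R' x) (at x)" if "X \<le> x" for x
    using DERIV_shift[of R "R' (x + 1)" x 1] dR[of "x + 1"] dR[OF that] that by (intro DERIV_diff) auto
  then obtain y where y: "X < y" "y < X + 1" "(R (X + 1 + 1) - R (X + 1)) - (R (X + 1) - R X) = R' (y + 1) - R' y"
    using MVT2[of X "X + 1" "\<lambda>x. R (x + 1) - R x" "\<lambda>x. R' (x + 1) - R' x"] by auto
  obtain z where z: "y < z" "z < y + 1" "R' (y + 1) - R' y = R'' z"
    using MVT2[of y "y + 1" R' R''] dR' y by auto
  obtain w where w: "z < w" "h (z + 1) - h z = h' w" using h_diff[of z] z y by auto
  obtain v where v: "z < v" "h' (z + 1) - h' z = h'' v" using h'_diff[of z] z y by auto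
  have "\<bar>R'' z\<bar> = R z * \<bar>(h' w)\<^sup>2 + h'' v\<bar>"
    using R1[of z] z y by (simp add: R''_def w v abs_mult)
  also have "\<dots> \<le> 1.03 * ((0.4535 * U ^ 3)\<^sup>2 + 1.18 * U ^ 5)"
  proof (intro mult_mono)
    have "(h' w)\<^sup>2 \<le> (0.4535 * U ^ 3)\<^sup>2"
    proof -
      have "0 \<le> - h' w"
      proof -
        have "0 \<le> (1 / sqrt w) ^ 3 * (b / 2 - 0.94 * (1 / sqrt w))"
          using uU[of w] U b w z y by (intro mult_nonneg_nonneg) auto
        then show ?thesis using H(5)[of w] w z y X by simp
      qed
      then have "(- h' w)\<^sup>2 \<le> (0.4535 * U ^ 3)\<^sup>2"
        using h'hi[of w] w z y by (intro power_mono) auto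
      then show ?thesis by simp
    qed
    then show "\<bar>(h' w)\<^sup>2 + h'' v\<bar> \<le> (0.4535 * U ^ 3)\<^sup>2 + 1.18 * U ^ 5"
      using h''hi[of v] v z y zero_le_power2[of "h' w"] by linarith
  qed (use R1[of z] R2[of z] z y in auto)
  also have "\<dots> = 1.03 * (0.20566225 * U + 1.18) * U ^ 5"
    by (simp add: power2_eq_square eval_nat_numeral algebra_simps)
  also have "\<dots> \<le> 1.4 * U ^ 5" using U by (intro mult_right_mono) auto
  finally have "\<bar>R'' z\<bar> \<le> 1.4 * U ^ 5" .
  moreover have "X + 1 + 1 = X + 2" by simp
  then have "R X - 2 * R (X + 1) + R (X + 2) = R'' z" using y(3) z(3) by (simp only:)
  ultimately show "\<bar>R X - 2 * R (X + 1) + R (X + 2)\<bar> \<le> 1.4 * U ^ 5" by simp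
qed

section \<open>Contour integrals for the Bessel-type series\<close>

lemma higher_deriv_exp_mult:
  fixes x :: complex
  shows "(deriv ^^ k) (\<lambda>u. exp (x * u)) = (\<lambda>u. x ^ k * exp (x * u))"
proof (induction k)
  case (Suc k)
  have "deriv (\<lambda>u. x ^ k * exp (x * u)) = (\<lambda>u. x ^ Suc k * exp (x * u))"
    by (rule ext, rule DERIV_imp_deriv) (auto intro!: derivative_eq_intros)
  then show ?case by (simp add: Suc)
qed simp

lemma contour_integral_circlepath_exp_div_power:
  fixes x :: complex
  shows "((\<lambda>s. exp (x * s) / s ^ Suc k) has_contour_integral (of_real (2 * pi) * \<i> * (x ^ k / fact k))) (circlepath 0 1)"
proof -
  have "((\<lambda>u. exp (x * u) / (u - 0) ^ Suc k) has_contour_integral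
      (of_real (2 * pi) * \<i>) / fact k * (deriv ^^ k) (\<lambda>u. exp (x * u)) 0) (circlepath 0 1)"
    by (rule Cauchy_has_contour_integral_higher_derivative_circlepath)
      (auto intro!: continuous_intros holomorphic_intros)
  then show ?thesis by (simp add: higher_deriv_exp_mult)
qed

text \<open>Expand \<open>exp (a / s)\<close> and integrate term by term over the unit circle. The
  constant term integrates to 0, which is why the powers of \<open>a\<close> in
  \<open>bes_coeff\<close> are shifted by one against those of \<open>x\<close>.\<close>

lemma residue_exp_bes:
  fixes a x :: real
  assumes "a > 0"
  shows "residue (\<lambda>s. exp (of_real a / s + of_real x * s)) 0 = of_real (bes a x)"
proof -
  define f where "f s = exp (of_real a / s + of_real x * s)" for s :: complex
  define t where "t k s = (of_real a / s) ^ k / fact k * exp (of_real x * s)" for k and s :: complex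
  have int: "(f has_contour_integral of_real (2 * pi) * \<i> * residue f 0) (circlepath 0 1)"
    by (rule base_residue[of UNIV]) (auto simp: f_def[abs_def] intro!: holomorphic_intros)
  have tsum: "(\<lambda>k. t k s) sums f s" for s
  proof -
    have "(\<lambda>k. (of_real a / s) ^ k /\<^sub>R fact k) sums exp (of_real a / s)" by (rule exp_converges)
    from sums_mult2[OF this, of "exp (of_real x * s)"]
    show ?thesis by (simp add: t_def f_def exp_add scaleR_conv_of_real divide_inverse mult_ac)
  qed
  have "uniform_limit (sphere 0 1) (\<lambda>n s. \<Sum>k<n. t k s) (\<lambda>s. suminf (\<lambda>k. t k s)) sequentially"
  proof (rule Weierstrass_m_test)
    show "summable (\<lambda>k. a ^ k /\<^sub>R fact k * exp \<bar>x\<bar>)"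
      by (intro summable_mult2 summable_exp_generic)
    fix k s assume "s \<in> sphere (0 :: complex) 1"
    then have s: "norm s = 1" by simp
    have "norm (exp (of_real x * s)) \<le> exp (norm (of_real x * s))" by (rule norm_exp)
    then have "norm (exp (of_real x * s)) \<le> exp \<bar>x\<bar>" using s by (simp add: norm_mult)
    then have "a ^ k / fact k * norm (exp (of_real x * s)) \<le> a ^ k / fact k * exp \<bar>x\<bar>"
      using assms by (intro mult_left_mono) auto
    moreover have "norm (t k s) = a ^ k / fact k * norm (exp (of_real x * s))"
      using assms s by (simp add: t_def norm_mult norm_divide norm_power)
    ultimately show "norm (t k s) \<le> a ^ k /\<^sub>R fact k * exp \<bar>x\<bar>"
      by (simp add: divide_inverse mult_ac)
  qed
  then have lim: "uniform_limit (sphere 0 1) (\<lambda>n s. \<Sum>k<n. t k s) f sequentially"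
    using tsum by (simp add: sums_iff)
  have tint: "(t k has_contour_integral (case k of 0 \<Rightarrow> 0 | Suc j \<Rightarrow>
      of_real (2 * pi * (bes_coeff a j * x ^ j)) * \<i>)) (circlepath 0 1)" for k
  proof (cases k)
    case 0
    have "t 0 = (\<lambda>s. exp (of_real x * s))" by (simp add: t_def fun_eq_iff)
    moreover have "((\<lambda>s. exp (of_real x * s)) has_contour_integral 0) (circlepath 0 1)"
      by (rule Cauchy_theorem_disc_simple[of _ 0 2])
        (auto intro!: holomorphic_intros)
    ultimately show ?thesis by (simp add: 0)
  next
    case (Suc j)
    have "t k = (\<lambda>s. of_real a ^ k / fact k * (exp (of_real x * s) / s ^ Suc j))"
      by (simp add: t_def fun_eq_iff Suc power_divide)
    then show ?thesis
      using has_contour_integral_lmul[OF contour_integral_circlepath_exp_div_power[of "of_real x" j], of "of_real a ^ k / fact k"]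
      by (simp add: Suc bes_coeff_def mult_ac)
  qed
  have lim2: "(\<lambda>n. contour_integral (circlepath 0 1) (\<lambda>s. \<Sum>k<n. t k s)) \<longlonglongrightarrow> contour_integral (circlepath 0 1) f"
    by (rule contour_integral_uniform_limit_circlepath[OF _ lim])
      (intro always_eventually allI contour_integrable_sum has_contour_integral_integrable[OF tint], auto)
  have "contour_integral (circlepath 0 1) (\<lambda>s. \<Sum>k<n. t k s) =
      (\<Sum>k<n. case k of 0 \<Rightarrow> 0 | Suc j \<Rightarrow> of_real (2 * pi * (bes_coeff a j * x ^ j)) * \<i>)" for n
    by (rule contour_integral_unique, intro has_contour_integral_sum) (auto intro: tint)
  with lim2 have "(\<lambda>k. case k of 0 \<Rightarrow> 0 | Suc j \<Rightarrow> of_real (2 * pi * (bes_coeff a j * x ^ j)) * \<i>)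
      sums contour_integral (circlepath 0 1) f"
    by (simp add: sums_def)
  moreover have "(\<lambda>j. complex_of_real (2 * pi * (bes_coeff a j * x ^ j)) * \<i>) sums (of_real (2 * pi * bes a x) * \<i>)"
    unfolding bes_def by (intro sums_mult2 sums_of_real sums_mult summable_sums summable_bes)
  then have "(\<lambda>k. case k of 0 \<Rightarrow> 0 | Suc j \<Rightarrow> complex_of_real (2 * pi * (bes_coeff a j * x ^ j)) * \<i>)
      sums (of_real (2 * pi * bes a x) * \<i>)"
    using sums_Suc[of "\<lambda>k. case k of 0 \<Rightarrow> 0 | Suc j \<Rightarrow> complex_of_real (2 * pi * (bes_coeff a j * x ^ j)) * \<i>"] by simp
  ultimately have "contour_integral (circlepath 0 1) f = of_real (2 * pi * bes a x) * \<i>"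
    by (rule sums_unique2)
  then have "of_real (2 * pi) * \<i> * residue f 0 = of_real (2 * pi * bes a x) * \<i>"
    using contour_integral_unique[OF int] by simp
  then show ?thesis unfolding f_def by simp
qed

text \<open>The segment is closed to a rectangle around 0 whose left side lies on
  \<open>Re s = - t\<close>. On that side both parts of the exponent have real part at most 0, and
  on the horizontal sides \<open>norm s \<ge> y\<close> keeps \<open>a / s\<close> small.\<close>

lemma vertical_segment_integral_bes:
  fixes a x t y :: real
  assumes pos: "a > 0" "x > 0" "t > 0" "y > 0"
  shows "norm (contour_integral (linepath (Complex t (- y)) (Complex t y)) (\<lambda>s. exp (of_real a / s + of_real x * s))
      - of_real (2 * pi) * \<i> * of_real (bes a x)) \<le> 4 * t * exp (x * t + a * t / y\<^sup>2) + 2 * y"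
proof -
  define f where "f s = exp (of_real a / s + of_real x * s)" for s :: complex
  define a1 a2 a3 a4 where "a1 = Complex (-t) (-y)" and "a2 = Complex t (-y)" and "a3 = Complex t y" and "a4 = Complex (-t) y"
  have z: "0 \<in> box a1 a3" using pos by (simp add: in_box_complex_iff a1_def a3_def)
  have rect: "rectpath a1 a3 = linepath a1 a2 +++ linepath a2 a3 +++ linepath a3 a4 +++ linepath a4 a1"
    by (simp add: rectpath_def Let_def a1_def a2_def a3_def a4_def)
  have "contour_integral (rectpath a1 a3) f = of_real (2 * pi) * \<i> * (\<Sum>p\<in>{0}. winding_number (rectpath a1 a3) p * residue f p)"
  proof (rule Residue_theorem[of UNIV])
    show "f holomorphic_on UNIV - {0}" by (auto simp: f_def[abs_def] intro!: holomorphic_intros)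
    show "path_image (rectpath a1 a3) \<subseteq> UNIV - {0}"
      using z by (subst path_image_rectpath_cbox_minus_box) (auto simp: a1_def a3_def pos less_imp_le)
  qed auto
  then have I: "contour_integral (rectpath a1 a3) f = of_real (2 * pi) * \<i> * of_real (bes a x)"
    using winding_number_rectpath[OF z] residue_exp_bes[OF pos(1), of x] by (simp add: f_def[abs_def])
  have intg: "f contour_integrable_on linepath p r" if "0 \<notin> closed_segment p r" for p r
    by (rule contour_integrable_continuous_linepath)
      (use that in \<open>auto simp: f_def[abs_def] intro!: continuous_intros\<close>)
  have seg: "closed_segment a1 a2 = {z. Im z = - y \<and> Re z \<in> {-t..t}}"
    "closed_segment a3 a4 = {z. Im z = y \<and> Re z \<in> {-t..t}}"
    "closed_segment a4 a1 = {z. Re z = - t \<and> Im z \<in> {-y..y}}"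
    "closed_segment a2 a3 = {z. Re z = t \<and> Im z \<in> {-y..y}}"
    using pos by (auto simp: closed_segment_same_Im closed_segment_same_Re a1_def a2_def a3_def a4_def closed_segment_eq_real_ivl)
  have i: "f contour_integrable_on linepath a1 a2" "f contour_integrable_on linepath a2 a3"
    "f contour_integrable_on linepath a3 a4" "f contour_integrable_on linepath a4 a1"
    using pos by (auto intro!: intg simp: seg)
  have "contour_integral (rectpath a1 a3) f = contour_integral (linepath a1 a2) f + (contour_integral (linepath a2 a3) f
     + (contour_integral (linepath a3 a4) f + contour_integral (linepath a4 a1) f))"
    unfolding rect using i by (simp add: contour_integrable_join)
  then have e: "contour_integral (linepath a2 a3) f - of_real (2 * pi) * \<i> * of_real (bes a x)
    = - (contour_integral (linepath a1 a2) f + contour_integral (linepath a3 a4) f + contour_integral (linepath a4 a1) f)"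
    using I by (simp add: algebra_simps)
  have fn: "norm (f s) = exp (a * (Re s / (norm s)\<^sup>2) + x * Re s)" for s
    unfolding f_def norm_exp_eq_Re by (simp add: Re_divide cmod_power2)
  define B where "B = exp (x * t + a * t / y\<^sup>2)"
  have hor: "norm (f s) \<le> B" if s: "\<bar>Im s\<bar> = y" "Re s \<in> {-t..t}" for s
  proof -
    have "y\<^sup>2 \<le> (norm s)\<^sup>2" using abs_Im_le_cmod[of s] s pos by (intro power_mono) auto
    then have "Re s / (norm s)\<^sup>2 \<le> t / y\<^sup>2"
    proof (cases "Re s \<ge> 0")
      case True
      then show ?thesis using s pos \<open>y\<^sup>2 \<le> (norm s)\<^sup>2\<close> by (intro frac_le) auto
    next
      case False
      then have "Re s / (norm s)\<^sup>2 \<le> 0" by (simp add: divide_nonpos_nonneg)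
      also have "0 \<le> t / y\<^sup>2" using pos by simp
      finally show ?thesis .
    qed
    then have "a * (Re s / (norm s)\<^sup>2) + x * Re s \<le> a * (t / y\<^sup>2) + x * t"
      using pos s by (intro add_mono mult_left_mono) auto
    then show ?thesis unfolding fn B_def by simp
  qed
  have b1: "norm (contour_integral (linepath a1 a2) f) \<le> B * norm (a2 - a1)"
    by (rule contour_integral_bound_linepath[OF i(1)]) (use pos in \<open>auto simp: seg B_def[symmetric] intro!: hor\<close>, simp add: B_def)
  have b3: "norm (contour_integral (linepath a3 a4) f) \<le> B * norm (a4 - a3)"
    by (rule contour_integral_bound_linepath[OF i(3)]) (use pos in \<open>auto simp: seg B_def[symmetric] intro!: hor\<close>, simp add: B_def)
  have b4: "norm (contour_integral (linepath a4 a1) f) \<le> 1 * norm (a1 - a4)"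
  proof (rule contour_integral_bound_linepath[OF i(4)])
    fix s assume "s \<in> closed_segment a4 a1"
    then have "Re s = - t" by (simp add: seg)
    moreover have "a * (- t / (norm s)\<^sup>2) \<le> 0" using pos by (simp add: mult_nonneg_nonneg)
    moreover have "0 \<le> x * t" using pos by simp
    ultimately show "norm (f s) \<le> 1" unfolding fn by simp
  qed simp
  have n: "norm (a2 - a1) = 2 * t" "norm (a4 - a3) = 2 * t" "norm (a1 - a4) = 2 * y"
  proof -
    have "a2 - a1 = of_real (2 * t)" "a4 - a3 = of_real (- 2 * t)" "a1 - a4 = \<i> * of_real (- 2 * y)"
      by (simp_all add: a1_def a2_def a3_def a4_def complex_eq_iff)
    then show "norm (a2 - a1) = 2 * t" "norm (a4 - a3) = 2 * t" "norm (a1 - a4) = 2 * y"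
      using pos by (simp_all add: norm_mult)
  qed
  have tri: "norm (- (p + r + s)) \<le> norm p + norm r + norm s" for p r s :: complex
    using norm_triangle_ineq[of "p + r" s] norm_triangle_ineq[of p r] by (simp only: norm_minus_cancel)
  have "norm (contour_integral (linepath a2 a3) f - of_real (2 * pi) * \<i> * of_real (bes a x))
    \<le> norm (contour_integral (linepath a1 a2) f) + norm (contour_integral (linepath a3 a4) f) + norm (contour_integral (linepath a4 a1) f)"
    unfolding e by (rule tri)
  also have "\<dots> \<le> B * (2 * t) + B * (2 * t) + 1 * (2 * y)"
    using b1 b3 b4 unfolding n by linarith
  also have "\<dots> = 4 * t * B + 2 * y" by simp
  finally show ?thesis by (simp add: a2_def a3_def B_def f_def[abs_def])
qed

section \<open>The circle method\<close>

lemma has_contour_integral_exp_vertical: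
  fixes k :: int and t :: real
  shows "((\<lambda>s. exp (of_int k * s)) has_contour_integral (if k = 0 then of_real (2 * pi) * \<i> else 0))
    (linepath (Complex t (- pi)) (Complex t pi))"
proof (cases "k = 0")
  case True
  have "Complex t pi - Complex t (- pi) = of_real (2 * pi) * \<i>" by (simp add: complex_eq_iff)
  then show ?thesis using True has_contour_integral_const_linepath[of 1 "Complex t pi" "Complex t (- pi)"] by simp
next
  case False
  have "((\<lambda>s. exp (of_int k * s)) has_contour_integral
      exp (of_int k * Complex t pi) / of_int k - exp (of_int k * Complex t (- pi)) / of_int k)
    (linepath (Complex t (- pi)) (Complex t pi))"
  proof -
    have "((\<lambda>s. exp (of_int k * s) / of_int k) has_field_derivative exp (of_int k * x)) (at x)" for x :: complex
      using False by (auto intro!: derivative_eq_intros)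
    from contour_integral_primitive[of UNIV, OF this valid_path_linepath] show ?thesis by simp
  qed
  moreover have "exp (of_int k * Complex t pi) = exp (of_int k * Complex t (- pi))"
    unfolding exp_eq by (rule exI[of _ k]) (simp add: complex_eq_iff algebra_simps)
  ultimately show ?thesis using False by simp
qed

lemma prod_one_plus_exp_eq_sum:
  fixes s :: complex
  shows "(\<Prod>j\<in>{1..N}. 1 + exp (- (of_nat j * s))) = (\<Sum>S\<in>Pow {1..N}. exp (- (of_nat (\<Sum>S) * s)))"
proof -
  have "(\<Prod>j\<in>{1..N}. exp (- (of_nat j * s)) + 1) =
      (\<Sum>S\<in>Pow {1..N}. (\<Prod>j\<in>S. exp (- (of_nat j * s))) * (\<Prod>j\<in>{1..N} - S. 1))"
    by (rule prod_add) simp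
  also have "\<dots> = (\<Sum>S\<in>Pow {1..N}. exp (- (of_nat (\<Sum>S) * s)))"
  proof (rule sum.cong[OF refl])
    fix S assume "S \<in> Pow {1..N}"
    then have "finite S" by (auto intro: finite_subset)
    then show "(\<Prod>j\<in>S. exp (- (of_nat j * s))) * (\<Prod>j\<in>{1..N} - S. 1) = exp (- (of_nat (\<Sum>S) * s))"
      by (simp add: exp_sum[symmetric] sum_negf sum_distrib_right)
  qed
  finally show ?thesis by (simp only: add.commute)
qed

text \<open>For a finite product only finitely many exponentials are integrated, and the
  orthogonality relation selects the sets of sum \<open>n\<close>. Factors beyond \<open>n\<close>
  do not change this count, so every \<open>N \<ge> n\<close> gives the same value and the limit can
  be taken afterwards.\<close>

lemma has_contour_integral_prod_one_plus_exp:
  assumes "n \<le> N"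
  shows "((\<lambda>s. (\<Prod>j\<in>{1..N}. 1 + exp (- (of_nat j * s))) * exp (of_nat n * s)) has_contour_integral
     of_nat (q n) * (of_real (2 * pi) * \<i>)) (linepath (Complex t (- pi)) (Complex t pi))"
proof -
  let ?c = "of_real (2 * pi) * \<i>"
  have "((\<lambda>s. \<Sum>S\<in>Pow {1..N}. exp (of_int (int n - int (\<Sum>S)) * s)) has_contour_integral
     (\<Sum>S\<in>Pow {1..N}. if int n - int (\<Sum>S) = 0 then ?c else 0)) (linepath (Complex t (- pi)) (Complex t pi))"
    by (intro has_contour_integral_sum has_contour_integral_exp_vertical) auto
  moreover have "(\<Sum>S\<in>Pow {1..N}. exp (of_int (int n - int (\<Sum>S)) * s)) =
      (\<Prod>j\<in>{1..N}. 1 + exp (- (of_nat j * s))) * exp (of_nat n * s)" for s :: complex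
    unfolding prod_one_plus_exp_eq_sum sum_distrib_right exp_add[symmetric]
    by (simp add: algebra_simps)
  moreover have "(\<Sum>S\<in>Pow {1..N}. if int n - int (\<Sum>S) = 0 then ?c else 0) = of_nat (q n) * ?c"
  proof -
    have "int n - int m = 0 \<longleftrightarrow> m = n" for m by auto
    note iff = this
    have "{S \<in> Pow {1..N}. int n - int (\<Sum>S) = 0} = distinct_partitions n" unfolding iff
    proof (intro equalityI subsetI)
      fix S assume S: "S \<in> distinct_partitions n"
      have "x \<le> N" if "x \<in> S" for x
        using member_le_sum[OF that, of "\<lambda>x. x"] S assms by (auto simp: distinct_partitions_def)
      moreover have "1 \<le> x" if "x \<in> S" for x
        using S that by (cases x) (auto simp: distinct_partitions_def)
      ultimately show "S \<in> {S \<in> Pow {1..N}. \<Sum>S = n}"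
        using S by (auto simp: distinct_partitions_def)
    qed (auto simp: distinct_partitions_def intro: finite_subset)
    moreover have "(\<Sum>S\<in>Pow {1..N}. if int n - int (\<Sum>S) = 0 then ?c else 0) =
        (\<Sum>S\<in>{S \<in> Pow {1..N}. int n - int (\<Sum>S) = 0}. ?c)"
      by (rule sum.inter_filter[symmetric]) simp
    ultimately show ?thesis by (simp only: sum_constant q_def)
  qed
  ultimately show ?thesis by (simp only:)
qed

text \<open>Expanding the logarithms gives a double series in \<open>z^((j+1)(k+1))\<close>; summing
  over \<open>j\<close> first yields geometric series, hence the alternating form of
  \<open>csch_sum\<close>. The exponent is at least \<open>j + k\<close>, which supplies a product
  majorant.\<close>

lemma prod_one_plus_exp_tendsto:
  assumes "Re s > 0"
  shows "(\<lambda>N. \<Prod>j\<in>{1..N}. 1 + exp (- (of_nat j * s))) \<longlonglongrightarrow> exp (csch_sum s)"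
proof -
  define z where "z = exp (- s)"
  define r where "r = norm z"
  have r: "0 < r" "r < 1" using assms by (simp_all add: r_def z_def norm_exp_eq_Re)
  define b where "b j k = (-1) ^ k * z ^ (Suc j * Suc k) / of_nat (Suc k)" for j k :: nat
  define A where "A k = 1 / (exp (of_nat k * s) - 1) / of_nat k" for k :: nat
  have zp: "norm (z ^ Suc j) < 1" for j
    unfolding norm_power r_def[symmetric] using r by (intro power_Suc_less_one) auto
  have X: "b j sums ln (1 + z ^ Suc j)" for j
  proof -
    have "(\<lambda>n. (-1) ^ Suc (Suc n) / of_nat (Suc n) * (z ^ Suc j) ^ Suc n) sums ln (1 + z ^ Suc j)"
      using sums_Suc_imp[of "\<lambda>n. (-1) ^ Suc n / of_nat n * (z ^ Suc j) ^ n" "ln (1 + z ^ Suc j)"]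
        sums_split_initial_segment[OF Ln_series[OF zp[of j]], of 1] by simp
    moreover have "(-1) ^ Suc (Suc k) / of_nat (Suc k) * (z ^ Suc j) ^ Suc k = b j k" for k
      unfolding b_def power_mult by simp
    ultimately show ?thesis by (simp only:)
  qed
  have Y: "(\<lambda>j. b j k) sums ((-1) ^ k * A (Suc k))" for k
  proof -
    have "(\<lambda>j. (z ^ Suc k) ^ j) sums (1 / (1 - z ^ Suc k))" by (rule geometric_sums[OF zp])
    from sums_mult[OF this, of "(-1) ^ k / of_nat (Suc k) * z ^ Suc k"]
    have "(\<lambda>j. (-1) ^ k / of_nat (Suc k) * z ^ Suc k * (z ^ Suc k) ^ j) sums
      ((-1) ^ k / of_nat (Suc k) * z ^ Suc k * (1 / (1 - z ^ Suc k)))" .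
    moreover have "(-1) ^ k / of_nat (Suc k) * z ^ Suc k * (z ^ Suc k) ^ j = b j k" for j
    proof -
      have "z ^ Suc k * (z ^ Suc k) ^ j = z ^ (Suc j * Suc k)"
        by (metis mult.commute power_Suc power_mult)
      then show ?thesis by (simp only: b_def mult.assoc times_divide_eq_left)
    qed
    moreover have "(-1) ^ k / of_nat (Suc k) * z ^ Suc k * (1 / (1 - z ^ Suc k)) = (-1) ^ k * A (Suc k)"
    proof -
      have "z ^ Suc k = inverse (exp (of_nat (Suc k) * s))"
        by (simp only: z_def exp_minus[symmetric] exp_of_nat_mult[symmetric] mult_minus_right)
      moreover have "inverse e * (1 / (1 - inverse e)) = 1 / (e - 1)" if "e \<noteq> 0" for e :: complex
      proof -
        have "e * (1 - inverse e) = e - 1" using that by (simp add: right_diff_distrib)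
        moreover have "inverse e * (1 / (1 - inverse e)) = 1 / (e * (1 - inverse e))"
          by (simp add: divide_inverse)
        ultimately show ?thesis by simp
      qed
      ultimately have "z ^ Suc k * (1 / (1 - z ^ Suc k)) = 1 / (exp (of_nat (Suc k) * s) - 1)"
        by (simp only: exp_not_eq_zero not_False_eq_True)
      moreover have "c / m * (1 / e) = c * (1 / e / m)" for c m e :: complex by simp
      ultimately show ?thesis unfolding A_def mult.assoc by (simp only:)
    qed
    ultimately show ?thesis by (simp only:)
  qed
  have bd: "norm (b j k) \<le> r ^ j * r ^ k" for j k
  proof -
    have "norm (b j k) = r ^ (Suc j * Suc k) / real (Suc k)"
      by (simp only: b_def norm_divide norm_mult norm_power r_def[symmetric] norm_of_nat norm_minus_cancel norm_one power_one mult_1)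
    also have "\<dots> \<le> r ^ (Suc j * Suc k) / 1" using r by (intro divide_left_mono) auto
    also have "\<dots> \<le> r ^ (j + k)" using r by (simp only: div_by_1) (intro power_decreasing; simp)
    finally show ?thesis by (simp add: power_add)
  qed
  have rs: "summable (\<lambda>j. r ^ j)" using r by (intro summable_geometric) auto
  obtain S where S: "(\<lambda>j. ln (1 + z ^ Suc j)) sums S" "(\<lambda>k. (-1) ^ k * A (Suc k)) sums S"
    by (rule double_sums_swap[OF bd rs rs _ _ X Y]) (use r in auto)
  from sums_pairs[OF S(2)] have "(\<lambda>j. A (2 * j + 1) - A (2 * j + 2)) sums S" by simp
  moreover have "(\<lambda>j. A (2 * j + 1) - A (2 * j + 2)) sums csch_sum s"
    unfolding A_def by (rule csch_sum_alternating(2)[OF assms])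
  ultimately have "S = csch_sum s" by (rule sums_unique2)
  with S(1) have "(\<lambda>N. \<Sum>j<N. ln (1 + z ^ Suc j)) \<longlonglongrightarrow> csch_sum s" by (simp add: sums_def)
  then have "(\<lambda>N. exp (\<Sum>j<N. ln (1 + z ^ Suc j))) \<longlonglongrightarrow> exp (csch_sum s)"
    by (rule tendsto_exp)
  moreover have "exp (\<Sum>j<N. ln (1 + z ^ Suc j)) = (\<Prod>j\<in>{1..N}. 1 + exp (- (of_nat j * s)))" for N
  proof -
    have "exp (ln (1 + z ^ Suc j)) = 1 + exp (- (of_nat (Suc j) * s))" for j
    proof -
      have "1 + z ^ Suc j \<noteq> 0"
      proof
        assume "1 + z ^ Suc j = 0"
        then have "z ^ Suc j = - 1" by (simp add: eq_neg_iff_add_eq_0 add.commute)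
        then show False using zp[of j] by (simp only: norm_minus_cancel norm_one)
      qed
      moreover have "z ^ Suc j = exp (- (of_nat (Suc j) * s))"
        by (simp only: z_def exp_of_nat_mult[symmetric] mult_minus_right)
      ultimately show ?thesis by (simp only: exp_Ln not_False_eq_True)
    qed
    then have "exp (\<Sum>j<N. ln (1 + z ^ Suc j)) = (\<Prod>j<N. 1 + exp (- (of_nat (Suc j) * s)))"
      by (simp only: exp_sum finite_lessThan)
    also have "\<dots> = (\<Prod>j\<in>{1..N}. 1 + exp (- (of_nat j * s)))"
      by (simp add: prod.atLeast1_atMost_eq del: of_nat_Suc)
    finally show ?thesis .
  qed
  ultimately show ?thesis by (simp only:)
qed

text \<open>A bound uniform in \<open>N\<close> and in \<open>Im s\<close>: it is the dominating
  constant for passing to the limit under the integral.\<close>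

lemma norm_prod_one_plus_exp_le:
  assumes "Re s = t" "t > 0"
  shows "norm (\<Prod>j\<in>{1..N}. 1 + exp (- (of_nat j * s))) \<le> exp (1 / (1 - exp (- t)))"
proof -
  define r where "r = exp (- t)"
  have r: "0 < r" "r < 1" using assms by (simp_all add: r_def)
  have "norm (\<Prod>j\<in>{1..N}. 1 + exp (- (of_nat j * s))) = (\<Prod>j\<in>{1..N}. norm (1 + exp (- (of_nat j * s))))"
    by (simp add: prod_norm)
  also have "\<dots> \<le> (\<Prod>j\<in>{1..N}. exp (r ^ j))"
  proof (intro prod_mono conjI)
    fix j :: nat
    have "norm (1 + exp (- (of_nat j * s))) \<le> 1 + norm (exp (- (of_nat j * s)))"
      using norm_triangle_ineq[of 1 "exp (- (of_nat j * s))"] by simp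
    also have "norm (exp (- (of_nat j * s))) = r ^ j"
      using assms(1) by (simp add: norm_exp_eq_Re r_def exp_of_nat_mult[symmetric])
    also have "1 + r ^ j \<le> exp (r ^ j)" by (rule exp_ge_add_one_self)
    finally show "norm (1 + exp (- (of_nat j * s))) \<le> exp (r ^ j)" .
  qed auto
  also have "\<dots> = exp (\<Sum>j\<in>{1..N}. r ^ j)" by (simp add: exp_sum)
  also have "(\<Sum>j\<in>{1..N}. r ^ j) \<le> (\<Sum>j. r ^ j)"
    using r by (intro sum_le_suminf summable_geometric) auto
  also have "(\<Sum>j. r ^ j) = 1 / (1 - r)" using r by (intro suminf_geometric) auto
  finally show ?thesis by (simp add: r_def)
qed

theorem contour_integral_exp_csch_sum:
  assumes t: "t > 0"
  shows "contour_integral (linepath (Complex t (- pi)) (Complex t pi)) (\<lambda>s. exp (csch_sum s + of_nat n * s))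
    = of_nat (q n) * (of_real (2 * pi) * \<i>)"
proof -
  let ?a = "Complex t (- pi)" and ?b = "Complex t pi"
  define f where "f N s = (\<Prod>j\<in>{1..N}. 1 + exp (- (of_nat j * s))) * exp (of_nat n * s)" for N and s :: complex
  have Re: "Re (linepath ?a ?b x) = t" for x by (simp add: linepath_def algebra_simps)
  \<comment> \<open>The index is shifted by \<open>n\<close> so that each of the truncated products
    is long enough to count all partitions of \<open>n\<close>.\<close>
  have int: "((\<lambda>x. f (N + n) (linepath ?a ?b x) * (?b - ?a)) has_integral of_nat (q n) * (of_real (2 * pi) * \<i>)) {0..1}" for N
    using has_contour_integral_prod_one_plus_exp[of n "N + n" t]
    unfolding has_contour_integral_linepath f_def by simp
  define F where "F N x = f (N + n) (linepath ?a ?b x) * (?b - ?a)" for N x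
  define H where "H x = exp (csch_sum (linepath ?a ?b x) + of_nat n * linepath ?a ?b x) * (?b - ?a)" for x
  have 1: "F N integrable_on {0..1}" for N
    using int unfolding F_def by (rule has_integral_integrable)
  have 2: "(\<lambda>x. exp (1 / (1 - exp (- t))) * exp (real n * t) * norm (?b - ?a)) integrable_on {0..1::real}"
    by (intro integrable_const_ivl)
  have 3: "norm (F N x) \<le> exp (1 / (1 - exp (- t))) * exp (real n * t) * norm (?b - ?a)" for N x
    unfolding F_def norm_mult f_def using Re[of x] t
    by (intro mult_right_mono mult_mono norm_prod_one_plus_exp_le) (auto simp: norm_exp_eq_Re)
  have 4: "(\<lambda>N. F N x) \<longlonglongrightarrow> H x" for x
    unfolding F_def H_def f_def exp_add
    by (rule tendsto_mult[OF tendsto_mult[OF LIMSEQ_ignore_initial_segment[OF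
        prod_one_plus_exp_tendsto] tendsto_const] tendsto_const]) (simp add: Re t)
  have intg: "H integrable_on {0..1}" and lim: "(\<lambda>N. integral {0..1} (F N)) \<longlonglongrightarrow> integral {0..1} H"
    using dominated_convergence[OF 1 2 3 4] by blast+
  have "integral {0..1} (F N) = of_nat (q n) * (of_real (2 * pi) * \<i>)" for N
    unfolding F_def by (rule integral_unique[OF int])
  with lim have "integral {0..1} H = of_nat (q n) * (of_real (2 * pi) * \<i>)"
    by (simp add: LIMSEQ_const_iff)
  with intg have "(H has_integral of_nat (q n) * (of_real (2 * pi) * \<i>)) {0..1}"
    by (metis has_integral_integral)
  then show ?thesis unfolding H_def
    by (intro contour_integral_unique) (simp only: has_contour_integral_linepath)
qed

lemma continuous_on_csch_sum:
  assumes "t > 0"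
  shows "continuous_on {s. Re s = t} csch_sum"
proof -
  define a where "a k s = 1 / (2 * of_nat (Suc k) * sinh (of_nat (Suc k) * s))" for k and s :: complex
  have ul: "uniform_limit {s. Re s = t} (\<lambda>n s. \<Sum>k<n. a k s) (\<lambda>s. \<Sum>k. a k s) sequentially"
  proof (rule Weierstrass_m_test)
    show "norm (a k s) \<le> 1 / (2 * sinh t) * (1 / (of_nat (Suc k))\<^sup>2)" if "s \<in> {s. Re s = t}" for k s
      using norm_csch_term[of s k] that assms unfolding a_def by simp
    show "summable (\<lambda>k. 1 / (2 * sinh t) * (1 / (real (Suc k))\<^sup>2))"
      using inverse_squares_sums by (intro summable_mult) (simp only: Suc_eq_plus1 of_nat_power sums_iff)
  qed
  have c: "continuous_on {s. Re s = t} (\<lambda>s. \<Sum>k<n. a k s)" for n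
  proof (intro continuous_on_sum)
    fix k
    have "sinh (of_nat (Suc k) * s) \<noteq> 0" if "Re s = t" for s
      by (rule inverse_sinh_eq(1)) (use that assms in simp)
    then show "continuous_on {s. Re s = t} (a k)"
      unfolding a_def by (intro continuous_intros) (auto simp del: of_nat_Suc)
  qed
  have "continuous_on {s. Re s = t} (\<lambda>s. \<Sum>k. a k s)"
    by (rule uniform_limit_theorem[OF _ ul]) (use c in simp_all)
  then show ?thesis unfolding a_def csch_sum_def[abs_def] .
qed

section \<open>Loss of size away from the real axis\<close>

lemma sinh_Complex: "sinh (Complex t \<theta>) = Complex (sinh t * cos \<theta>) (cosh t * sin \<theta>)"
  by (simp add: complex_eq_iff sinh_field_def cosh_field_def Re_exp Im_exp algebra_simps diff_divide_distrib add_divide_distrib)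

lemma Re_inverse_sinh_Complex:
  "Re (1 / sinh (Complex t \<theta>)) = sinh t * cos \<theta> / ((sinh t)\<^sup>2 + (sin \<theta>)\<^sup>2)"
proof -
  have "(sinh t * cos \<theta>)\<^sup>2 + (cosh t * sin \<theta>)\<^sup>2 = (sinh t)\<^sup>2 * ((cos \<theta>)\<^sup>2 + (sin \<theta>)\<^sup>2) + (sin \<theta>)\<^sup>2"
    by (simp add: power_mult_distrib cosh_square_eq algebra_simps del: sin_cos_squared_add2 sin_cos_squared_add)
  then have "(sinh t * cos \<theta>)\<^sup>2 + (cosh t * sin \<theta>)\<^sup>2 = (sinh t)\<^sup>2 + (sin \<theta>)\<^sup>2" by simp
  then show ?thesis by (simp add: sinh_Complex Re_divide)
qed

text \<open>Every term of the series has its largest real part at \<open>\<theta> = 0\<close>,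
  because \<open>norm (sinh z) \<ge> sinh (Re z)\<close>. So each term of the difference is
  nonnegative, and keeping the first two gives a lower bound.\<close>

lemma Re_csch_sum_diff:
  assumes t: "t > 0"
  shows "1 / 2 * (1 / sinh t - sinh t * cos \<theta> / ((sinh t)\<^sup>2 + (sin \<theta>)\<^sup>2)) +
      1 / 4 * (1 / sinh (2 * t) - sinh (2 * t) * cos (2 * \<theta>) / ((sinh (2 * t))\<^sup>2 + (sin (2 * \<theta>))\<^sup>2))
    \<le> Re (csch_sum (of_real t)) - Re (csch_sum (Complex t \<theta>))"
proof -
  define u where "u k = 1 / (2 * real (Suc k)) * (1 / sinh (real (Suc k) * t))" for k
  define v where "v k = 1 / (2 * real (Suc k)) * Re (1 / sinh (Complex (real (Suc k) * t) (real (Suc k) * \<theta>)))" for k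
  have tm: "Re (1 / (2 * of_nat (Suc k) * sinh (of_nat (Suc k) * Complex t \<theta>))) =
      1 / (2 * real (Suc k)) * Re (1 / sinh (Complex (real (Suc k) * t) (real (Suc k) * \<theta>)))" for k \<theta>
  proof -
    have "of_nat (Suc k) * Complex t \<theta> = Complex (real (Suc k) * t) (real (Suc k) * \<theta>)"
      by (simp add: complex_eq_iff algebra_simps)
    moreover have "1 / (2 * of_nat (Suc k) * z) = of_real (1 / (2 * real (Suc k))) * (1 / z)" for z :: complex
      by simp
    moreover have "Re (of_real r * z) = r * Re z" for r z by simp
    ultimately show ?thesis by (simp only:)
  qed
  have v: "v sums Re (csch_sum (Complex t \<theta>))"
    using sums_Re[OF csch_sum(2)[of "Complex t \<theta>"]] t unfolding tm v_def by simp
  have "Complex t 0 = of_real t" by (simp add: complex_eq_iff)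
  then have "(\<lambda>k. 1 / (2 * real (Suc k)) * Re (1 / sinh (Complex (real (Suc k) * t) (real (Suc k) * 0))))
      sums Re (csch_sum (of_real t))"
    using sums_Re[OF csch_sum(2)[of "Complex t 0"]] t unfolding tm by simp
  moreover have "Re (1 / sinh (Complex r (c * 0))) = 1 / sinh r" for r c
    by (simp add: Re_inverse_sinh_Complex power2_eq_square)
  ultimately have u: "u sums Re (csch_sum (of_real t))" unfolding u_def by (simp only:)
  have uv: "0 \<le> u k - v k" for k
  proof -
    let ?r = "real (Suc k) * t"
    have r: "sinh ?r > 0" using t by simp
    have "Re (1 / sinh (Complex ?r (real (Suc k) * \<theta>))) \<le> norm (1 / sinh (Complex ?r (real (Suc k) * \<theta>)))"
      by (rule complex_Re_le_cmod)
    also have "\<dots> \<le> 1 / sinh ?r"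
      using norm_sinh_ge[of "Complex ?r (real (Suc k) * \<theta>)"] r
      by (simp only: norm_divide norm_one) (intro frac_le; simp)
    finally show ?thesis unfolding u_def v_def right_diff_distrib[symmetric]
      by (intro mult_nonneg_nonneg) auto
  qed
  have d: "(\<lambda>k. u k - v k) sums (Re (csch_sum (of_real t)) - Re (csch_sum (Complex t \<theta>)))"
    by (rule sums_diff[OF u v])
  have "(\<Sum>k<2. u k - v k) \<le> (\<Sum>k. u k - v k)"
    using d uv by (intro sum_le_suminf) (auto simp: sums_iff)
  also have "\<dots> = Re (csch_sum (of_real t)) - Re (csch_sum (Complex t \<theta>))" using d by (simp add: sums_iff)
  also have "(\<Sum>k<2. u k - v k) = (u 0 - v 0) + (u 1 - v 1)" by (simp add: numeral_2_eq_2)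
  also have "u 0 - v 0 = 1 / 2 * (1 / sinh t - sinh t * cos \<theta> / ((sinh t)\<^sup>2 + (sin \<theta>)\<^sup>2))"
    unfolding u_def v_def Re_inverse_sinh_Complex by (simp add: right_diff_distrib)
  also have "u 1 - v 1 = 1 / 4 * (1 / sinh (2 * t) - sinh (2 * t) * cos (2 * \<theta>) / ((sinh (2 * t))\<^sup>2 + (sin (2 * \<theta>))\<^sup>2))"
    unfolding u_def v_def Re_inverse_sinh_Complex by (simp add: right_diff_distrib)
  finally show ?thesis .
qed

lemma sinh_upper:
  assumes "0 \<le> t" "t \<le> (1 :: real)"
  shows "sinh t \<le> t * (1 + t / 2)"
proof -
  have "exp t \<le> 1 + t + t\<^sup>2" using assms by (rule exp_bound)
  moreover have "1 - t \<le> exp (- t)" using exp_ge_add_one_self[of "- t"] by simp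
  ultimately show ?thesis by (simp add: sinh_field_def power2_eq_square field_simps)
qed

lemma sin_lower:
  assumes "0 \<le> x" "x \<le> ((21 / 100) :: real)"
  shows "(975 / 1000) * x \<le> sin x"
proof -
  have "(\<lambda>x. sin x - (975 / 1000) * x) 0 \<le> (\<lambda>x. sin x - (975 / 1000) * x) x"
  proof (rule DERIV_nonneg_imp_nondecreasing[OF assms(1)])
    fix y assume y: "0 \<le> y" "y \<le> x"
    have "((\<lambda>x. sin x - (975 / 1000) * x) has_real_derivative cos y - (975 / 1000)) (at y)"
      by (auto intro!: derivative_eq_intros)
    moreover have "0 \<le> cos y - (975 / 1000)"
    proof -
      have "sin (y / 2) \<le> y / 2" using y by (intro sin_x_le_x) simp
      moreover have "y \<le> pi" using y assms pi_ge_two by linarith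
      then have "0 \<le> sin (y / 2)" using y by (intro sin_ge_zero) auto
      ultimately have "(sin (y / 2))\<^sup>2 \<le> ((105 / 1000))\<^sup>2" using y assms by (intro power_mono) auto
      moreover have "cos y = 1 - 2 * (sin (y / 2))\<^sup>2" using cos_double_sin[of "y / 2"] by simp
      ultimately show ?thesis by (simp add: power2_eq_square)
    qed
    ultimately show "\<exists>d. ((\<lambda>x. sin x - (975 / 1000) * x) has_real_derivative d) (at y) \<and> 0 \<le> d" by blast
  qed
  then show ?thesis by simp
qed

text \<open>Either the subtracted fraction is at most 0, or its denominator is at least
  \<open>20 * S^2\<close> and it amounts to at most 5 percent of \<open>1 / S\<close>.\<close>

lemma csch_term_gain:
  fixes S s c k :: real
  assumes "S > 0" "c \<le> 1" "19 * S\<^sup>2 \<le> s\<^sup>2 \<or> c \<le> 0"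
  shows "(95 / 100) / S \<le> 1 / S - S * c / (S\<^sup>2 + s\<^sup>2)"
proof -
  have pos: "S\<^sup>2 + s\<^sup>2 > 0" using assms(1) by (simp add: add_pos_nonneg)
  have "S * c / (S\<^sup>2 + s\<^sup>2) \<le> (5 / 100) / S"
  proof (cases "c \<le> 0")
    case True
    then have "S * c / (S\<^sup>2 + s\<^sup>2) \<le> 0" using assms(1) pos by (simp add: divide_nonpos_pos mult_nonneg_nonpos)
    also have "0 \<le> (5 / 100) / S" using assms(1) by simp
    finally show ?thesis .
  next
    case False
    then have "S * c / (S\<^sup>2 + s\<^sup>2) \<le> S * 1 / (20 * S\<^sup>2)"
      using assms by (intro frac_le mult_left_mono) auto
    also have "\<dots> = (5 / 100) / S" using assms(1) by (simp add: power2_eq_square)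
    finally show ?thesis .
  qed
  moreover have "1 / S - (5 / 100) / S = (95 / 100) / S" by (simp flip: diff_divide_distrib)
  ultimately show ?thesis by linarith
qed

text \<open>The first term alone gains only about \<open>1 / (2 t)\<close> at
  \<open>\<theta> = pi / 2\<close>; the second raises this to \<open>0.58 / t\<close>, which is what
  makes the error small enough already at n = 2000. The boundary \<open>5 * t\<close> makes
  \<open>sin \<theta>\<close> at least \<open>4.4 * S\<close>, and \<open>4.4^2\<close> exceeds
  19.\<close>

lemma minor_arc_gain:
  assumes t: "0 < t" "t \<le> (205 / 10000)" and \<theta>: "5 * t \<le> \<theta>" "\<theta> \<le> pi"
  shows "(58 / 100) / t \<le> 1 / 2 * (1 / sinh t - sinh t * cos \<theta> / ((sinh t)\<^sup>2 + (sin \<theta>)\<^sup>2)) +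
      1 / 4 * (1 / sinh (2 * t) - sinh (2 * t) * cos (2 * \<theta>) / ((sinh (2 * t))\<^sup>2 + (sin (2 * \<theta>))\<^sup>2))"
proof -
  define S where "S = sinh t"
  define T where "T = sinh (2 * t)"
  have S: "t \<le> S" "S \<le> (10103 / 10000) * t"
  proof -
    show "t \<le> S" unfolding S_def using t by (intro sinh_real_ge) simp
    have "S \<le> t * (1 + t / 2)" unfolding S_def using t by (intro sinh_upper) auto
    also have "\<dots> \<le> t * (10103 / 10000)" using t by (intro mult_left_mono) auto
    finally show "S \<le> (10103 / 10000) * t" by simp
  qed
  have T: "2 * t \<le> T" "T \<le> (2041 / 1000) * t"
  proof -
    show "2 * t \<le> T" unfolding T_def using t by (intro sinh_real_ge) simp
    have "T \<le> 2 * t * (1 + 2 * t / 2)" unfolding T_def using t by (intro sinh_upper) auto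
    also have "\<dots> \<le> 2 * t * (10205 / 10000)" using t by (intro mult_left_mono) auto
    finally show "T \<le> (2041 / 1000) * t" by simp
  qed
  have S0: "S > 0" and T0: "T > 0" using S T t by linarith+
  have invS: "(9898 / 10000) / t \<le> 1 / S"
  proof -
    have "(9898 / 10000) * S \<le> t" using S t by linarith
    then show ?thesis using S0 t by (simp add: field_simps)
  qed
  have invT: "(4899 / 10000) / t \<le> 1 / T"
  proof -
    have "(4899 / 10000) * T \<le> t" using T t by linarith
    then show ?thesis using T0 t by (simp add: field_simps)
  qed
  have "(95 / 100) * (1 / 2 * (1 / S) + 1 / 4 * (1 / T)) \<le> 1 / 2 * (1 / S - S * cos \<theta> / (S\<^sup>2 + (sin \<theta>)\<^sup>2)) +
      1 / 4 * (1 / T - T * cos (2 * \<theta>) / (T\<^sup>2 + (sin (2 * \<theta>))\<^sup>2))"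
  proof (cases "\<theta> \<le> pi / 2")
    case True
    have s: "(975 / 1000) * w \<le> sin z" if "0 \<le> w" "w \<le> (21 / 100)" "w \<le> z" "z \<le> pi / 2" for w z
    proof -
      have "sin w \<le> sin z" using that by (intro sin_monotone_2pi_le) auto
      then show ?thesis using sin_lower[OF that(1,2)] by linarith
    qed
    have sq: "19 * M\<^sup>2 \<le> w\<^sup>2" if "0 < M" "(44 / 10) * M \<le> w" for M w :: real
    proof -
      have "((44 / 10) * M)\<^sup>2 \<le> w\<^sup>2" using that by (intro power_mono) auto
      moreover have "((44 / 10) * M)\<^sup>2 = (1936 / 100) * M\<^sup>2" by (simp add: power_mult_distrib power2_eq_square)
      moreover have "0 \<le> M\<^sup>2" by simp
      ultimately show ?thesis by linarith
    qed
    have g1: "(95 / 100) / S \<le> 1 / S - S * cos \<theta> / (S\<^sup>2 + (sin \<theta>)\<^sup>2)"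
    proof (rule csch_term_gain)
      have "(975 / 1000) * (5 * t) \<le> sin \<theta>" using t \<theta> True by (intro s) auto
      then have "(44 / 10) * S \<le> sin \<theta>" using S t by linarith
      then show "19 * S\<^sup>2 \<le> (sin \<theta>)\<^sup>2 \<or> cos \<theta> \<le> 0" using sq[OF S0] by blast
    qed (use S0 in auto)
    have g2: "(95 / 100) / T \<le> 1 / T - T * cos (2 * \<theta>) / (T\<^sup>2 + (sin (2 * \<theta>))\<^sup>2)"
    proof (rule csch_term_gain)
      show "19 * T\<^sup>2 \<le> (sin (2 * \<theta>))\<^sup>2 \<or> cos (2 * \<theta>) \<le> 0"
      proof (cases "2 * \<theta> \<le> pi / 2")
        case le: True
        have "(975 / 1000) * (10 * t) \<le> sin (2 * \<theta>)" using t \<theta> le by (intro s) auto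
        then have "(44 / 10) * T \<le> sin (2 * \<theta>)" using T t by linarith
        then show ?thesis using sq[OF T0] by blast
      next
        case False
        have "0 \<le> sin (2 * \<theta> - pi / 2)" using False True by (intro sin_ge_zero) auto
        then have "cos (2 * \<theta>) \<le> 0" by (simp add: sin_diff)
        then show ?thesis ..
      qed
    qed (use T0 in auto)
    have e: "p * (1 / 2 * (1 / S) + 1 / 4 * (1 / T)) = 1 / 2 * (p / S) + 1 / 4 * (p / T)" for p
      by (simp add: distrib_left)
    show ?thesis unfolding e by (intro add_mono mult_left_mono g1 g2) auto
  next
    case False
    define C where "C = - cos \<theta>"
    have "0 \<le> sin (\<theta> - pi / 2)" using False \<theta> by (intro sin_ge_zero) auto
    then have C: "C \<ge> 0" by (simp add: C_def sin_diff)
    have p1: "S * cos \<theta> / (S\<^sup>2 + (sin \<theta>)\<^sup>2) = - (S * C / (S\<^sup>2 + (sin \<theta>)\<^sup>2))" by (simp add: C_def)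
    have pos: "S\<^sup>2 + (sin \<theta>)\<^sup>2 > 0" using S0 by (simp add: add_pos_nonneg)
    have post: "T\<^sup>2 + (sin (2 * \<theta>))\<^sup>2 > 0" using T0 by (simp add: add_pos_nonneg)
    \<comment> \<open>As \<open>\<theta>\<close> approaches \<open>pi\<close>, the angle
      \<open>2 * \<theta>\<close> returns to a full turn and the second term gains nothing. The
      cosine in the first term is then negative, and its surplus covers the deficit.\<close>
    have key: "1 / 4 * (T * cos (2 * \<theta>) / (T\<^sup>2 + (sin (2 * \<theta>))\<^sup>2)) \<le> 1 / 2 * (S * C / (S\<^sup>2 + (sin \<theta>)\<^sup>2))"
    proof (cases "cos (2 * \<theta>) \<le> 0")
      case True
      then have 1: "T * cos (2 * \<theta>) / (T\<^sup>2 + (sin (2 * \<theta>))\<^sup>2) \<le> 0"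
        using T0 post by (simp add: divide_nonpos_pos mult_nonneg_nonpos)
      have 2: "0 \<le> S * C / (S\<^sup>2 + (sin \<theta>)\<^sup>2)" using S0 C pos by simp
      have "1 / 4 * m \<le> 1 / 2 * k" if "m \<le> 0" "0 \<le> k" for m k :: real using that by linarith
      from this[OF 1 2] show ?thesis .
    next
      case c2: False
      \<comment> \<open>A positive \<open>cos (2 * \<theta>)\<close> means that \<open>C^2\<close>
        is at least one half, so the square of \<open>sin (2 * \<theta>)\<close> is at least twice
        that of \<open>sin \<theta>\<close>. This makes the two denominators comparable.\<close>
      have C2: "1 / 2 \<le> C\<^sup>2" using c2 cos_double_cos[of \<theta>] by (simp add: C_def)
      have C7: "(7 / 10) \<le> C"
      proof (rule ccontr)
        assume "\<not> (7 / 10) \<le> C"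
        then have "C\<^sup>2 \<le> (7 / 10)\<^sup>2" using C by (intro power_mono) auto
        then show False using C2 by (simp add: power2_eq_square)
      qed
      have 1: "(sin (2 * \<theta>))\<^sup>2 = 4 * (sin \<theta>)\<^sup>2 * C\<^sup>2"
        by (simp add: sin_double C_def power_mult_distrib)
      have 2: "4 * (sin \<theta>)\<^sup>2 * (1 / 2) \<le> 4 * (sin \<theta>)\<^sup>2 * C\<^sup>2" using C2 by (intro mult_left_mono) auto
      have 3: "(2 * S)\<^sup>2 \<le> T\<^sup>2"
      proof (rule power_mono)
        show "2 * S \<le> T" using sinh_of_nat_mult_ge[OF t(1), of 1] by (simp add: S_def T_def)
      qed (use S0 in simp)
      have 4: "0 \<le> S\<^sup>2" "(2 * S)\<^sup>2 = 4 * S\<^sup>2" by (simp_all add: power_mult_distrib)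
      have "2 * (p + z) \<le> m + w" if "0 \<le> p" "4 * p \<le> m" "2 * z \<le> w"
        for p z m w :: real using that by simp
      from this[OF 4(1)] have den: "2 * (S\<^sup>2 + (sin \<theta>)\<^sup>2) \<le> T\<^sup>2 + (sin (2 * \<theta>))\<^sup>2"
        using 1 2 3 4(2) by simp
      have "T * cos (2 * \<theta>) / (T\<^sup>2 + (sin (2 * \<theta>))\<^sup>2) \<le> T * 1 / (2 * (S\<^sup>2 + (sin \<theta>)\<^sup>2))"
        using T0 den pos by (intro frac_le mult_left_mono) auto
      also have "\<dots> \<le> ((2041 / 1000) * S) / (2 * (S\<^sup>2 + (sin \<theta>)\<^sup>2))"
        using T S pos by (intro divide_right_mono) auto
      also have "\<dots> \<le> (4 * (S * C)) / (2 * (S\<^sup>2 + (sin \<theta>)\<^sup>2))"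
      proof (intro divide_right_mono)
        have "S * (7 / 10) \<le> S * C" using C7 S0 by (intro mult_left_mono) auto
        then show "(2041 / 1000) * S \<le> 4 * (S * C)" using S0 by linarith
      qed (use pos in simp)
      also have "\<dots> = 2 * (S * C / (S\<^sup>2 + (sin \<theta>)\<^sup>2))"
      proof -
        have "4 * k / (2 * m) = 2 * (k / m)" for k m :: real by simp
        then show ?thesis .
      qed
      finally have 1: "T * cos (2 * \<theta>) / (T\<^sup>2 + (sin (2 * \<theta>))\<^sup>2) \<le> 2 * (S * C / (S\<^sup>2 + (sin \<theta>)\<^sup>2))" .
      have "1 / 4 * m \<le> 1 / 2 * k" if "m \<le> 2 * k" for m k :: real using that by linarith
      from this[OF 1] show ?thesis .
    qed
    have inv: "0 \<le> 1 / S" "0 \<le> 1 / T" using S0 T0 by simp_all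
    have "95 / 100 * (1 / 2 * i + 1 / 4 * j) \<le> 1 / 2 * (i - - k) + 1 / 4 * (j - m)"
      if "1 / 4 * m \<le> 1 / 2 * k" "0 \<le> i" "0 \<le> j" for i j k m :: real
    proof -
      have "95 / 100 * (1 / 2 * i + 1 / 4 * j) \<le> 1 * (1 / 2 * i + 1 / 4 * j)"
        using that by (intro mult_right_mono) auto
      also have "\<dots> \<le> (1 / 2 * i + 1 / 2 * k) + (1 / 4 * j - 1 / 4 * m)"
        using that by simp
      finally show ?thesis by (simp add: distrib_left right_diff_distrib)
    qed
    from this[OF key inv] show ?thesis unfolding p1 .
  qed
  moreover have "(58 / 100) / t \<le> (95 / 100) * (1 / 2 * (1 / S) + 1 / 4 * (1 / T))"
  proof -
    have "(58 / 100) / t \<le> (95 / 100) * (1 / 2 * ((9898 / 10000) / t) + 1 / 4 * ((4899 / 10000) / t))"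
      using t by (simp add: field_simps)
    also have "\<dots> \<le> (95 / 100) * (1 / 2 * (1 / S) + 1 / 4 * (1 / T))"
      using invS invT by (intro mult_left_mono add_mono) auto
    finally show ?thesis .
  qed
  ultimately show ?thesis unfolding S_def T_def by linarith
qed

section \<open>The integrand on the central arc and on the rest\<close>

lemma norm_exp_minus_one_le:
  fixes z :: complex
  assumes "norm z \<le> 1 / 2"
  shows "norm (exp (- z) - 1) \<le> 2 * norm z"
proof -
  have "norm (exp (- z) - 1) \<le> exp \<bar>Re z\<bar> * norm z" using Taylor_exp[of "- z" 0] by simp
  also have "exp \<bar>Re z\<bar> \<le> 2"
  proof -
    have "exp \<bar>Re z\<bar> \<le> 1 + \<bar>Re z\<bar> + \<bar>Re z\<bar>\<^sup>2"
      using assms abs_Re_le_cmod[of z] by (intro exp_bound) auto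
    also have "\<bar>Re z\<bar>\<^sup>2 \<le> (1 / 2)\<^sup>2" using assms abs_Re_le_cmod[of z] by (intro power_mono) auto
    finally show ?thesis using assms abs_Re_le_cmod[of z] by (simp add: power2_eq_square)
  qed
  finally show ?thesis by (simp add: mult_right_mono)
qed

text \<open>On this arc \<open>(norm s)^2 \<le> 26 * t^2\<close>, hence
  \<open>Re (2 * pi^2 / s) \<ge> 12 / 13 * y\<close>, and \<open>12 / 13\<close> exceeds 0.92. The
  reflected \<open>csch_sum\<close> is then exponentially small.\<close>

lemma major_arc_error:
  assumes t: "t > 0" and y: "y = pi\<^sup>2 / 12 / t" "y \<ge> 40" and s: "Re s = t" "\<bar>Im s\<bar> \<le> 5 * t"
  shows "norm (exp (- csch_sum (2 * (of_real pi)\<^sup>2 / s)) - 1) \<le> 5 * exp (- (92 / 100 * y))"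
proof -
  define v where "v = 2 * (of_real pi)\<^sup>2 / s"
  have "Re v = 2 * pi\<^sup>2 * (t / (t\<^sup>2 + (Im s)\<^sup>2))"
    by (simp add: v_def Re_divide s(1) power2_eq_square)
  moreover have "t / (26 * t\<^sup>2) \<le> t / (t\<^sup>2 + (Im s)\<^sup>2)"
  proof (rule frac_le)
    have "\<bar>Im s\<bar>\<^sup>2 \<le> (5 * t)\<^sup>2" using s(2) by (intro power_mono) auto
    then show "t\<^sup>2 + (Im s)\<^sup>2 \<le> 26 * t\<^sup>2" by (simp add: power_mult_distrib)
  qed (use t in \<open>auto intro: add_pos_nonneg\<close>)
  then have "2 * pi\<^sup>2 * (t / (26 * t\<^sup>2)) \<le> 2 * pi\<^sup>2 * (t / (t\<^sup>2 + (Im s)\<^sup>2))" by (intro mult_left_mono) auto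
  moreover have "2 * pi\<^sup>2 * (t / (26 * t\<^sup>2)) = 12 / 13 * y" using t by (simp add: y(1) power2_eq_square)
  ultimately have w: "92 / 100 * y \<le> Re v" using y(2) by linarith
  define E where "E = exp (92 / 100 * y)"
  have E: "37 \<le> E" using exp_ge_add_one_self[of "92 / 100 * y"] y(2) unfolding E_def by linarith
  have "E / 3 \<le> sinh (92 / 100 * y)"
  proof -
    have "exp (- (92 / 100 * y)) \<le> 1" using y(2) by simp
    then have "(E - 1) / 2 \<le> sinh (92 / 100 * y)" unfolding sinh_field_def E_def by simp
    moreover have "E / 3 \<le> (E - 1) / 2" using E by simp
    ultimately show ?thesis by (rule order_trans[rotated])
  qed
  also have "\<dots> \<le> sinh (Re v)" using w by simp
  finally have sE: "E / 3 \<le> sinh (Re v)" .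
  have "Re v > 0" using w y(2) by linarith
  then have "norm (csch_sum v) \<le> pi\<^sup>2 / 12 / sinh (Re v)" by (rule csch_sum(3))
  also have "\<dots> \<le> pi\<^sup>2 / 12 / (E / 3)" using sE E by (intro frac_le) auto
  also have "\<dots> = 3 * pi\<^sup>2 / 12 / E" by simp
  also have "\<dots> \<le> (5 / 2) / E"
  proof -
    have "pi\<^sup>2 \<le> (3.1415926535899)\<^sup>2" using pi_approx by (intro power_mono) auto
    then have "pi\<^sup>2 \<le> 10" by (simp add: power2_eq_square)
    then show ?thesis using E by (intro divide_right_mono) auto
  qed
  finally have G: "norm (csch_sum v) \<le> (5 / 2) / E" .
  have "(5 / 2) / E \<le> (5 / 2) / 37" using E by (intro divide_left_mono) auto
  then have "norm (csch_sum v) \<le> 1 / 2" using G by simp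
  then have "norm (exp (- csch_sum v) - 1) \<le> 2 * norm (csch_sum v)" by (rule norm_exp_minus_one_le)
  also have "\<dots> \<le> 5 / E" using G by simp
  also have "5 / E = 5 * exp (- (92 / 100 * y))" unfolding E_def exp_minus by (rule divide_inverse)
  finally show ?thesis unfolding v_def .
qed

text \<open>The exponential of the reflection formula: the summand \<open>s / 24\<close> is the
  origin of the shift from \<open>n\<close> to \<open>n + 1 / 24\<close>, and
  \<open>ln 2 / 2\<close> that of the factor \<open>1 / sqrt 2\<close>.\<close>

lemma csch_sum_eq:
  assumes "Re s > 0"
  shows "exp (csch_sum s + of_nat n * s) = of_real (1 / sqrt 2) *
    (exp (of_real (pi\<^sup>2 / 12) / s + of_real (real n + 1 / 24) * s) * exp (- csch_sum (2 * (of_real pi)\<^sup>2 / s)))"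
proof -
  have s0: "s \<noteq> 0" using assms by auto
  have "csch_sum s = (of_real pi)\<^sup>2 / (12 * s) + s / 24 - of_real (ln 2) / 2 - csch_sum (2 * (of_real pi)\<^sup>2 / s)"
    using csch_sum_reflect[OF assms] by (simp add: eq_diff_eq)
  then have "csch_sum s + of_nat n * s = of_real (- (ln 2 / 2)) +
      ((of_real (pi\<^sup>2 / 12) / s + of_real (real n + 1 / 24) * s) + - csch_sum (2 * (of_real pi)\<^sup>2 / s))"
    using s0 by (simp add: field_simps)
  moreover have "exp (complex_of_real (- (ln 2 / 2))) = of_real (1 / sqrt 2)"
  proof -
    have "exp (- (ln 2 / 2)) = 1 / sqrt (2 :: real)"
      by (simp add: exp_minus ln_sqrt[symmetric] inverse_eq_divide)
    then show ?thesis by (simp only: exp_of_real)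
  qed
  ultimately show ?thesis by (simp only: exp_add)
qed

text \<open>The comparison is with the real point \<open>s = t\<close>. There the reflected
  \<open>csch_sum\<close> is nonnegative, which bounds the integrand by \<open>exp (2 * y)\<close>;
  away from it a factor \<open>exp (- 0.58 / t)\<close> is lost, at most
  \<open>exp (- 0.7 * y)\<close> since \<open>pi^2 / 12\<close> is below 0.823.\<close>

lemma minor_arc_bound:
  assumes t: "0 < t" "t \<le> 205 / 10000" and y: "y = pi\<^sup>2 / 12 / t" "(real n + 1 / 24) * t = y"
    and s: "Re s = t" "5 * t \<le> \<bar>Im s\<bar>" "\<bar>Im s\<bar> \<le> pi"
  shows "norm (of_real (sqrt 2) * exp (csch_sum s + of_nat n * s)) \<le> exp (13 / 10 * y)"
proof -
  define \<theta> where "\<theta> = \<bar>Im s\<bar>"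
  have e: "cos (Im s) = cos \<theta>" "(sin (Im s))\<^sup>2 = (sin \<theta>)\<^sup>2" "cos (2 * Im s) = cos (2 * \<theta>)"
    "(sin (2 * Im s))\<^sup>2 = (sin (2 * \<theta>))\<^sup>2"
    by (auto simp: \<theta>_def abs_if)
  have sc: "s = Complex t (Im s)" using s(1) by (simp add: complex_eq_iff)
  have "58 / 100 / t \<le> Re (csch_sum (of_real t)) - Re (csch_sum s)"
    using minor_arc_gain[OF t, of \<theta>] Re_csch_sum_diff[OF t(1), of "Im s"] s(2,3)
    unfolding e sc[symmetric] by (simp add: \<theta>_def)
  moreover have "7 / 10 * y \<le> 58 / 100 / t"
  proof -
    have "pi\<^sup>2 \<le> (3.1415926535899)\<^sup>2" using pi_approx by (intro power_mono) auto
    then have "7 / 10 * (pi\<^sup>2 / 12) \<le> 58 / 100" by (simp add: power2_eq_square)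
    then have "7 / 10 * (pi\<^sup>2 / 12) / t \<le> 58 / 100 / t" using t by (intro divide_right_mono) auto
    then show ?thesis by (simp add: y(1))
  qed
  ultimately have gain: "Re (csch_sum s) \<le> Re (csch_sum (of_real t)) - 7 / 10 * y" by linarith
  have "norm (of_real (sqrt 2) * exp (csch_sum s + of_nat n * s)) = sqrt 2 * exp (Re (csch_sum s) + real n * t)"
    by (simp add: norm_mult norm_exp_eq_Re s(1))
  also have "\<dots> \<le> sqrt 2 * exp (Re (csch_sum (of_real t)) - 7 / 10 * y + real n * t)"
    using gain by simp
  also have "\<dots> = norm (of_real (sqrt 2) * exp (csch_sum (of_real t) + of_nat n * of_real t)) * exp (- (7 / 10 * y))"
    by (simp add: norm_mult norm_exp_eq_Re mult_exp_exp)
  also have "norm (of_real (sqrt 2) * exp (csch_sum (of_real t) + of_nat n * of_real t)) \<le> exp (2 * y)"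
  proof -
    define v where "v = 2 * pi\<^sup>2 / t"
    have v: "v > 0" using t by (simp add: v_def)
    have "0 \<le> Re (csch_sum (of_real v))"
    proof -
      have 1: "(\<lambda>k. Re (1 / (2 * of_nat (Suc k) * sinh (of_nat (Suc k) * of_real v)))) sums Re (csch_sum (of_real v))"
        using v by (intro sums_Re csch_sum(2)) simp
      have 2: "0 \<le> Re (1 / (2 * of_nat (Suc k) * sinh (of_nat (Suc k) * of_real v)))" for k
      proof -
        have "1 / (2 * of_nat (Suc k) * sinh (of_nat (Suc k) * of_real v)) =
            complex_of_real (1 / (2 * real (Suc k) * sinh (real (Suc k) * v)))"
        proof -
          have "sinh (of_real r) = complex_of_real (sinh r)" for r
            by (simp add: sinh_field_def flip: exp_of_real)
          then have "sinh (of_nat (Suc k) * of_real v) = complex_of_real (sinh (real (Suc k) * v))"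
            by (metis of_real_mult of_real_of_nat_eq)
          then show ?thesis by simp
        qed
        then show ?thesis using v by (simp only: Re_complex_of_real) (simp del: of_nat_Suc)
      qed
      show ?thesis by (rule sums_le[OF 2 sums_zero 1])
    qed
    moreover have "2 * (of_real pi)\<^sup>2 / complex_of_real t = of_real v" by (simp add: v_def)
    ultimately have "norm (exp (- csch_sum (2 * (of_real pi)\<^sup>2 / complex_of_real t))) \<le> 1"
      by (simp add: norm_exp_eq_Re)
    moreover have "norm (exp (of_real (pi\<^sup>2 / 12) / of_real t + of_real (real n + 1 / 24) * complex_of_real t)) = exp (2 * y)"
    proof -
      have "of_real (pi\<^sup>2 / 12) / of_real t + of_real (real n + 1 / 24) * complex_of_real t = of_real (2 * y)"
        unfolding of_real_mult[symmetric] of_real_divide[symmetric] of_real_add[symmetric] y(2) by (simp add: y(1))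
      then show ?thesis by (simp only: norm_exp_eq_Re Re_complex_of_real)
    qed
    moreover have "norm (of_real (sqrt 2) * (of_real (1 / sqrt 2) * (z * w))) = norm z * norm w" for z w :: complex
      by (simp add: norm_mult norm_divide)
    ultimately show ?thesis using t by (subst csch_sum_eq) (simp, simp only: mult_left_le exp_ge_zero)
  qed
  finally have "norm (of_real (sqrt 2) * exp (csch_sum s + of_nat n * s)) \<le> exp (2 * y) * exp (- (7 / 10 * y))"
    by simp
  also have "\<dots> = exp (13 / 10 * y)" unfolding exp_add[symmetric] by simp
  finally show ?thesis .
qed

text \<open>The line of integration passes through the saddle point \<open>t = sqrt (a / x)\<close>
  of \<open>a / s + x * s\<close>, where both summands equal \<open>y = sqrt (a * x)\<close>. The
  minor arcs dominate the error; the factor \<open>5 / 4\<close> in place of 1 absorbs everything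
  else.\<close>

theorem q_bes_approx:
  assumes n: "n \<ge> 2000"
  defines "x \<equiv> real n + 1 / 24" and "a \<equiv> pi\<^sup>2 / 12"
  shows "\<bar>sqrt 2 * real (q n) - bes a x\<bar> \<le> 5 / 4 * exp (13 / 10 * sqrt (a * x))"
proof -
  define t where "t = sqrt (a / x)"
  define y where "y = sqrt (a * x)"
  have a: "822 / 1000 \<le> a" "a \<le> 823 / 1000"
  proof -
    have "(3.141592653588)\<^sup>2 \<le> pi\<^sup>2" "pi\<^sup>2 \<le> (3.1415926535899)\<^sup>2"
      using pi_approx by (intro power_mono; simp)+
    then show "822 / 1000 \<le> a" "a \<le> 823 / 1000" by (simp_all add: a_def power2_eq_square)
  qed
  have x: "x \<ge> 2000" using n by (simp add: x_def)
  have t0: "t > 0" using a x by (simp add: t_def)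
  have t1: "t \<le> 205 / 10000"
  proof -
    have "a / x \<le> (823 / 1000) / 2000" using a x by (intro frac_le) auto
    also have "\<dots> \<le> (205 / 10000)\<^sup>2" by (simp add: power2_eq_square)
    finally have "t \<le> sqrt ((205 / 10000)\<^sup>2)" unfolding t_def by (simp only: real_sqrt_le_iff)
    then show ?thesis by simp
  qed
  have y40: "40 \<le> y"
  proof -
    have "40\<^sup>2 \<le> (822 / 1000) * (2000 :: real)" by simp
    also have "\<dots> \<le> a * x" using a x by (intro mult_mono) auto
    finally have "sqrt (40\<^sup>2) \<le> y" unfolding y_def by (simp only: real_sqrt_le_iff)
    then show ?thesis by simp
  qed
  have xt: "x * t = y" and at: "y = a / t"
  proof -
    define p where "p = sqrt x"
    define r where "r = sqrt a"
    have pr: "p > 0" "r > 0" "x = p * p" "a = r * r" using x a by (simp_all add: p_def r_def)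
    moreover have "t = r / p" "y = r * p" by (simp_all add: t_def y_def p_def r_def real_sqrt_divide real_sqrt_mult)
    ultimately show "x * t = y" "y = a / t" by simp_all
  qed
  define f where "f s = of_real (sqrt 2) * exp (csch_sum s + of_nat n * s)" for s
  define E :: "complex \<Rightarrow> complex" where "E s = exp (of_real a / s + of_real x * s)" for s
  define A B C D where "A = Complex t (- pi)" and "B = Complex t (- (5 * t))" and "C = Complex t (5 * t)" and "D = Complex t pi"
  have t5: "5 * t \<le> pi" using t1 pi_ge_two by linarith
  have seg: "closed_segment A D = {z. Re z = t \<and> Im z \<in> {- pi..pi}}"
    "closed_segment A B = {z. Re z = t \<and> Im z \<in> {- pi..- (5 * t)}}"
    "closed_segment B C = {z. Re z = t \<and> Im z \<in> {- (5 * t)..5 * t}}"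
    "closed_segment B D = {z. Re z = t \<and> Im z \<in> {- (5 * t)..pi}}"
    "closed_segment C D = {z. Re z = t \<and> Im z \<in> {5 * t..pi}}"
    using t0 t5 by (auto simp: A_def B_def C_def D_def closed_segment_same_Re closed_segment_eq_real_ivl)
  have cont: "continuous_on S f" if "S \<subseteq> {z. Re z = t}" for S
    unfolding f_def
    by (intro continuous_intros continuous_on_subset[OF continuous_on_csch_sum[OF t0] that])
  have contA: "continuous_on (closed_segment A D) f" "continuous_on (closed_segment B D) f"
    and int: "f contour_integrable_on linepath A B" "f contour_integrable_on linepath B C" "f contour_integrable_on linepath C D"
    by (auto intro!: contour_integrable_continuous_linepath cont simp: seg)
  have intE: "E contour_integrable_on linepath B C"
    unfolding E_def using t0
    by (intro contour_integrable_continuous_linepath continuous_intros) (auto simp: seg)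
  have total: "contour_integral (linepath A D) f = of_real (sqrt 2) * (of_nat (q n) * (of_real (2 * pi) * \<i>))"
  proof -
    have "f contour_integrable_on linepath A D" by (rule contour_integrable_continuous_linepath[OF contA(1)])
    have "(\<lambda>s. exp (csch_sum s + of_nat n * s)) contour_integrable_on linepath A D"
      by (intro contour_integrable_continuous_linepath continuous_intros
        continuous_on_subset[OF continuous_on_csch_sum[OF t0]]) (auto simp: seg)
    then show ?thesis unfolding f_def A_def D_def
      using contour_integral_exp_csch_sum[OF t0, of n] by (simp add: contour_integral_lmul A_def D_def)
  qed
  have "contour_integral (linepath A D) f = contour_integral (linepath A B) f + contour_integral (linepath B D) f"
    using t0 t5 by (intro contour_integral_split_linepath contA) (auto simp: seg B_def)
  also have "contour_integral (linepath B D) f = contour_integral (linepath B C) f + contour_integral (linepath C D) f"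
    using t0 t5 by (intro contour_integral_split_linepath contA) (auto simp: seg C_def)
  finally have split: "contour_integral (linepath A D) f =
     contour_integral (linepath A B) f + contour_integral (linepath B C) f + contour_integral (linepath C D) f"
    by simp
  have minor: "norm (f s) \<le> exp (13 / 10 * y)" if "Re s = t" "5 * t \<le> \<bar>Im s\<bar>" "\<bar>Im s\<bar> \<le> pi" for s
    unfolding f_def using xt at that by (intro minor_arc_bound[OF t0 t1]) (auto simp: a_def x_def)
  have len: "norm (B - A) = pi - 5 * t" "norm (D - C) = pi - 5 * t" "norm (C - B) = 10 * t"
  proof -
    have "B - A = \<i> * of_real (pi - 5 * t)" "D - C = \<i> * of_real (pi - 5 * t)" "C - B = \<i> * of_real (10 * t)"
      by (simp_all add: A_def B_def C_def D_def complex_eq_iff)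
    then show "norm (B - A) = pi - 5 * t" "norm (D - C) = pi - 5 * t" "norm (C - B) = 10 * t"
      using t0 t5 by (simp_all only: norm_mult norm_ii norm_of_real) simp_all
  qed
  have m1: "norm (contour_integral (linepath A B) f) \<le> exp (13 / 10 * y) * (pi - 5 * t)"
    unfolding len(1)[symmetric]
  proof (rule contour_integral_bound_linepath[OF int(1)])
    fix s assume "s \<in> closed_segment A B"
    then have "Re s = t" "5 * t \<le> \<bar>Im s\<bar>" "\<bar>Im s\<bar> \<le> pi" using t0 t5 unfolding seg by auto
    then show "norm (f s) \<le> exp (13 / 10 * y)" by (rule minor)
  qed simp
  have m2: "norm (contour_integral (linepath C D) f) \<le> exp (13 / 10 * y) * (pi - 5 * t)"
    unfolding len(2)[symmetric]
  proof (rule contour_integral_bound_linepath[OF int(3)])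
    fix s assume "s \<in> closed_segment C D"
    then have "Re s = t" "5 * t \<le> \<bar>Im s\<bar>" "\<bar>Im s\<bar> \<le> pi" using t0 t5 unfolding seg by auto
    then show "norm (f s) \<le> exp (13 / 10 * y)" by (rule minor)
  qed simp
  have m3: "norm (contour_integral (linepath B C) (\<lambda>s. f s - E s)) \<le> 5 * exp (108 / 100 * y) * (10 * t)"
    unfolding len(3)[symmetric]
  proof (rule contour_integral_bound_linepath)
    show "(\<lambda>s. f s - E s) contour_integrable_on linepath B C"
      by (intro contour_integrable_diff int intE)
    fix s assume "s \<in> closed_segment B C"
    then have s: "Re s = t" "\<bar>Im s\<bar> \<le> 5 * t" by (auto simp: seg)
    have "f s - E s = E s * (exp (- csch_sum (2 * (of_real pi)\<^sup>2 / s)) - 1)"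
    proof -
      have "f s = of_real (sqrt 2) * (of_real (1 / sqrt 2) * (E s * exp (- csch_sum (2 * (of_real pi)\<^sup>2 / s))))"
        using s t0 unfolding f_def E_def a_def x_def by (subst csch_sum_eq) simp_all
      also have "\<dots> = E s * exp (- csch_sum (2 * (of_real pi)\<^sup>2 / s))"
        unfolding mult.assoc[symmetric] of_real_mult[symmetric] by simp
      finally show ?thesis by (simp add: algebra_simps)
    qed
    then have "norm (f s - E s) = norm (E s) * norm (exp (- csch_sum (2 * (of_real pi)\<^sup>2 / s)) - 1)"
      by (simp only: norm_mult)
    also have "\<dots> \<le> exp (2 * y) * (5 * exp (- (92 / 100 * y)))"
    proof (intro mult_mono)
      have "Re (of_real a / s) \<le> a / t"
      proof -
        have "Re (of_real a / s) \<le> norm (of_real a / s)" by (rule complex_Re_le_cmod)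
        also have "\<dots> = a / norm s" using a by (simp add: norm_divide)
        also have "\<dots> \<le> a / t" using a t0 s complex_Re_le_cmod[of s] by (intro divide_left_mono mult_pos_pos) auto
        finally show ?thesis .
      qed
      then show "norm (E s) \<le> exp (2 * y)" unfolding E_def norm_exp_eq_Re using s xt at by simp
      show "norm (exp (- csch_sum (2 * (of_real pi)\<^sup>2 / s)) - 1) \<le> 5 * exp (- (92 / 100 * y))"
        by (rule major_arc_error[OF t0 _ y40 s]) (simp add: at a_def)
    qed auto
    also have "\<dots> = 5 * exp (108 / 100 * y)" by (simp add: mult_exp_exp)
    finally show "norm (f s - E s) \<le> 5 * exp (108 / 100 * y)" .
  qed simp
  have m4: "norm (contour_integral (linepath B C) E - of_real (2 * pi) * \<i> * of_real (bes a x)) \<le> 4 * t * exp (26 / 25 * y) + 10 * t"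
  proof -
    have "norm (contour_integral (linepath B C) E - of_real (2 * pi) * \<i> * of_real (bes a x)) \<le>
        4 * t * exp (x * t + a * t / (5 * t)\<^sup>2) + 2 * (5 * t)"
      unfolding B_def C_def E_def[abs_def] using a x t0 by (intro vertical_segment_integral_bes) auto
    also have "x * t + a * t / (5 * t)\<^sup>2 = 26 / 25 * y"
      using t0 unfolding xt by (simp add: at power2_eq_square)
    finally show ?thesis by simp
  qed
  have diff: "contour_integral (linepath B C) (\<lambda>s. f s - E s) = contour_integral (linepath B C) f - contour_integral (linepath B C) E"
    by (rule contour_integral_diff[OF int(2) intE])
  have "of_real (2 * pi) * \<i> * of_real (sqrt 2 * real (q n) - bes a x) =
      of_real (sqrt 2) * (of_nat (q n) * (of_real (2 * pi) * \<i>)) - of_real (2 * pi) * \<i> * of_real (bes a x)"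
    by (simp add: algebra_simps)
  also have "\<dots> = contour_integral (linepath A B) f + contour_integral (linepath C D) f
      + contour_integral (linepath B C) (\<lambda>s. f s - E s)
      + (contour_integral (linepath B C) E - of_real (2 * pi) * \<i> * of_real (bes a x))"
    unfolding total[symmetric] split diff by simp
  finally have decomp: "of_real (2 * pi) * \<i> * of_real (sqrt 2 * real (q n) - bes a x) =
      contour_integral (linepath A B) f + contour_integral (linepath C D) f
      + contour_integral (linepath B C) (\<lambda>s. f s - E s)
      + (contour_integral (linepath B C) E - of_real (2 * pi) * \<i> * of_real (bes a x))" .
  have tri: "norm (z1 + z2 + z3 + z4) \<le> norm z1 + norm z2 + norm z3 + norm z4" for z1 z2 z3 z4 :: complex
    using norm_triangle_ineq[of "z1 + z2 + z3" z4] norm_triangle_ineq[of "z1 + z2" z3] norm_triangle_ineq[of z1 z2]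
    by linarith
  have "norm (of_real (2 * pi) * \<i> * of_real (sqrt 2 * real (q n) - bes a x)) \<le>
      norm (contour_integral (linepath A B) f) + norm (contour_integral (linepath C D) f)
      + norm (contour_integral (linepath B C) (\<lambda>s. f s - E s))
      + norm (contour_integral (linepath B C) E - of_real (2 * pi) * \<i> * of_real (bes a x))"
    unfolding decomp by (rule tri)
  also have "\<dots> \<le> exp (13 / 10 * y) * (pi - 5 * t) + exp (13 / 10 * y) * (pi - 5 * t) +
      5 * exp (108 / 100 * y) * (10 * t) + (4 * t * exp (26 / 25 * y) + 10 * t)"
    using m1 m2 m3 m4 by linarith
  \<comment> \<open>Central arc, horizontal sides and left side contribute \<open>50 * t\<close>,
    \<open>4 * t\<close> and \<open>10 * t\<close>; the bound on \<open>t\<close> makes their sum at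
    most a quarter of \<open>2 * pi\<close>.\<close>
  also have "\<dots> \<le> 2 * pi * exp (13 / 10 * y) + 64 * t * exp (13 / 10 * y)"
  proof -
    have "exp (108 / 100 * y) \<le> exp (13 / 10 * y)" "exp (26 / 25 * y) \<le> exp (13 / 10 * y)" "1 \<le> exp (13 / 10 * y)"
      using y40 by simp_all
    from this[THEN mult_left_mono, of t] have "t * exp (108 / 100 * y) \<le> t * exp (13 / 10 * y)"
      "t * exp (26 / 25 * y) \<le> t * exp (13 / 10 * y)" "t \<le> t * exp (13 / 10 * y)"
      using t0 by simp_all
    moreover have "0 \<le> t * exp (13 / 10 * y)" using t0 by simp
    ultimately show ?thesis by (simp add: algebra_simps)
  qed
  also have "\<dots> \<le> 2 * pi * exp (13 / 10 * y) + 2 * pi * (1 / 4) * exp (13 / 10 * y)"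
  proof -
    have "64 * t \<le> 2 * pi * (1 / 4)" using t1 pi_approx(1) by simp
    then show ?thesis by (intro add_left_mono mult_right_mono) auto
  qed
  also have "\<dots> = 2 * pi * (5 / 4 * exp (13 / 10 * y))" by (simp add: algebra_simps)
  also have "norm (of_real (2 * pi) * \<i> * of_real (sqrt 2 * real (q n) - bes a x)) = 2 * pi * \<bar>sqrt 2 * real (q n) - bes a x\<bar>"
    by (simp only: norm_mult norm_of_real norm_ii) simp
  finally have "2 * pi * \<bar>sqrt 2 * real (q n) - bes a x\<bar> \<le> 2 * pi * (5 / 4 * exp (13 / 10 * y))" .
  then show ?thesis unfolding y_def by simp
qed

section \<open>Verified computation for small arguments\<close>

unbundle fps_syntax

text \<open>Binary numerals with the least significant bit first. Each step of symbolic evaluation takes time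
  proportional to the size of the term, hence tables are lists of short chunks.\<close>

datatype bin = BZ | B0 bin | B1 bin

fun binc :: "bin \<Rightarrow> bin" where
  "binc BZ = B1 BZ"
| "binc (B0 x) = B1 x"
| "binc (B1 x) = B0 (binc x)"

fun badd :: "bin \<Rightarrow> bin \<Rightarrow> bin" and baddc :: "bin \<Rightarrow> bin \<Rightarrow> bin" where
  "badd BZ y = y"
| "badd (B0 x) BZ = B0 x"
| "badd (B1 x) BZ = B1 x"
| "badd (B0 x) (B0 y) = B0 (badd x y)"
| "badd (B0 x) (B1 y) = B1 (badd x y)"
| "badd (B1 x) (B0 y) = B1 (badd x y)"
| "badd (B1 x) (B1 y) = B0 (baddc x y)"
| "baddc BZ y = binc y"
| "baddc (B0 x) BZ = B1 x"
| "baddc (B1 x) BZ = B0 (binc x)"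
| "baddc (B0 x) (B0 y) = B1 (badd x y)"
| "baddc (B0 x) (B1 y) = B0 (baddc x y)"
| "baddc (B1 x) (B0 y) = B0 (baddc x y)"
| "baddc (B1 x) (B1 y) = B1 (baddc x y)"

text \<open>Low digits come first, so the flag \<open>c\<close> records the verdict of the digits
  read so far and is overruled by any higher digit that differs. At the top it decides the case of
  equality.\<close>

fun blt :: "bool \<Rightarrow> bin \<Rightarrow> bin \<Rightarrow> bool" where
  "blt c BZ BZ = c"
| "blt c BZ (B0 y) = blt c BZ y"
| "blt c BZ (B1 y) = True"
| "blt c (B0 x) BZ = blt c x BZ"
| "blt c (B1 x) BZ = False"
| "blt c (B0 x) (B0 y) = blt c x y"
| "blt c (B0 x) (B1 y) = blt True x y"
| "blt c (B1 x) (B0 y) = blt False x y"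
| "blt c (B1 x) (B1 y) = blt c x y"

fun bdec :: "bin \<Rightarrow> bin" where
  "bdec BZ = BZ"
| "bdec (B0 x) = B1 (bdec x)"
| "bdec (B1 x) = B0 x"

text \<open>\<open>bsubb\<close> subtracts with a borrow. The results are meaningful only if nothing
  underflows; beyond that the clauses return default values.\<close>

fun bsub :: "bin \<Rightarrow> bin \<Rightarrow> bin" and bsubb :: "bin \<Rightarrow> bin \<Rightarrow> bin" where
  "bsub x BZ = x"
| "bsub BZ (B0 y) = BZ"
| "bsub BZ (B1 y) = BZ"
| "bsub (B0 x) (B0 y) = B0 (bsub x y)"
| "bsub (B0 x) (B1 y) = B1 (bsubb x y)"
| "bsub (B1 x) (B0 y) = B1 (bsub x y)"
| "bsub (B1 x) (B1 y) = B0 (bsub x y)"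
| "bsubb x BZ = bdec x"
| "bsubb BZ (B0 y) = BZ"
| "bsubb BZ (B1 y) = BZ"
| "bsubb (B0 x) (B0 y) = B1 (bsubb x y)"
| "bsubb (B0 x) (B1 y) = B0 (bsubb x y)"
| "bsubb (B1 x) (B0 y) = B0 (bsub x y)"
| "bsubb (B1 x) (B1 y) = B1 (bsubb x y)"

fun bmul :: "bin \<Rightarrow> bin \<Rightarrow> bin" where
  "bmul BZ y = BZ"
| "bmul (B0 x) y = B0 (bmul x y)"
| "bmul (B1 x) y = badd y (B0 (bmul x y))"

text \<open>Lengths are given by lists that are consumed cell by cell, so that the loops carry no
  counter of type \<open>nat\<close>.\<close>

fun droplist :: "'a list \<Rightarrow> 'b list \<Rightarrow> 'b list" where
  "droplist [] ys = ys"
| "droplist (x # xs) [] = []"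
| "droplist (x # xs) (y # ys) = droplist xs ys"

fun takelist :: "'a list \<Rightarrow> 'b list \<Rightarrow> 'b list" where
  "takelist [] ys = []"
| "takelist (x # xs) [] = []"
| "takelist (x # xs) (y # ys) = y # takelist xs ys"

fun app :: "'a list \<Rightarrow> 'a list \<Rightarrow> 'a list" where
  "app [] ys = ys"
| "app (x # xs) ys = x # app xs ys"

fun revapp :: "'a list \<Rightarrow> 'a list \<Rightarrow> 'a list" where
  "revapp [] ys = ys"
| "revapp (x # xs) ys = revapp xs (x # ys)"

text \<open>Division of a power series by \<open>1 - X^k\<close> in terms of coefficients: each
  output is the input plus the output \<open>k\<close> places earlier. The last \<open>k\<close>
  outputs wait in a queue with front \<open>fr\<close> and reversed back \<open>bk\<close>.
  \<open>lagsum1\<close> takes the place of a \<open>let\<close>, since the new sum is both emitted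
  and queued.\<close>

fun lagsum :: "bin list \<Rightarrow> bin list \<Rightarrow> bin list \<Rightarrow> bin list" 
and lagsum1 :: "bin \<Rightarrow> bin list \<Rightarrow> bin list \<Rightarrow> bin list \<Rightarrow> bin list"
and lagsum2 :: "bin list \<Rightarrow> bin list \<Rightarrow> bin list" where
  "lagsum fr bk [] = []"
| "lagsum [] bk (x # xs) = lagsum2 (revapp bk []) (x # xs)"
| "lagsum (p # fr) bk (x # xs) = lagsum1 (badd p x) fr bk xs"
| "lagsum1 s fr bk xs = s # lagsum fr (s # bk) xs"
| "lagsum2 [] xs = []"
| "lagsum2 (p # fr) [] = []"
| "lagsum2 (p # fr) (x # xs) = lagsum1 (badd p x) fr [] xs"

fun lagsums :: "bin list \<Rightarrow> bin list list \<Rightarrow> bin list list"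
and lagsums1 :: "bin list \<Rightarrow> bin list \<Rightarrow> bin list list \<Rightarrow> bin list list" where
  "lagsums fr [] = []"
| "lagsums fr (c # cs) = lagsums1 fr (lagsum fr [] c) cs"
| "lagsums1 fr s cs = s # lagsums (droplist s (app fr s)) cs"

text \<open>The prefix \<open>h\<close> is pushed in front of the table and the entries are cut anew
  into chunks of the length of \<open>w\<close>; what overflows a chunk becomes the prefix for the
  next one.\<close>

fun shifts :: "'b list \<Rightarrow> bin list \<Rightarrow> bin list list \<Rightarrow> bin list list"
and shifts1 :: "'b list \<Rightarrow> bin list \<Rightarrow> bin list list \<Rightarrow> bin list list" where
  "shifts w [] [] = []"
| "shifts w (x # h) [] = [x # h]"
| "shifts w h (c # cs) = shifts1 w (app h c) cs"
| "shifts1 w l cs = takelist w l # shifts w (droplist w l) cs"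

text \<open>One Horner step of \<open>tail_fps\<close> for each element of the list. With
  \<open>k\<close> elements left, the list itself is the initial queue for the division by
  \<open>1 - X^k\<close>, and replacing its head by 1 gives the prefix that multiplies by
  \<open>X^k\<close> and adds 1.\<close>

fun rows :: "'b list \<Rightarrow> bin list \<Rightarrow> bin list list \<Rightarrow> bin list list" where
  "rows w [] cs = cs"
| "rows w (z # zs) cs = rows w zs (shifts w (B1 BZ # zs) (lagsums (z # zs) cs))"

text \<open>Long division: as many binary digits of \<open>r / d\<close> as \<open>us\<close> has
  elements are appended to \<open>z\<close>.\<close>

fun bquot :: "'a list \<Rightarrow> bin \<Rightarrow> bin \<Rightarrow> bin \<Rightarrow> bin"
and bquot1 :: "bool \<Rightarrow> 'a list \<Rightarrow> bin \<Rightarrow> bin \<Rightarrow> bin \<Rightarrow> bin" where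
  "bquot [] r d z = z"
| "bquot (u # us) r d z = bquot1 (blt False (B0 r) d) us (B0 r) d z"
| "bquot1 True us r d z = bquot us r d (B0 z)"
| "bquot1 False us r d z = bquot us (bsub r d) d (B1 z)"

fun bdist :: "bin \<Rightarrow> bin \<Rightarrow> bin" where
  "bdist x y = (if blt False x y then bsub y x else bsub x y)"

text \<open>The arguments are ratios rounded down, so that \<open>e\<close> and \<open>f\<close> are off by less than 1.\<close>

fun turan_chk1 :: "bin \<Rightarrow> bin \<Rightarrow> bin \<Rightarrow> bool" where
  "turan_chk1 r e f = (\<not> blt False (B0 (B0 (bmul (bmul (bdec e) (bdec e)) (bdec f))))
     (bmul (binc r) (bmul (binc (binc (bdist e f))) (binc (binc (bdist e f))))))"

fun turan_chk :: "bin \<Rightarrow> bin \<Rightarrow> bin \<Rightarrow> bool" where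
  "turan_chk r0 r1 r2 = (if blt False r1 r0 then if blt False r2 r1 then
      turan_chk1 r1 (bsub r0 r1) (bsub r1 r2) else False else False)"

datatype state = State bool bin bin bin

text \<open>The quotient handed in as the third ratio is computed with integer part 1, which is
  right only for \<open>x \<le> y < 2 x\<close>; this is tested here, before the ratios are
  trusted.\<close>

fun turan_step :: "'a list \<Rightarrow> bool \<Rightarrow> bin \<Rightarrow> bin \<Rightarrow> bin \<Rightarrow> bin \<Rightarrow> bin \<Rightarrow> state" where
  "turan_step us ok x y r0 r1 r2 = State (if ok then if blt False y x then False else
    if blt False y (B0 x) then turan_chk r0 r1 r2 else False else False) y r1 r2"

fun turan_run :: "'a list \<Rightarrow> state \<Rightarrow> bin list \<Rightarrow> state" where
  "turan_run us s [] = s"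
| "turan_run us (State ok x r0 r1) (y # ys) =
     turan_run us (turan_step us ok x y r0 r1 (bquot us (bsub y x) x (B1 BZ))) ys"

fun turan_runs :: "'a list \<Rightarrow> state \<Rightarrow> bin list list \<Rightarrow> state" where
  "turan_runs us s [] = s"
| "turan_runs us s (c # cs) = turan_runs us (turan_run us s c) cs"

section \<open>Correctness of the arithmetic and of the list operations\<close>

fun bval :: "bin \<Rightarrow> nat" where
  "bval BZ = 0"
| "bval (B0 x) = 2 * bval x"
| "bval (B1 x) = 2 * bval x + 1"

lemma bval_binc [simp]: "bval (binc x) = bval x + 1"
  by (induction x) auto

lemma bval_badd_baddc: "bval (badd x y) = bval x + bval y" "bval (baddc x y) = bval x + bval y + 1"
  by (induction x y and x y rule: badd_baddc.induct) auto

lemma blt_iff: "blt c x y \<longleftrightarrow> bval x < bval y \<or> bval x = bval y \<and> c"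
proof (induction c x y rule: blt.induct)
  case (7 c x y)
  then show ?case by (simp add: less_Suc_eq_le) linarith
next
  case (8 c x y)
  then show ?case by simp linarith
qed auto

lemma bval_bdec: "0 < bval x \<Longrightarrow> bval (bdec x) = bval x - 1"
  by (induction x) auto

lemma bval_bsub_bsubb:
  "bval y \<le> bval x \<Longrightarrow> bval (bsub x y) = bval x - bval y"
  "bval y < bval x \<Longrightarrow> bval (bsubb x y) = bval x - bval y - 1"
  by (induction x y and x y rule: bsub_bsubb.induct) (auto simp: bval_bdec)

lemma bval_bmul [simp]: "bval (bmul x y) = bval x * bval y"
  by (induction x y rule: bmul.induct) (auto simp: bval_badd_baddc algebra_simps)

lemma droplist_eq: "droplist xs ys = drop (length xs) ys"
  by (induction xs ys rule: droplist.induct) auto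

lemma takelist_eq: "takelist xs ys = take (length xs) ys"
  by (induction xs ys rule: takelist.induct) auto

lemma app_eq: "app xs ys = xs @ ys"
  by (induction xs ys rule: app.induct) auto

lemma revapp_eq: "revapp xs ys = rev xs @ ys"
  by (induction xs ys rule: revapp.induct) auto

fun lag :: "nat list \<Rightarrow> nat list \<Rightarrow> nat list" where
  "lag h [] = []"
| "lag [] (x # xs) = []"
| "lag (p # h) (x # xs) = (p + x) # lag (h @ [p + x]) xs"

lemma lag_Nil [simp]: "lag [] xs = []"
  by (cases xs) auto

lemma lagsum_eq:
  "map bval (lagsum fr bk xs) = lag (map bval (fr @ rev bk)) (map bval xs)"
  "map bval (lagsum1 s fr bk xs) = bval s # lag (map bval (fr @ rev bk @ [s])) (map bval xs)"
  "map bval (lagsum2 fr xs) = lag (map bval fr) (map bval xs)"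
  by (induction fr bk xs and s fr bk xs and fr xs rule: lagsum_lagsum1_lagsum2.induct)
    (auto simp: revapp_eq bval_badd_baddc)

lemma length_lag: "h \<noteq> [] \<Longrightarrow> length (lag h xs) = length xs"
  by (induction h xs rule: lag.induct) auto

lemma lag_append:
  "lag h (xs @ ys) = lag h xs @ lag (drop (length (lag h xs)) (h @ lag h xs)) ys"
  by (induction h xs rule: lag.induct) auto

lemma lag_nth:
  "i < length xs \<Longrightarrow> h \<noteq> [] \<Longrightarrow> lag h xs ! i = (h @ lag h xs) ! i + xs ! i"
proof (induction h xs arbitrary: i rule: lag.induct)
  case (3 p h x xs)
  then show ?case by (cases i) auto
qed auto

lemma concat_lagsums:
  "map bval (concat (lagsums fr cs)) = lag (map bval fr) (map bval (concat cs))"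
  "map bval (concat (lagsums1 fr s cs)) =
     map bval s @ lag (map bval (drop (length s) (fr @ s))) (map bval (concat cs))"
proof (induction fr cs and fr s cs rule: lagsums_lagsums1.induct)
  case (2 fr c cs)
  have 1: "map bval (lagsum fr [] c) = lag (map bval fr) (map bval c)"
    by (simp add: lagsum_eq)
  show ?case using 2
    by (simp add: lag_append 1[symmetric] drop_map)
qed (auto simp: droplist_eq app_eq)

lemma concat_shifts:
  "concat (shifts w h cs) = h @ concat cs"
  "concat (shifts1 w l cs) = l @ concat cs"
proof (induction w h cs and w l cs rule: shifts_shifts1.induct)
  case (4 w l cs)
  then show ?case by (simp add: takelist_eq droplist_eq flip: append_assoc)
qed (auto simp: app_eq)

section \<open>Partitions by number of parts, and the recurrence behind the table\<close>

text \<open>\<open>parts_fps m\<close> generates the partitions into exactly \<open>m\<close> distinct parts; \<open>tail_fps K k\<close> is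
  \<open>(\<Sum>m=k-1..K. parts_fps m) / parts_fps (k-1)\<close>, obtained by Horner's scheme.\<close>

fun parts_fps :: "nat \<Rightarrow> real fps" where
  "parts_fps 0 = 1"
| "parts_fps (Suc m) = parts_fps m * fps_X ^ Suc m * inverse (1 - fps_X ^ Suc m)"

fun tail_fps :: "nat \<Rightarrow> nat \<Rightarrow> real fps" where
  "tail_fps K 0 = 1"
| "tail_fps K (Suc j) = 1 + fps_X ^ (K - j) * (tail_fps K j * inverse (1 - fps_X ^ (K - j)))"

lemma sum_parts_fps:
  "j \<le> K \<Longrightarrow> (\<Sum>m=K-j..K. parts_fps m) = parts_fps (K - j) * tail_fps K j"
proof (induction j)
  case (Suc j)
  then obtain m where m: "K - j = Suc m" "K - Suc j = m"
    by (metis Suc_diff_Suc Suc_le_lessD)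
  have "{m..K} = insert m {Suc m..K}" using m by auto
  then have "(\<Sum>m=m..K. parts_fps m) = parts_fps m + (\<Sum>m=Suc m..K. parts_fps m)"
    by simp
  also have "\<dots> = parts_fps m + parts_fps (Suc m) * tail_fps K j"
    using Suc m by simp
  also have "\<dots> = parts_fps m * tail_fps K (Suc j)"
    by (simp only: tail_fps.simps parts_fps.simps m(1)) (simp only: algebra_simps mult_1_right mult_1_left)
  finally show ?case unfolding m(2) .
qed simp

lemma fps_nth_div_one_minus_X_power:
  fixes f :: "real fps"
  assumes "0 < k"
  defines "g \<equiv> f * inverse (1 - fps_X ^ k)"
  shows "g $ i = f $ i + (if i < k then 0 else g $ (i - k))"
proof -
  have "(1 - fps_X ^ k :: real fps) $ 0 \<noteq> 0" using assms(1) by simp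
  then have "g * (1 - fps_X ^ k) = f"
    unfolding g_def by (simp add: inverse_mult_eq_1 mult.assoc)
  then have "g = f + g * fps_X ^ k" by (simp add: algebra_simps)
  then have "g $ i = (f + g * fps_X ^ k) $ i" by (rule arg_cong)
  also have "\<dots> = f $ i + (if i < k then 0 else g $ (i - k))"
    by (simp add: fps_X_power_mult_right_nth)
  finally show ?thesis .
qed

lemma lag_fps_nth:
  assumes "0 < k" "\<And>i. i < length xs \<Longrightarrow> real (xs ! i) = f $ i" "i < length xs"
  shows "real (lag (replicate k 0) xs ! i) = (f * inverse (1 - fps_X ^ k)) $ i"
  using assms(3)
proof (induction i rule: less_induct)
  case (less i)
  let ?l = "lag (replicate k 0) xs"
  have ne: "replicate k 0 \<noteq> ([] :: nat list)" using assms(1) by auto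
  have l: "length ?l = length xs" by (simp add: length_lag[OF ne])
  have "real (?l ! i) = real ((replicate k 0 @ ?l) ! i) + f $ i"
    using lag_nth[OF less.prems ne] assms(2)[OF less.prems] by simp
  also have "real ((replicate k 0 @ ?l) ! i) =
      (if i < k then 0 else (f * inverse (1 - fps_X ^ k)) $ (i - k))"
    using less assms(1) by (auto simp: nth_append)
  finally show ?case using fps_nth_div_one_minus_X_power[OF assms(1), of f i] by simp
qed

text \<open>Invariant of the Horner scheme: with \<open>length zs\<close> steps to go, the table
  holds an initial segment of \<open>tail_fps K j\<close>. A step multiplies by a power of X, so the
  segment that is known to be correct grows by that power.\<close>

lemma rows_eq:
  assumes "set zs \<subseteq> {BZ}" "j + length zs = K"
    "\<And>i. i < length (concat cs) \<Longrightarrow> real (bval (concat cs ! i)) = tail_fps K j $ i"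
    "i < length (concat (rows w zs cs))"
  shows "real (bval (concat (rows w zs cs) ! i)) = tail_fps K K $ i"
  using assms
proof (induction w zs cs arbitrary: j rule: rows.induct)
  case (2 w z zs cs)
  define k where "k = length (z # zs)"
  have k: "K - j = k" "0 < k" "length zs = k - 1" using 2(3) by (auto simp: k_def)
  have z: "map bval (z # zs) = replicate k 0"
  proof (rule replicate_eqI)
    show "length (map bval (z # zs)) = k" by (simp add: k_def)
    show "y = 0" if "y \<in> set (map bval (z # zs))" for y using that 2(2) by auto
  qed
  define xs where "xs = map bval (concat cs)"
  define ls where "ls = lag (replicate k 0) xs"
  have "length ls = length xs" unfolding ls_def using k(2) by (intro length_lag) auto
  then have len: "length ls = length (concat cs)" by (simp add: xs_def)
  have ls: "map bval (concat (lagsums (z # zs) cs)) = ls"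
    unfolding ls_def xs_def concat_lagsums z ..
  have lsn: "real (ls ! i) = (tail_fps K j * inverse (1 - fps_X ^ k)) $ i" if "i < length ls" for i
    unfolding ls_def using that len 2(4) k(2)
    by (intro lag_fps_nth) (auto simp: xs_def ls_def)
  have c: "map bval (concat (shifts w (B1 BZ # zs) (lagsums (z # zs) cs))) = (1 # replicate (k - 1) 0) @ ls"
  proof -
    have "map bval zs = replicate (k - 1) 0" using z k(2) by (cases k) auto
    then show ?thesis using ls by (simp add: concat_shifts)
  qed
  show ?case unfolding rows.simps
  proof (rule 2(1)[of "Suc j"])
    show "set zs \<subseteq> {BZ}" "Suc j + length zs = K" using 2 by auto
    show "i < length (concat (rows w zs (shifts w (B1 BZ # zs) (lagsums (z # zs) cs))))"
      using 2(5) by simp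
    fix i assume i: "i < length (concat (shifts w (B1 BZ # zs) (lagsums (z # zs) cs)))"
    have il: "i < k + length ls" using arg_cong[OF c, of length] i k(2) by simp
    have "bval (concat (shifts w (B1 BZ # zs) (lagsums (z # zs) cs)) ! i) = ((1 # replicate (k - 1) 0) @ ls) ! i"
      using nth_map[OF i, of bval] unfolding c by simp
    also have "real \<dots> = tail_fps K (Suc j) $ i"
      using il lsn[of "i - k"] k(2)
      by (auto simp: nth_append fps_X_power_mult_nth nth_Cons' k(1))
    finally show "real (bval (concat (shifts w (B1 BZ # zs) (lagsums (z # zs) cs)) ! i)) = tail_fps K (Suc j) $ i" .
  qed
qed auto

definition parts :: "nat \<Rightarrow> nat \<Rightarrow> nat set set" where
  "parts m n = {S. finite S \<and> 0 \<notin> S \<and> \<Sum>S = n \<and> card S = m}"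

lemma finite_parts: "finite (parts m n)"
  by (rule finite_subset[OF _ finite_distinct_partitions[of n]]) (auto simp: parts_def distinct_partitions_def)

lemma card_parts_0: "card (parts 0 n) = (if n = 0 then 1 else 0)"
proof -
  have "parts 0 n = (if n = 0 then {{}} else {})" by (auto simp: parts_def)
  then show ?thesis by simp
qed

lemma sum_Suc_image: "finite T \<Longrightarrow> \<Sum>(Suc ` T) = \<Sum>T + card T"
  by (subst sum.reindex) (auto simp: sum.distrib sum_Suc)

text \<open>Lower every part by 1. The result either still consists of positive numbers or contains
  0, whose removal leaves a partition with one part fewer.\<close>

lemma card_parts_Suc:
  "card (parts (Suc m) n) =
    (if n < Suc m then 0 else card (parts (Suc m) (n - Suc m)) + card (parts m (n - Suc m)))"
proof -
  define U where "U = {T. finite T \<and> \<Sum>T + Suc m = n \<and> card T = Suc m}"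
  have "bij_betw ((`) Suc) U (parts (Suc m) n)"
    unfolding bij_betw_def
  proof
    show "inj_on ((`) Suc) U" by (auto simp: inj_on_def inj_image_eq_iff)
    show "(`) Suc ` U = parts (Suc m) n"
    proof (intro equalityI subsetI)
      fix S assume "S \<in> (`) Suc ` U"
      then show "S \<in> parts (Suc m) n"
        by (auto simp: U_def parts_def sum_Suc_image card_image)
    next
      fix S assume S: "S \<in> parts (Suc m) n"
      define T where "T = (\<lambda>x. x - 1) ` S"
      have ST: "S = Suc ` T"
      proof -
        have "Suc (x - 1) = x" if "x \<in> S" for x using that S by (cases x) (auto simp: parts_def)
        then show ?thesis by (simp add: T_def image_image cong: image_cong)
      qed
      have "finite T" using S by (simp add: T_def parts_def)
      then have "T \<in> U" using S unfolding ST by (auto simp: U_def parts_def sum_Suc_image card_image)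
      then show "S \<in> (`) Suc ` U" using ST by blast
    qed
  qed
  then have c: "card (parts (Suc m) n) = card U" by (simp add: bij_betw_same_card)
  show ?thesis
  proof (cases "n < Suc m")
    case True
    then have "U = {}" by (auto simp: U_def)
    then show ?thesis using c True by simp
  next
    case False
    have U: "U = parts (Suc m) (n - Suc m) \<union> insert 0 ` parts m (n - Suc m)"
    proof (intro equalityI subsetI)
      fix T assume T: "T \<in> U"
      show "T \<in> parts (Suc m) (n - Suc m) \<union> insert 0 ` parts m (n - Suc m)"
      proof (cases "0 \<in> T")
        case True
        have "\<Sum>(T - {0}) = \<Sum>T" by (rule sum.mono_neutral_left) (use T in \<open>auto simp: U_def\<close>)
        then have "T - {0} \<in> parts m (n - Suc m)" "insert 0 (T - {0}) = T"
          using T True by (auto simp: U_def parts_def)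
        then show ?thesis by (metis UnI2 imageI)
      qed (use T in \<open>auto simp: U_def parts_def\<close>)
    qed (use False in \<open>auto simp: U_def parts_def\<close>)
    have "inj_on (insert 0) (parts m (n - Suc m))"
      by (intro inj_onI) (auto simp: parts_def insert_ident)
    moreover have "parts (Suc m) (n - Suc m) \<inter> insert 0 ` parts m (n - Suc m) = {}"
      by (auto simp: parts_def)
    ultimately have "card U = card (parts (Suc m) (n - Suc m)) + card (parts m (n - Suc m))"
      unfolding U using finite_parts by (simp add: card_Un_disjoint card_image)
    then show ?thesis using c False by simp
  qed
qed

lemma fps_nth_parts_fps: "parts_fps m $ n = real (card (parts m n))"
proof (induction m arbitrary: n)
  case 0
  then show ?case by (simp add: card_parts_0)
next
  case (Suc m)
  show ?case
  proof (induction n rule: less_induct)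
    case (less n)
    have e: "parts_fps (Suc m) = (parts_fps m * fps_X ^ Suc m) * inverse (1 - fps_X ^ Suc m)"
      by (simp add: mult.assoc)
    show ?case
      using fps_nth_div_one_minus_X_power[of "Suc m" "parts_fps m * fps_X ^ Suc m" n, folded e]
        less[of "n - Suc m"] Suc[of "n - Suc m"]
      by (auto simp: card_parts_Suc fps_X_power_mult_right_nth simp del: parts_fps.simps power_Suc)
  qed
qed

text \<open>The largest of \<open>m\<close> positive integers is at least \<open>m\<close>; remove
  it and induct. This bounds the number of distinct parts, so finitely many \<open>parts_fps\<close>
  suffice for a given \<open>n\<close>.\<close>

lemma card_le_Sum:
  assumes "finite S" "0 \<notin> S"
  shows "\<Sum>{..card S} \<le> \<Sum>S"
  using assms
proof (induction "card S" arbitrary: S)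
  case (Suc m)
  have ne: "S \<noteq> {}" using Suc(2) by auto
  have "card S \<le> Max S"
  proof -
    have "S \<subseteq> {1..Max S}"
    proof
      fix x assume "x \<in> S"
      then show "x \<in> {1..Max S}" using Suc(3,4) by (cases x) auto
    qed
    then show ?thesis by (metis card_atLeastAtMost card_mono diff_Suc_1 finite_atLeastAtMost)
  qed
  moreover have "\<Sum>{..m} \<le> \<Sum>(S - {Max S})"
  proof -
    have "Max S \<in> S" using Suc(3) ne by simp
    then have "card (S - {Max S}) = m" using Suc(2) by simp
    then show ?thesis using Suc(1)[of "S - {Max S}"] Suc(3,4) by auto
  qed
  moreover have "\<Sum>S = Max S + \<Sum>(S - {Max S})"
    using Suc(3) ne by (intro sum.remove) auto
  moreover have "\<Sum>{..card S} = card S + \<Sum>{..m}" by (simp flip: Suc(2))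
  ultimately show ?case by linarith
qed auto

lemma q_eq_sum_parts:
  assumes "n < \<Sum>{..Suc K}"
  shows "q n = (\<Sum>m=0..K. card (parts m n))"
proof -
  have "distinct_partitions n = (\<Union>m\<in>{0..K}. parts m n)"
  proof (intro equalityI subsetI)
    fix S assume S: "S \<in> distinct_partitions n"
    then have "\<Sum>{..card S} \<le> n" using card_le_Sum[of S] by (auto simp: distinct_partitions_def)
    moreover have "\<Sum>{..Suc K} \<le> \<Sum>{..card S}" if "Suc K \<le> card S"
      using that by (intro sum_mono2) auto
    ultimately have "\<not> Suc K \<le> card S"
      using assms by linarith
    then show "S \<in> (\<Union>m\<in>{0..K}. parts m n)"
      using S by (auto simp: distinct_partitions_def parts_def)
  qed (auto simp: distinct_partitions_def parts_def)
  then show ?thesis unfolding q_def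
    by (simp only:) (rule card_UN_disjoint, auto simp: finite_parts, auto simp: parts_def)
qed

lemma q_eq_tail_fps:
  assumes "n < \<Sum>{..Suc K}"
  shows "real (q n) = tail_fps K K $ n"
proof -
  have "(\<Sum>m=0..K. parts_fps m) = tail_fps K K" using sum_parts_fps[of K K] by simp
  then have "tail_fps K K $ n = (\<Sum>m=0..K. parts_fps m $ n)" by (metis fps_sum_nth)
  then show ?thesis by (simp add: fps_nth_parts_fps q_eq_sum_parts[OF assms])
qed

unbundle no fps_syntax

text \<open>Each step doubles \<open>z * d + r\<close> and keeps \<open>r < d\<close>.\<close>

lemma bquot_bounds:
  assumes "bval r < bval d"
  shows "bval (bquot us r d z) * bval d \<le> 2 ^ length us * (bval z * bval d + bval r) \<and>
    2 ^ length us * (bval z * bval d + bval r) < (bval (bquot us r d z) + 1) * bval d"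
  using assms
proof (induction us arbitrary: r z)
  case (Cons u us)
  obtain r' z' where e: "bquot (u # us) r d z = bquot us r' d z'" "bval r' < bval d"
    "bval z' * bval d + bval r' = 2 * (bval z * bval d + bval r)"
  proof (cases "blt False (B0 r) d")
    case True
    then show ?thesis using that[of "B0 r" "B0 z"] by (simp add: blt_iff)
  next
    case False
    then show ?thesis using that[of "bsub (B0 r) d" "B1 z"] Cons.prems
      by (simp add: blt_iff bval_bsub_bsubb)
  qed
  have eq: "2 ^ length (u # us) * (bval z * bval d + bval r) = 2 ^ length us * (bval z' * bval d + bval r')"
    unfolding e(3) by simp
  show ?case using Cons.IH[OF e(2), of z'] unfolding e(1) eq .
qed auto

lemma bval_bdist: "real (bval (bdist x y)) = \<bar>real (bval x) - real (bval y)\<bar>"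
  by (auto simp: blt_iff bval_bsub_bsubb)

section \<open>The inequalities in terms of ratios, and soundness of the tests\<close>

lemma log_concave_of_ratios:
  fixes a b c :: real
  assumes "a > 0" "b > 0" "c / b \<le> b / a"
  shows "a * c \<le> b\<^sup>2"
  using assms by (simp add: divide_simps power2_eq_square mult.commute)

text \<open>Each bracket of the inequality is a monomial times \<open>e\<close>, \<open>f\<close> or
  \<open>e + f\<close>. Substituting \<open>b / a = c / b + e\<close> makes the difference of the
  two sides \<open>a^2 * b * c\<close> times that of the last hypothesis.\<close>

lemma turan_of_ratios:
  fixes a b c d :: real
  assumes pos: "a > 0" "b > 0" "c > 0"
  defines "e \<equiv> b / a - c / b" and "f \<equiv> c / b - d / c"
  assumes "c / b * (e - f)\<^sup>2 \<le> 4 * e\<^sup>2 * f"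
  shows "(b * c - a * d)\<^sup>2 \<le> 4 * (b\<^sup>2 - a * c) * (c\<^sup>2 - b * d)"
proof -
  have "b\<^sup>2 - a * c = a * b * e" "c\<^sup>2 - b * d = b * c * f" "b * c - a * d = a * c * (e + f)"
    using pos by (simp_all add: e_def f_def field_simps power2_eq_square)
  then have "4 * (b\<^sup>2 - a * c) * (c\<^sup>2 - b * d) - (b * c - a * d)\<^sup>2
      = 4 * (a * b * e) * (b * c * f) - (a * c * (e + f))\<^sup>2" by simp
  also have "\<dots> = a\<^sup>2 * b * c * (4 * e * f * (b / a) - c / b * (e + f)\<^sup>2)"
    using pos by (simp add: field_simps power2_eq_square)
  also have "b / a = c / b + e" by (simp add: e_def)
  also have "4 * e * f * (c / b + e) - c / b * (e + f)\<^sup>2 = 4 * e\<^sup>2 * f - c / b * (e - f)\<^sup>2"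
    by algebra
  also have "a\<^sup>2 * b * c * \<dots> \<ge> 0" using assms by simp
  finally show ?thesis by simp
qed

definition turan_at :: "real \<Rightarrow> real \<Rightarrow> real \<Rightarrow> real \<Rightarrow> bool" where
  "turan_at a b c d \<longleftrightarrow> a * c \<le> b\<^sup>2 \<and> (b * c - a * d)\<^sup>2 \<le> 4 * (b\<^sup>2 - a * c) * (c\<^sup>2 - b * d)"

text \<open>\<open>z\<close> is the integer part of \<open>2 ^ p * y / x\<close>, written without
  division. The strict half forces \<open>x\<close> to be positive.\<close>

definition approx_ratio :: "nat \<Rightarrow> bin \<Rightarrow> bin \<Rightarrow> bin \<Rightarrow> bool" where
  "approx_ratio p z x y \<longleftrightarrow> bval z * bval x \<le> 2 ^ p * bval y \<and> 2 ^ p * bval y < (bval z + 1) * bval x"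

lemma approx_ratio_real:
  assumes "approx_ratio p z x y" 
  shows "real (bval x) > 0" "real (bval z) \<le> 2 ^ p * (bval y / bval x)"
    "2 ^ p * (bval y / bval x) < real (bval z) + 1"
proof -
  show x: "real (bval x) > 0" using assms by (cases "bval x") (auto simp: approx_ratio_def)
  have "real (bval z * bval x) \<le> real (2 ^ p * bval y)" "real (2 ^ p * bval y) < real ((bval z + 1) * bval x)"
    using assms unfolding approx_ratio_def of_nat_le_iff of_nat_less_iff by auto
  then show "real (bval z) \<le> 2 ^ p * (bval y / bval x)"
    "2 ^ p * (bval y / bval x) < real (bval z) + 1"
    using x by (simp_all add: field_simps)
qed

text \<open>With \<open>s = 2 ^ p\<close>, the integer differences \<open>E\<close> and
  \<open>F\<close> are within 1 of \<open>s * e\<close> and \<open>s * f\<close>. Hence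
  \<open>E - 1\<close>, \<open>F - 1\<close>, \<open>abs (E - F) + 2\<close> and
  \<open>z1 + 1\<close> err on the safe side; both sides of the tested inequality carry the factor
  \<open>s ^ 3\<close>.\<close>

lemma turan_chk_sound:
  assumes z: "approx_ratio p z0 a b" "approx_ratio p z1 b c" "approx_ratio p z2 c d"
    and chk: "turan_chk z0 z1 z2"
  shows "turan_at (bval a) (bval b) (bval c) (bval d)"
proof -
  note z0 = approx_ratio_real[OF z(1)]
  note z1 = approx_ratio_real[OF z(2)]
  note z2 = approx_ratio_real[OF z(3)]
  define e where "e = real (bval b) / bval a - bval c / bval b"
  define f where "f = real (bval c) / bval b - bval d / bval c"
  define E where "E = real (bval z0) - real (bval z1)"
  define F where "F = real (bval z1) - real (bval z2)"
  have lt: "bval z1 < bval z0" "bval z2 < bval z1" and chk1: "turan_chk1 z1 (bsub z0 z1) (bsub z1 z2)"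
    using chk by (auto simp: blt_iff split: if_splits)
  have EF: "E \<ge> 1" "F \<ge> 1" using lt by (simp_all add: E_def F_def)
  have v: "real (bval (bsub z0 z1)) = E" "real (bval (bsub z1 z2)) = F"
    using lt by (simp_all add: E_def F_def bval_bsub_bsubb)
  have v1: "real (bval (bdec (bsub z0 z1))) = E - 1" "real (bval (bdec (bsub z1 z2))) = F - 1"
    using lt by (simp_all add: bval_bdec bval_bsub_bsubb E_def F_def)
  let ?D = "bdist (bsub z0 z1) (bsub z1 z2)"
  have "real (bval (bmul (binc z1) (bmul (binc (binc ?D)) (binc (binc ?D)))))
    \<le> real (bval (B0 (B0 (bmul (bmul (bdec (bsub z0 z1)) (bdec (bsub z0 z1))) (bdec (bsub z1 z2))))))"
    using chk1 unfolding turan_chk1.simps blt_iff of_nat_le_iff by linarith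
  moreover have "real (bval (bmul (binc z1) (bmul (binc (binc ?D)) (binc (binc ?D)))))
    = (real (bval z1) + 1) * (\<bar>E - F\<bar> + 2)\<^sup>2"
    using bval_bdist[of "bsub z0 z1" "bsub z1 z2"] unfolding v
    by (simp add: power2_eq_square algebra_simps del: bdist.simps)
  moreover have "real (bval (B0 (B0 (bmul (bmul (bdec (bsub z0 z1)) (bdec (bsub z0 z1))) (bdec (bsub z1 z2))))))
    = 4 * ((E - 1)\<^sup>2 * (F - 1))"
    unfolding bval.simps bval_bmul of_nat_mult v1 power2_eq_square by simp
  ultimately have ineq: "(real (bval z1) + 1) * (\<bar>E - F\<bar> + 2)\<^sup>2 \<le> 4 * ((E - 1)\<^sup>2 * (F - 1))"
    by linarith
  define s :: real where "s = 2 ^ p"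
  have s: "s > 0" by (simp add: s_def)
  have se: "E - 1 \<le> s * e" "s * e \<le> E + 1" and sf: "F - 1 \<le> s * f" "s * f \<le> F + 1"
    using z0 z1 z2 by (simp_all add: e_def f_def E_def F_def s_def algebra_simps)
  define r where "r = real (bval c) / bval b"
  have r: "s * r \<le> real (bval z1) + 1" using z1 by (simp add: r_def s_def)
  have "(s * (e - f))\<^sup>2 = \<bar>s * e - s * f\<bar>\<^sup>2" by (simp add: right_diff_distrib)
  also have "\<dots> \<le> (\<bar>E - F\<bar> + 2)\<^sup>2"
    using se sf by (intro power_mono) auto
  finally have "(s * r) * (s * (e - f))\<^sup>2 \<le> (real (bval z1) + 1) * (\<bar>E - F\<bar> + 2)\<^sup>2"
    using r by (intro mult_mono) auto
  also have "\<dots> \<le> 4 * ((E - 1)\<^sup>2 * (F - 1))" by (fact ineq)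
  also have "\<dots> \<le> 4 * ((s * e)\<^sup>2 * (s * f))"
    using se sf EF by (intro mult_left_mono mult_mono power_mono) auto
  finally have "s ^ 3 * (r * (e - f)\<^sup>2) \<le> s ^ 3 * (4 * e\<^sup>2 * f)"
    by (simp add: power_mult_distrib power3_eq_cube power2_eq_square algebra_simps)
  then have "r * (e - f)\<^sup>2 \<le> 4 * e\<^sup>2 * f" using s by simp
  moreover have "e \<ge> 0" using se EF s by (smt (verit) mult_pos_neg)
  ultimately show ?thesis
    using z0(1) z1(1) z2(1) log_concave_of_ratios[of a b c for a b c :: real]
      turan_of_ratios[of "bval a" "bval b" "bval c" "bval d"]
    by (auto simp: turan_at_def r_def e_def f_def)
qed

lemma turan_run_append: "turan_run us s (xs @ ys) = turan_run us (turan_run us s xs) ys"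
  by (induction us s xs rule: turan_run.induct) auto

lemma turan_runs_concat: "turan_runs us s cs = turan_run us s (concat cs)"
  by (induction us s cs rule: turan_runs.induct) (auto simp: turan_run_append)

fun state_ok :: "state \<Rightarrow> bool" where
  "state_ok (State ok x r0 r1) = ok"

lemma turan_run_not_ok: "\<not> state_ok s \<Longrightarrow> \<not> state_ok (turan_run us s ys)"
  by (induction us s ys rule: turan_run.induct) auto

lemma approx_ratio_bquot:
  assumes "\<not> blt False y x" "blt False y (B0 x)"
  shows "approx_ratio (length us) (bquot us (bsub y x) x (B1 BZ)) x y"
proof -
  have "bval (bsub y x) = bval y - bval x" "bval x \<le> bval y" "bval y < 2 * bval x"
    using assms by (auto simp: blt_iff bval_bsub_bsubb)
  then show ?thesis
    using bquot_bounds[of "bsub y x" x us "B1 BZ"] by (simp add: approx_ratio_def)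
qed

lemma turan_run_sound:
  assumes "state_ok (turan_run us (State ok x r0 r1) ys)"
    "approx_ratio (length us) r0 w0 w1" "approx_ratio (length us) r1 w1 x"
    "i < length ys"
  defines "zs \<equiv> map bval (w0 # w1 # x # ys)"
  shows "turan_at (zs ! i) (zs ! (i + 1)) (zs ! (i + 2)) (zs ! (i + 3))"
  using assms(1-4) unfolding zs_def
proof (induction ys arbitrary: w0 w1 x r0 r1 ok i)
  case (Cons y ys)
  let ?r = "bquot us (bsub y x) x (B1 BZ)"
  have run: "state_ok (turan_run us (turan_step us ok x y r0 r1 ?r) ys)"
    using Cons.prems(1) by (simp only: turan_run.simps)
  then have "state_ok (turan_step us ok x y r0 r1 ?r)"
    using turan_run_not_ok by blast
  then have ok: "\<not> blt False y x" "blt False y (B0 x)" "turan_chk r0 r1 ?r"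
    by (auto simp del: turan_chk.simps split: if_splits)
  note r2 = approx_ratio_bquot[OF ok(1,2), of us]
  show ?case
  proof (cases i)
    case 0
    then show ?thesis using turan_chk_sound[OF Cons.prems(2,3) r2 ok(3)] by simp
  next
    case (Suc j)
    then show ?thesis
      using Cons.IH[OF run[unfolded turan_step.simps] Cons.prems(3) r2, of j] Cons.prems(4)
      by (simp add: numeral_eq_Suc)
  qed
qed simp

fun turan_from :: "'a list \<Rightarrow> bin list \<Rightarrow> bin list list \<Rightarrow> bool" where
  "turan_from us (w0 # w1 # x # ys) cs = (if blt False w1 w0 then False else
     if blt False w1 (B0 w0) then if blt False x w1 then False else
     if blt False x (B0 w1) then
       state_ok (turan_runs us (turan_run us (State True x (bquot us (bsub w1 w0) w0 (B1 BZ))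
         (bquot us (bsub x w1) w1 (B1 BZ))) ys) cs) else False else False)"
| "turan_from us _ cs = False"

lemma turan_from_sound:
  assumes "turan_from us c cs" "i + 3 < length (c @ concat cs)"
  defines "zs \<equiv> map bval (c @ concat cs)"
  shows "turan_at (zs ! i) (zs ! (i + 1)) (zs ! (i + 2)) (zs ! (i + 3))"
proof -
  from assms(1) obtain w0 w1 x ys where c: "c = w0 # w1 # x # ys"
    by (cases "(us, c, cs)" rule: turan_from.cases) auto
  have ok: "\<not> blt False w1 w0" "blt False w1 (B0 w0)" "\<not> blt False x w1" "blt False x (B0 w1)"
    and run: "state_ok (turan_run us (State True x (bquot us (bsub w1 w0) w0 (B1 BZ))
         (bquot us (bsub x w1) w1 (B1 BZ))) (ys @ concat cs))"
    using assms(1) unfolding c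
    by (auto simp: turan_runs_concat turan_run_append split: if_splits)
  show ?thesis
    using turan_run_sound[OF run approx_ratio_bquot[OF ok(1,2)] approx_ratio_bquot[OF ok(3,4)], of i]
      assms(2) unfolding zs_def c by simp
qed

text \<open>Near the beginning of the range exact products are compared: the rounded test always
  proves both inequalities together, while for n from 33 to 120 only log-concavity is
  claimed.\<close>

fun concave_exact :: "bin list \<Rightarrow> bool" where
  "concave_exact (a # b # c # xs) =
     (if blt False (bmul b b) (bmul a c) then False else concave_exact (b # c # xs))"
| "concave_exact _ = True"

fun turan_exact :: "bin list \<Rightarrow> bool" where
  "turan_exact (a # b # c # d # xs) =
     (if blt False (bmul b b) (bmul a c) then False else if blt False (bmul c c) (bmul b d) then False else
      if blt False (B0 (B0 (bmul (bsub (bmul b b) (bmul a c)) (bsub (bmul c c) (bmul b d)))))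
        (bmul (bdist (bmul b c) (bmul a d)) (bdist (bmul b c) (bmul a d)))
      then False else turan_exact (b # c # d # xs))"
| "turan_exact _ = True"

lemma concave_exact_sound:
  assumes "concave_exact xs" "i + 2 < length xs"
  shows "bval (xs ! i) * bval (xs ! (i + 2)) \<le> (bval (xs ! (i + 1)))\<^sup>2"
  using assms
proof (induction xs arbitrary: i rule: concave_exact.induct)
  case (1 a b c xs)
  then show ?case
    by (cases i) (auto simp: blt_iff power2_eq_square split: if_splits)
qed auto

lemma turan_exact_sound:
  assumes "turan_exact xs" "i + 3 < length xs"
  shows "turan_at (bval (xs ! i)) (bval (xs ! (i + 1))) (bval (xs ! (i + 2))) (bval (xs ! (i + 3)))"
  using assms
proof (induction xs arbitrary: i rule: turan_exact.induct)
  case (1 a b c d xs)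
  show ?case
  proof (cases i)
    case 0
    have *: "bval a * bval c \<le> bval b * bval b" "bval b * bval d \<le> bval c * bval c"
      "bval (bmul (bdist (bmul b c) (bmul a d)) (bdist (bmul b c) (bmul a d))) \<le>
        4 * ((bval b * bval b - bval a * bval c) * (bval c * bval c - bval b * bval d))"
      using 1(2) by (auto simp: blt_iff bval_bsub_bsubb simp del: bdist.simps split: if_splits)
    have **: "(real (bval (bdist (bmul b c) (bmul a d))))\<^sup>2 \<le>
        4 * ((real (bval b) * bval b - real (bval a) * bval c) * (real (bval c) * bval c - real (bval b) * bval d))"
      using *(3)[unfolded bval_bmul, folded of_nat_le_iff[where 'a = real]] *(1,2)
      by (simp add: of_nat_diff power2_eq_square del: bdist.simps)
    have "real (bval a) * bval c \<le> real (bval b) * bval b"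
      using *(1) by (metis of_nat_le_iff of_nat_mult)
    then show ?thesis using ** 0 unfolding bval_bdist
      by (simp add: turan_at_def power2_eq_square numeral_eq_Suc algebra_simps)
  next
    case (Suc j)
    then show ?thesis using 1(1)[of j] 1(2,3) by (auto simp: numeral_eq_Suc split: if_splits)
  qed
qed auto

lemma length_concat_rows:
  "length (concat (rows w zs cs)) = length (concat cs) + \<Sum>{..length zs}"
proof (induction w zs cs rule: rows.induct)
  case (2 w z zs cs)
  have "length (map bval (concat (lagsums (z # zs) cs))) = length (concat cs)"
    unfolding concat_lagsums by (simp add: length_lag)
  then show ?case using 2 by (simp add: concat_shifts)
qed simp

section \<open>The table of q up to 2003 and its verification\<close>

fun unary :: "nat \<Rightarrow> unit list" where
  "unary 0 = []"
| "unary (Suc n) = () # unary n"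

lemma length_unary [simp]: "length (unary n) = n"
  by (induction n) auto

fun zeros :: "nat \<Rightarrow> bin list" where
  "zeros 0 = []"
| "zeros (Suc n) = BZ # zeros n"

lemma zeros_eq: "zeros n = replicate n BZ"
  by (induction n) auto

text \<open>A partition of \<open>n < 2016 = 1 + ... + 63\<close> into distinct parts has at most 62 parts.\<close>

definition q_table :: "bin list list" where
  "q_table = rows (unary 64) (zeros 62) [B1 BZ # zeros 50]"

text \<open>The computation starts from 51 coefficients of the constant series 1, and the step with
  lag \<open>k\<close> adds \<open>k\<close> entries: \<open>51 + (1 + ... + 62) = 2004\<close>.
  This just reaches \<open>q (n + 2)\<close> for \<open>n = 2001\<close>.\<close>

lemma q_table:
  shows "length (concat q_table) = 2004" 
    and "i < 2004 \<Longrightarrow> bval (concat q_table ! i) = q i"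
proof -
  have gauss: "\<Sum>{..n} = n * (n + 1) div 2" for n :: nat by (induction n) auto
  show l: "length (concat q_table) = 2004"
    by (simp add: q_table_def length_concat_rows zeros_eq gauss)
  assume i: "i < 2004"
  have "real (q i) = fps_nth (tail_fps 62 62) i"
    using i gauss[of "Suc 62"] by (intro q_eq_tail_fps) simp
  moreover have "real (bval (concat q_table ! i)) = fps_nth (tail_fps 62 62) i"
    unfolding q_table_def
    by (rule rows_eq[where j = 0])
      (use i l in \<open>auto simp: zeros_eq nth_Cons' q_table_def\<close>)
  ultimately show "bval (concat q_table ! i) = q i" by simp
qed

text \<open>Dropping \<open>k\<close> entries makes \<open>k + 1\<close> the first index n tested,
  so the three tests start at n = 33, 121 and 129. The exact ones end by index 137 and overlap with
  the rounded one, which works with 28 binary digits.\<close>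

fun table_ok :: "bin list list \<Rightarrow> bool"
and table_ok1 :: "bin list \<Rightarrow> bin list list \<Rightarrow> bool" where
  "table_ok (c # d # e # cs) = table_ok1 (app c (app d e)) cs"
| "table_ok _ = False"
| "table_ok1 l cs = (if concave_exact (droplist (unary 32) (takelist (unary 138) l))
     then if turan_exact (droplist (unary 120) (takelist (unary 138) l))
     then turan_from (unary 28) (droplist (unary 128) l) cs else False else False)"

lemma table_ok_sound:
  assumes "table_ok css" 
  shows "33 \<le> n \<Longrightarrow> n + 2 < length (concat css) \<Longrightarrow>
      bval (concat css ! (n - 1)) * bval (concat css ! (n + 1)) \<le> (bval (concat css ! n))\<^sup>2"
    and "121 \<le> n \<Longrightarrow> n + 2 < length (concat css) \<Longrightarrow>
      turan_at (bval (concat css ! (n - 1))) (bval (concat css ! n))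
        (bval (concat css ! (n + 1))) (bval (concat css ! (n + 2)))"
proof -
  from assms obtain c d e cs where css: "css = c # d # e # cs"
    by (cases css rule: table_ok.cases) auto
  define l where "l = c @ d @ e"
  have concat: "concat css = l @ concat cs" by (simp add: css l_def)
  have ok: "concave_exact (drop 32 (take 138 l))" "turan_exact (drop 120 (take 138 l))"
    and from_ok: "turan_from (unary 28) (drop 128 l) cs"
    using assms unfolding css by (auto simp: l_def app_eq droplist_eq takelist_eq split: if_splits)
  have "length (drop 128 l) \<ge> 3"
    using from_ok by (cases "(unary 28, drop 128 l, cs)" rule: turan_from.cases) (auto simp: Suc_le_eq)
  then have len: "131 \<le> length l" by simp
  have big: "turan_at (bval (concat css ! (n - 1))) (bval (concat css ! n))
        (bval (concat css ! (n + 1))) (bval (concat css ! (n + 2)))"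
    if "129 \<le> n" "n + 2 < length (concat css)" for n
  proof -
    obtain i where i: "n = 129 + i" using \<open>129 \<le> n\<close> le_Suc_ex by blast
    have d: "drop 128 l @ concat cs = drop 128 (concat css)" using len by (simp add: concat)
    have i3: "i + 3 < length (drop 128 l @ concat cs)" using that(2) unfolding d by (simp add: i)
    show ?thesis
      using turan_from_sound[OF from_ok i3] that(2) unfolding d by (simp add: i numeral_eq_Suc)
  qed
  show "bval (concat css ! (n - 1)) * bval (concat css ! (n + 1)) \<le> (bval (concat css ! n))\<^sup>2"
    if n: "33 \<le> n" "n + 2 < length (concat css)"
  proof (cases "129 \<le> n")
    case True
    have "real (bval (concat css ! (n - 1))) * real (bval (concat css ! (n + 1))) \<le> (real (bval (concat css ! n)))\<^sup>2"
      using big[OF True n(2)] by (simp add: turan_at_def)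
    then show ?thesis by (metis of_nat_le_iff of_nat_mult of_nat_power)
  next
    case False
    obtain i where i: "n = 33 + i" using n(1) le_Suc_ex by blast
    show ?thesis
      using concave_exact_sound[OF ok(1), of i] len False by (simp add: i concat nth_append)
  qed
  show "turan_at (bval (concat css ! (n - 1))) (bval (concat css ! n))
        (bval (concat css ! (n + 1))) (bval (concat css ! (n + 2)))"
    if n: "121 \<le> n" "n + 2 < length (concat css)"
  proof (cases "129 \<le> n")
    case False
    obtain i where i: "n = 121 + i" using n(1) le_Suc_ex by blast
    show ?thesis
      using turan_exact_sound[OF ok(2), of i] len False by (simp add: i concat nth_append)
  qed (use big n in blast)
qed

lemma table_ok_q_table: "table_ok q_table"
  by code_simp

theorem q_inequalities_small:
  assumes "n \<le> 2001"
  shows "33 \<le> n \<Longrightarrow> q (n - 1) * q (n + 1) \<le> (q n)\<^sup>2"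
    "121 \<le> n \<Longrightarrow> turan_at (q (n - 1)) (q n) (q (n + 1)) (q (n + 2))"
  using table_ok_sound[OF table_ok_q_table, of n] assms by (simp_all add: q_table)

section \<open>Turan inequalities for large arguments\<close>

text \<open>Here \<open>r\<close> stands for \<open>sqrt x\<close>, and \<open>r^6 = x^3\<close>
  collects the factor \<open>x^(3/4)\<close> from the size of M and \<open>x^(9/4)\<close> from the
  admissible error. The constant 188 is \<open>5 / 4\<close> divided by \<open>0.035 * 0.19\<close>,
  rounded up. Beyond \<open>r0\<close> the logarithm of the left side has slope at most
  \<open>6 / r0\<close>, well below that of the right side.\<close>

lemma exp_dominates_power6:
  fixes r b :: real
  assumes r: "447 / 10 \<le> r" and b: "9068 / 10000 \<le> b"
  shows "188 * r ^ 6 \<le> exp (7 / 10 * (b * r))"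
proof -
  define r0 :: real where "r0 = 447 / 10"
  have r0: "r0 > 0" by (simp add: r0_def)
  \<comment> \<open>The number 28.37 is just below \<open>0.7 * 0.9068 * 44.7\<close>, the least
    exponent on the right; it is split as \<open>28 + 0.37\<close> in order to use a bound for
    \<open>exp 1\<close>.\<close>
  have e1: "2718 / 1000 \<le> exp (1 :: real)" using e_approx_32 by (simp add: abs_if split: if_splits)
  have "188 * r0 ^ 6 \<le> (2718 / 1000) ^ 28 * (137 / 100)" by (simp add: r0_def power_divide)
  also have "\<dots> \<le> exp 1 ^ 28 * exp (37 / 100)"
    using e1 exp_ge_add_one_self[of "37 / 100 :: real"] by (intro mult_mono power_mono) auto
  also have "\<dots> = exp (28 * 1) * exp (37 / 100 :: real)"
    using exp_of_nat_mult[of 28 "1 :: real"] by simp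
  also have "\<dots> = exp (2837 / 100 :: real)" unfolding exp_add[symmetric] by simp
  finally have base: "188 * r0 ^ 6 \<le> exp (2837 / 100)" .
  have "r / r0 \<le> exp (r / r0 - 1)" using exp_ge_add_one_self[of "r / r0 - 1"] by simp
  then have "(r / r0) ^ 6 \<le> exp (r / r0 - 1) ^ 6" using r r0 by (intro power_mono) auto
  also have "\<dots> = exp (6 * (r / r0 - 1))" using exp_of_nat_mult[of 6 "r / r0 - 1"] by simp
  finally have growth: "(r / r0) ^ 6 \<le> exp (6 * (r / r0 - 1))" .
  have "188 * r ^ 6 = 188 * r0 ^ 6 * (r / r0) ^ 6" using r0 by (simp add: power_divide)
  also have "\<dots> \<le> exp (2837 / 100) * exp (6 * (r / r0 - 1))"
    using base growth r r0 by (intro mult_mono) auto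
  also have "\<dots> = exp (2837 / 100 + 6 * (r / r0 - 1))" by (rule exp_add[symmetric])
  also have "\<dots> \<le> exp (7 / 10 * (b * r))"
  proof -
    have "9068 / 10000 * r \<le> b * r" using b r by (intro mult_right_mono) auto
    moreover have "2837 / 100 + 6 * (r / r0 - 1) \<le> 7 / 10 * (9068 / 10000 * r)"
      using r by (simp add: r0_def)
    ultimately show ?thesis by simp
  qed
  finally show ?thesis .
qed

text \<open>The error is measured by \<open>X^(-9/4)\<close> at one common \<open>X\<close> to the
  left, so that the same bound serves four consecutive values of q. The power 9 of
  \<open>X^(-1/4)\<close> is the largest order that \<open>e - f\<close> may have, as
  \<open>4 * e^2 * f\<close> is of order \<open>X^(-18/4)\<close>.\<close>

lemma q_relative_error:
  assumes n: "n \<ge> 2000" and X: "1 \<le> X" "X \<le> real n + 1 / 24"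
  shows "\<bar>sqrt 2 * real (q n) - bes (pi\<^sup>2 / 12) (real n + 1 / 24)\<bar>
    \<le> 35 / 1000 * (1 / sqrt (sqrt X)) ^ 9 * bes (pi\<^sup>2 / 12) (real n + 1 / 24)"
proof -
  define a where "a = pi\<^sup>2 / 12"
  define b where "b = sqrt a"
  define x where "x = real n + 1 / 24"
  have x: "x \<ge> 2000" using n by (simp add: x_def)
  have a: "(9068 / 10000)\<^sup>2 \<le> a" "a \<le> (907 / 1000)\<^sup>2"
  proof -
    have "(3.141592653588)\<^sup>2 \<le> pi\<^sup>2" "pi\<^sup>2 \<le> (3.1415926535899)\<^sup>2"
      using pi_approx by (intro power_mono; simp)+
    then show "(9068 / 10000)\<^sup>2 \<le> a" "a \<le> (907 / 1000)\<^sup>2" by (simp_all add: a_def power2_eq_square)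
  qed
  then have "sqrt ((9068 / 10000)\<^sup>2) \<le> b" "b \<le> sqrt ((907 / 1000)\<^sup>2)"
    unfolding b_def by (simp_all only: real_sqrt_le_iff)
  then have b: "0.9068 \<le> b" "b \<le> 0.907" by simp_all
  have ba: "b\<^sup>2 = a" unfolding b_def a_def by simp
  have "0 < a" by (simp add: a_def)
  then have y: "sqrt (a * x) = b * sqrt x" by (simp add: b_def real_sqrt_mult)
  have "sqrt ((447 / 10)\<^sup>2) \<le> sqrt x" using x by (simp only: real_sqrt_le_iff) (simp add: power2_eq_square)
  then have "447 / 10 \<le> sqrt x" by simp
  then have "188 * sqrt x ^ 6 \<le> exp (7 / 10 * (b * sqrt x))"
    using b by (intro exp_dominates_power6) auto
  moreover have "sqrt x ^ 6 = x ^ 3" using x by (simp add: eval_nat_numeral)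
  moreover have "x ^ 3 = exp (3 * ln x)"
  proof -
    have "exp (ln x) ^ 3 = exp (of_nat 3 * ln x)" by (rule exp_of_nat_mult[symmetric])
    then show ?thesis using x by simp
  qed
  ultimately have main: "188 * exp (3 * ln x) \<le> exp (7 / 10 * (b * sqrt x))" by simp
  have W: "exp (- (9 / 4 * ln x)) \<le> (1 / sqrt (sqrt X)) ^ 9"
  proof -
    have "sqrt (sqrt X) = exp (ln X / 4)"
    proof (rule real_sqrt_unique)
      have "(exp (ln X / 4))\<^sup>2 = exp (ln X / 2)" by (simp add: exp_double[symmetric])
      moreover have "(exp (ln X / 2))\<^sup>2 = X" using X(1) by (simp add: exp_double[symmetric])
      ultimately show "(exp (ln X / 4))\<^sup>2 = sqrt X" by (metis exp_ge_zero real_sqrt_unique)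
    qed simp
    then have "(1 / sqrt (sqrt X)) ^ 9 = exp (- (ln X / 4)) ^ 9" by (simp add: exp_minus inverse_eq_divide)
    also have "\<dots> = exp (of_nat 9 * (- (ln X / 4)))" by (rule exp_of_nat_mult[symmetric])
    finally have "(1 / sqrt (sqrt X)) ^ 9 = exp (- (9 / 4 * ln X))" by simp
    moreover have "ln X \<le> ln x" using X by (simp add: x_def)
    ultimately show ?thesis by simp
  qed
  \<comment> \<open>The product \<open>0.035 * 0.19 * 188\<close> is just above
    \<open>5 / 4\<close>.\<close>
  have "5 / 4 * exp (13 / 10 * (b * sqrt x)) \<le>
      35 / 1000 * 0.19 * (188 * exp (3 * ln x)) * exp (13 / 10 * (b * sqrt x) - 3 * ln x)"
    by (simp add: exp_diff)
  also have "\<dots> \<le> 35 / 1000 * 0.19 * exp (7 / 10 * (b * sqrt x)) * exp (13 / 10 * (b * sqrt x) - 3 * ln x)"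
    using main by simp
  also have "\<dots> = 35 / 1000 * exp (- (9 / 4 * ln x)) * (0.19 * exp (2 * b * sqrt x - 3 / 4 * ln x))"
    by (simp add: mult_exp_exp)
  also have "\<dots> \<le> 35 / 1000 * (1 / sqrt (sqrt X)) ^ 9 * bes (b\<^sup>2) x"
    using W b x X by (intro mult_mono bes_lower_bound) auto
  finally have "5 / 4 * exp (13 / 10 * sqrt (a * x)) \<le> 35 / 1000 * (1 / sqrt (sqrt X)) ^ 9 * bes a x"
    unfolding y ba .
  then show ?thesis using q_bes_approx[OF n] unfolding a_def x_def by linarith
qed

text \<open>For small \<open>d\<close> the quotient \<open>(1 + d) / (1 - d)\<close> is at most
  \<open>1 + 2.001 * d\<close>; multiplied by the bound 1.03 for the ratio this stays below
  2.07.\<close>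

lemma ratio_perturbation:
  fixes M N Q P d :: real
  assumes M: "M > 0" and N: "N > 0" and Q: "\<bar>Q - M\<bar> \<le> d * M" and P: "\<bar>P - N\<bar> \<le> d * N"
    and d: "0 \<le> d" "d \<le> 1 / 10000" and R: "N / M \<le> 103 / 100"
  shows "\<bar>P / Q - N / M\<bar> \<le> 207 / 100 * d" "Q > 0"
proof -
  have Ql: "(1 - d) * M \<le> Q" and Qu: "Q \<le> (1 + d) * M" and Pl: "(1 - d) * N \<le> P" and Pu: "P \<le> (1 + d) * N"
    using Q P by (simp_all add: abs_le_iff algebra_simps)
  have "0 < (1 - d) * M" using d M by simp
  then show Q0: "Q > 0" using Ql by linarith
  have R0: "0 < N / M" using M N by simp
  have "P / Q \<le> ((1 + d) * N) / ((1 - d) * M)"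
    using Pu Ql \<open>0 < (1 - d) * M\<close> N d by (intro frac_le) auto
  also have "\<dots> = (1 + d) / (1 - d) * (N / M)" by simp
  also have "\<dots> \<le> (1 + 2001 / 1000 * d) * (N / M)"
  proof (intro mult_right_mono)
    have "d * (d * 2001 / 1000) \<le> d * (1 / 1000)" using d by (intro mult_left_mono) auto
    then have "1 + d \<le> (1 + 2001 / 1000 * d) * (1 - d)" by (simp add: algebra_simps)
    then show "(1 + d) / (1 - d) \<le> 1 + 2001 / 1000 * d" using d by (simp add: pos_divide_le_eq)
  qed (use R0 in simp)
  finally have up: "P / Q \<le> (1 + 2001 / 1000 * d) * (N / M)" .
  have "(1 - 2 * d) * (N / M) \<le> (1 - d) / (1 + d) * (N / M)"
  proof (intro mult_right_mono)
    have "(1 - 2 * d) * (1 + d) \<le> 1 - d" using d by (simp add: algebra_simps)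
    then show "1 - 2 * d \<le> (1 - d) / (1 + d)" using d by (simp add: pos_le_divide_eq)
  qed (use R0 in simp)
  also have "\<dots> = ((1 - d) * N) / ((1 + d) * M)" by simp
  also have "\<dots> \<le> P / Q"
  proof (rule frac_le)
    have "0 \<le> (1 - d) * N" using N d by simp
    then show "0 \<le> P" using Pl by linarith
  qed (use Pl Qu Q0 in auto)
  finally have lo: "(1 - 2 * d) * (N / M) \<le> P / Q" .
  define y where "y = d * (N / M)"
  have "y \<le> d * (103 / 100)" unfolding y_def by (rule mult_left_mono[OF R d(1)])
  then have y: "100 * y \<le> 103 * d" by simp
  have "P / Q \<le> N / M + 2001 / 1000 * y" "N / M - 2 * y \<le> P / Q"
    using up lo unfolding y_def left_diff_distrib distrib_right mult.assoc by simp_all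
  with y d(1) show "\<bar>P / Q - N / M\<bar> \<le> 207 / 100 * d"
    by (intro abs_leI) linarith+
qed

text \<open>All ratios are those of M up to \<open>2.07 * d\<close>. This is negligible against
  \<open>e\<close> and \<open>f\<close>, of order \<open>W^6\<close>, but it is the larger part of
  the bound for \<open>e - f\<close>.\<close>

lemma turan_at_large:
  assumes n: "n \<ge> 2001"
  shows "turan_at (q (n - 1)) (q n) (q (n + 1)) (q (n + 2))"
proof -
  define a where "a = pi\<^sup>2 / 12"
  define b where "b = sqrt a"
  define X where "X = real (n - 1) + 1 / 24"
  define W where "W = 1 / sqrt (sqrt X)"
  define d where "d = 35 / 1000 * W ^ 9"
  define M where "M k = bes a (X + real k)" for k
  define Q where "Q k = real (q (n - 1 + k))" for k
  define R where "R k = M (Suc k) / M k" for k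
  define r where "r k = Q (Suc k) / Q k" for k
  have X: "X \<ge> 2000" using n by (simp add: X_def)
  have a: "(9068 / 10000)\<^sup>2 \<le> a" "a \<le> (907 / 1000)\<^sup>2"
  proof -
    have "(3.141592653588)\<^sup>2 \<le> pi\<^sup>2" "pi\<^sup>2 \<le> (3.1415926535899)\<^sup>2"
      using pi_approx by (intro power_mono; simp)+
    then show "(9068 / 10000)\<^sup>2 \<le> a" "a \<le> (907 / 1000)\<^sup>2" by (simp_all add: a_def power2_eq_square)
  qed
  then have "sqrt ((9068 / 10000)\<^sup>2) \<le> b" "b \<le> sqrt ((907 / 1000)\<^sup>2)"
    unfolding b_def by (simp_all only: real_sqrt_le_iff)
  then have b: "0.9068 \<le> b" "b \<le> 0.907" by simp_all
  have ba: "b\<^sup>2 = a" unfolding b_def a_def by simp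
  have a0: "a > 0" by (simp add: a_def)
  have M0: "M k > 0" for k unfolding M_def using a0 X by (intro bes_pos(1)) auto
  have W: "0 < W" "W \<le> 15 / 100"
  proof -
    show "0 < W" using X by (simp add: W_def)
    have "sqrt (sqrt (((20 / 3)\<^sup>2)\<^sup>2)) \<le> sqrt (sqrt X)"
      using X by (simp only: real_sqrt_le_iff) (simp add: power2_eq_square)
    also have "sqrt (sqrt (((20 / 3)\<^sup>2)\<^sup>2)) = 20 / 3" by (simp only: real_sqrt_abs abs_power2)
    finally have "1 / sqrt (sqrt X) \<le> 1 / (20 / 3)" by (intro divide_left_mono mult_pos_pos) (use X in auto)
    then show "W \<le> 15 / 100" by (simp add: W_def)
  qed
  have WU: "W\<^sup>2 = 1 / sqrt X" using X by (simp add: W_def power_divide)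
  have W3: "W ^ 3 \<le> 34 / 10000"
  proof -
    have "W ^ 3 \<le> (15 / 100) ^ 3" using W by (intro power_mono) auto
    then show ?thesis by (simp add: power3_eq_cube)
  qed
  have d: "0 \<le> d" "d \<le> 1 / 10000" "d \<le> 35 / 1000 * (34 / 10000) * W ^ 6"
  proof -
    show "0 \<le> d" using W by (simp add: d_def)
    have "W ^ 9 = W ^ 3 * W ^ 6" by (simp flip: power_add)
    also have "\<dots> \<le> 34 / 10000 * W ^ 6" using W3 W by (intro mult_right_mono) auto
    finally show 1: "d \<le> 35 / 1000 * (34 / 10000) * W ^ 6" by (simp add: d_def)
    have "W ^ 6 \<le> (15 / 100) ^ 6" using W by (intro power_mono) auto
    also have "\<dots> \<le> 1 / 10" by (simp add: power_numeral_reduce)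
    finally have "W ^ 6 \<le> 1 / 10" .
    then show "d \<le> 1 / 10000" using 1 by linarith
  qed
  have err: "\<bar>sqrt 2 * Q k - M k\<bar> \<le> d * M k" for k
  proof -
    have x: "real (n - 1 + k) + 1 / 24 = X + real k" by (simp add: X_def)
    show ?thesis
      using q_relative_error[of "n - 1 + k" X] n X
      unfolding x Q_def M_def d_def W_def a_def by simp
  qed
  have B: "43 / 100 * W ^ 6 \<le> R 0 - R 1" "43 / 100 * W ^ 6 \<le> R 1 - R 2"
    "\<bar>R 0 - 2 * R 1 + R 2\<bar> \<le> 14 / 10 * W ^ 10" "\<And>k. R k \<le> 103 / 100"
  proof -
    have X': "1999 \<le> X" using X by simp
    note * = bes_ratio_bounds[OF b X', unfolded ba WU[symmetric] power_mult[symmetric]]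
    have Rk: "R k = bes a (X + real k + 1) / bes a (X + real k)" for k
      by (simp add: R_def M_def add_ac)
    have R0: "R 0 = bes a (X + 1) / bes a X" and R1: "R 1 = bes a (X + 1 + 1) / bes a (X + 1)"
      and R2: "R 2 = bes a (X + 2 + 1) / bes a (X + 2)"
      using Rk[of 0] Rk[of 1] Rk[of 2] by (simp_all only: of_nat_0 of_nat_1 of_nat_numeral add_0_right)
    show "43 / 100 * W ^ 6 \<le> R 0 - R 1" "43 / 100 * W ^ 6 \<le> R 1 - R 2"
      "\<bar>R 0 - 2 * R 1 + R 2\<bar> \<le> 14 / 10 * W ^ 10"
      unfolding R0 R1 R2 using *(1-3) by simp_all
    show "R k \<le> 103 / 100" for k unfolding Rk using *(4)[of "X + real k"] by simp
  qed
  have rR: "\<bar>r k - R k\<bar> \<le> 207 / 100 * d" and Q0: "Q k > 0" for k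
  proof -
    note * = ratio_perturbation[OF M0[of k] M0[of "Suc k"] err[of k] err[of "Suc k"] d(1,2) B(4)[of k, unfolded R_def]]
    have "r k = (sqrt 2 * Q (Suc k)) / (sqrt 2 * Q k)" by (simp add: r_def)
    then show "\<bar>r k - R k\<bar> \<le> 207 / 100 * d" using *(1) by (simp only: R_def)
    show "Q k > 0" using *(2) by (simp add: zero_less_mult_iff)
  qed
  define e where "e = r 0 - r 1"
  define f where "f = r 1 - r 2"
  have W6: "0 < W ^ 6" using W by simp
  have e: "4295 / 10000 * W ^ 6 \<le> e" and f: "4295 / 10000 * W ^ 6 \<le> f"
    using rR[of 0] rR[of 1] rR[of 2] B(1,2) d(3) W6 unfolding e_def f_def abs_le_iff by linarith+
  \<comment> \<open>The difference \<open>e - f\<close> involves the error of a ratio four times,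
    \<open>8.28 * 0.035 = 0.2898\<close>; the second difference for M contributes
    \<open>1.4 * 0.15 = 0.21\<close>.\<close>
  have ef: "\<bar>e - f\<bar> \<le> 4998 / 10000 * W ^ 9"
  proof -
    have "W ^ 10 = W * W ^ 9" by (simp add: eval_nat_numeral)
    also have "\<dots> \<le> 15 / 100 * W ^ 9" using W by (intro mult_right_mono) auto
    finally have W10: "W ^ 10 \<le> 15 / 100 * W ^ 9" .
    have "\<bar>e - f\<bar> \<le> 14 / 10 * W ^ 10 + 828 / 100 * d"
      using rR[of 0] rR[of 1] rR[of 2] B(3) unfolding e_def f_def abs_le_iff by linarith
    then show ?thesis using W10 unfolding d_def by linarith
  qed
  have r1: "r 1 \<le> 104 / 100" "0 \<le> r 1"
    using rR[of 1] B(4)[of 1] d(2) Q0 unfolding abs_le_iff by (linarith, simp add: r_def less_imp_le)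
  \<comment> \<open>Both sides have order \<open>W^18\<close>; the constants are about 0.26 on the
    left and 0.31 on the right.\<close>
  have key: "r 1 * (e - f)\<^sup>2 \<le> 4 * e\<^sup>2 * f"
  proof -
    have "(e - f)\<^sup>2 \<le> (4998 / 10000 * W ^ 9)\<^sup>2" using ef W by (intro abs_le_square_iff[THEN iffD1]) simp
    then have "r 1 * (e - f)\<^sup>2 \<le> 104 / 100 * (4998 / 10000 * W ^ 9)\<^sup>2"
      using r1 by (intro mult_mono) auto
    also have "\<dots> = 104 / 100 * (4998 / 10000)\<^sup>2 * W ^ 18"
      by (simp add: power_mult_distrib power_divide flip: power_mult)
    also have "\<dots> \<le> 4 * (4295 / 10000) ^ 3 * W ^ 18"
      using W by (intro mult_right_mono) (simp_all add: power2_eq_square power3_eq_cube)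
    also have "\<dots> = 4 * (4295 / 10000 * W ^ 6)\<^sup>2 * (4295 / 10000 * W ^ 6)"
      by (simp add: power2_eq_square power3_eq_cube eval_nat_numeral)
    also have "\<dots> \<le> 4 * e\<^sup>2 * f" using e f W6 by (intro mult_mono power_mono) auto
    finally show ?thesis .
  qed
  have "1 \<le> n" using n by simp
  then have Qs: "Q 0 = q (n - 1)" "Q 1 = q n" "Q 2 = q (n + 1)" "Q 3 = q (n + 2)"
    by (simp_all add: Q_def numeral_2_eq_2 numeral_3_eq_3 Suc_diff_le)
  have rs: "r 0 = Q 1 / Q 0" "r 1 = Q 2 / Q 1" "r 2 = Q 3 / Q 2"
    by (simp_all add: r_def numeral_2_eq_2 numeral_3_eq_3)
  have "r 1 \<le> r 0" using e W6 unfolding e_def by linarith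
  then show ?thesis
    using log_concave_of_ratios[of "Q 0" "Q 1" "Q 2"] turan_of_ratios[of "Q 0" "Q 1" "Q 2" "Q 3"] key Q0
    unfolding turan_at_def Qs[symmetric] rs e_def f_def by simp
qed

theorem mainTheorem1:
  shows "(\<forall>n::nat. n \<ge> 33 \<longrightarrow> int (q n) ^ 2 \<ge> int (q (n - 1)) * int (q (n + 1)))
    \<and> (\<forall>n::nat. n \<ge> 121 \<longrightarrow>
        4 * (int (q n) ^ 2 - int (q (n - 1)) * int (q (n + 1)))
          * (int (q (n + 1)) ^ 2 - int (q n) * int (q (n + 2)))
        \<ge> (int (q n) * int (q (n + 1)) - int (q (n - 1)) * int (q (n + 2))) ^ 2)"
proof (intro conjI allI impI)
  fix n :: nat assume n: "33 \<le> n"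
  have "q (n - 1) * q (n + 1) \<le> (q n)\<^sup>2"
  proof (cases "n \<le> 2001")
    case True
    then show ?thesis using q_inequalities_small(1) n by blast
  next
    case False
    then have "real (q (n - 1)) * real (q (n + 1)) \<le> (real (q n))\<^sup>2"
      using turan_at_large[of n] by (simp add: turan_at_def)
    then show ?thesis by (metis of_nat_le_iff of_nat_mult of_nat_power)
  qed
  then show "int (q (n - 1)) * int (q (n + 1)) \<le> int (q n) ^ 2"
    by (metis of_nat_le_iff of_nat_mult of_nat_power)
next
  fix n :: nat assume n: "121 \<le> n"
  have "turan_at (q (n - 1)) (q n) (q (n + 1)) (q (n + 2))"
  proof (cases "n \<le> 2001")
    case True
    then show ?thesis using q_inequalities_small(2) n by blast
  qed (use turan_at_large[of n] in simp)
  then have "real_of_int ((int (q n) * int (q (n + 1)) - int (q (n - 1)) * int (q (n + 2))) ^ 2) \<le>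
      real_of_int (4 * (int (q n) ^ 2 - int (q (n - 1)) * int (q (n + 1)))
          * (int (q (n + 1)) ^ 2 - int (q n) * int (q (n + 2))))"
    by (simp add: turan_at_def)
  then show "(int (q n) * int (q (n + 1)) - int (q (n - 1)) * int (q (n + 2))) ^ 2 \<le>
      4 * (int (q n) ^ 2 - int (q (n - 1)) * int (q (n + 1)))
          * (int (q (n + 1)) ^ 2 - int (q n) * int (q (n + 2)))"
    by (simp only: of_int_le_iff)
qed

end
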